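(* Let $M$ be the McLain group of a non-empty totally ordered set $(\Lambda,\leq)$ over a ring $R$ with $1\neq0$, let $F$ be a field such that $R$ admits a right primitive linear character $R^+\to F^*$, let $D$ be a basic subset of $\Phi$ and $f$ a function from $D$ into the set of right primitive linear characters $R^+\to F^*$. With $H\le I\le M$ and $\Omega$ associated to $D$ as in the context, the following conditions are equivalent: (a) $V(D,f)$ is irreducible. (b) $D$ is non-overlapping. (c) $\Omega=\emptyset$. (d) $I=H$. (e) $(V(D,f),V(D,f))_M=1$.
   Context: Modules are over the field $F$ and may be infinite dimensional; $(X,Y)_G=\dim_F\mathrm{Hom}_{FG}(X,Y)$; $\mathrm{ind}_H^GW=FG\otimes_{FH}W$. $R$ and $\Lambda$ may be infinite and $R$ need not be commutative. McLain group: $\Phi=\{(\alpha,\beta)\in\Lambda\times\Lambda:\alpha<\beta\}$. $J$ is the free left $R$-module with basis $e_{\alpha\beta}$, $(\alpha,\beta)\in\Phi$, made into a ring by $(re_{\alpha\beta})(se_{\beta\gamma})=rs\,e_{\alpha\gamma}$ and $(re_{\alpha\beta})(se_{\gamma\delta})=0$ if $\beta\neq\gamma$, extended additively. $J$ is nil, and $M=\{1+x:x\in J\}$ is a group under multiplication. $M_{\alpha\beta}=\{1+re_{\alpha\beta}:r\in R\}$. A subset $\Delta\subseteq\Phi$ is closed if $(\alpha,\beta),(\beta,\gamma)\in\Delta$ implies $(\alpha,\gamma)\in\Delta$; then $M(\Delta)=\langle M_{\alpha\beta}:(\alpha,\beta)\in\Delta\rangle$. A group homomorphism $R^+\to F^*$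 (linear character) is right primitive if the only right ideal of $R$ contained in its kernel is $(0)$. Elementary modules: let $(\alpha,\beta)\in\Phi$ and let $\mu:R^+\to F^*$ be right primitive. Let $L$ be the subgroup generated by all $M_{\gamma\delta}$ with $\alpha\le\gamma<\delta\le\beta$; let $P$ be the subgroup of $L$ generated by all $M_{\gamma\beta}$ with $\alpha\le\gamma<\beta$ and all $M_{\gamma\delta}$ with $\alpha<\gamma<\delta<\beta$. There is a $1$-dimensional $P$-module on which $1+re_{\alpha\beta}$ acts as $\mu(r)$ and all the other listed generators act trivially; $V(\alpha,\beta,\mu)$ is the $L$-module induced from it, viewed as an $M$-module through $M=N\rtimes L$, where $N$ is the normal subgroup generated by all $M_{\gamma\delta}$ with $\gamma<\alpha$ or $\delta>\beta$, and $N$ acts trivially. Basic modules: a finite non-empty subset $D=\{(\alpha_1,\beta_1),\dots,(\alpha_m,\beta_m)\}$ of $\Phi$ is basic if the $\alpha_i$ are distinct and the $\beta_i$ are distinct. Write $f(\alpha_i,\beta_i)=\lambda_i$. The basic $M$-module is $V(D,f)=V(\alpha_m,\beta_m,\lambda_m)\otimes_F\cdots\otimes_FV(\alpha_1,\beta_1,\lambda_1)$ with diagonal action. Notation attached to $D$: $\Gamma=\Phi\setminus\bigcup_i\{(\alpha_i,\gamma)\in\Phi:\gamma<\beta_i\}$, $H=M(\Gamma)$, $\Omega=\{(\alpha,\gamma)\in\Phi:\exists\,(\alpha,\beta),(\gamma,\delta)\in D\text{ with }\alpha<\gamma<\beta<\delta\}$, $\Gamma_1=\Gamma\cup\Omega$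 (a closed subset of $\Phi$), $I=M(\Gamma_1)$. For $\alpha<\beta$ and $\gamma<\delta$ in $\Lambda$, the open intervals $(\alpha,\beta)$ and $(\gamma,\delta)$ of $\Lambda$ are overlapping if $\alpha<\gamma<\beta<\delta$ or $\gamma<\alpha<\delta<\beta$. $D$ is non-overlapping if no two of the intervals $(\alpha_i,\beta_i)$, $(\alpha_j,\beta_j)$ determined by elements of $D$ are overlapping. *)

theory Defs
  imports
    "HOL-Algebra.Generated_Groups"
    "HOL-Algebra.Ideal"
    "HOL-Library.Extended_Nat"
    "Jordan_Normal_Form.VS_Connect"
begin

(* The coefficient ring R, the field F and the ordered set Lambda are types of class ring_1, field
   and linorder; class_ring turns R and F into HOL-Algebra records, so that the carrier-based
   notions of HOL-Algebra (groups, modules) and of VectorSpace apply. *)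

section \<open>McLain groups\<close>

definition Phi :: "('l::linorder \<times> 'l) set" where
  "Phi = {(\<alpha>, \<beta>). \<alpha> < \<beta>}"

(* x represents the finite sum of the x (\<alpha>, \<beta>) e_{\<alpha>\<beta>} *)
definition mclain_ring :: "('l::linorder \<times> 'l \<Rightarrow> 'r::ring_1) set" where
  "mclain_ring = {x. finite {p. x p \<noteq> 0} \<and> {p. x p \<noteq> 0} \<subseteq> Phi}"

(* biadditive extension of (r e_{\<alpha>\<beta>}) (s e_{\<beta>\<gamma>}) = r s e_{\<alpha>\<gamma>}; the index set is finite on mclain_ring *)
definition mclain_ring_mult ::
    "('l::linorder \<times> 'l \<Rightarrow> 'r::ring_1) \<Rightarrow> ('l \<times> 'l \<Rightarrow> 'r) \<Rightarrow> 'l \<times> 'l \<Rightarrow> 'r" where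
  "mclain_ring_mult x y =
     (\<lambda>(\<alpha>, \<gamma>). \<Sum>\<beta> | x (\<alpha>, \<beta>) \<noteq> 0 \<and> y (\<beta>, \<gamma>) \<noteq> 0. x (\<alpha>, \<beta>) * y (\<beta>, \<gamma>))"

(* The element 1 + x of the group is represented by x, so that the product is given by
   (1 + x) (1 + y) = 1 + (x + y + x y). *)
definition mclain_group :: "('l::linorder \<times> 'l \<Rightarrow> 'r::ring_1) monoid" where
  "mclain_group =
     \<lparr>carrier = mclain_ring,
      mult = (\<lambda>x y p. x p + y p + mclain_ring_mult x y p),
      one = (\<lambda>_. 0)\<rparr>"

(* represents 1 + r e_p *)
definition root_elt :: "'r::ring_1 \<Rightarrow> 'l::linorder \<times> 'l \<Rightarrow> ('l \<times> 'l \<Rightarrow> 'r)" where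
  "root_elt r p = (\<lambda>q. if q = p then r else 0)"

definition root_subgroup :: "'l::linorder \<times> 'l \<Rightarrow> ('l \<times> 'l \<Rightarrow> 'r::ring_1) set" where
  "root_subgroup p = range (\<lambda>r. root_elt r p)"

definition closed_roots :: "('l::linorder \<times> 'l) set \<Rightarrow> bool" where
  "closed_roots \<Delta> \<longleftrightarrow>
     \<Delta> \<subseteq> Phi \<and> (\<forall>\<alpha> \<beta> \<gamma>. (\<alpha>, \<beta>) \<in> \<Delta> \<and> (\<beta>, \<gamma>) \<in> \<Delta> \<longrightarrow> (\<alpha>, \<gamma>) \<in> \<Delta>)"

definition mclain_subgroup :: "('l::linorder \<times> 'l) set \<Rightarrow> ('l \<times> 'l \<Rightarrow> 'r::ring_1) set" where
  "mclain_subgroup \<Delta> = generate mclain_group (\<Union>p\<in>\<Delta>. root_subgroup p)"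


section \<open>Right primitive linear characters\<close>

definition linear_char :: "('r::ring_1 \<Rightarrow> 'f::field) \<Rightarrow> bool" where
  "linear_char \<mu> \<longleftrightarrow> \<mu> \<in> hom (add_monoid class_ring) (units_of class_ring)"

definition right_ideal :: "'r::ring_1 set \<Rightarrow> bool" where
  "right_ideal I \<longleftrightarrow> additive_subgroup I class_ring \<and> (\<forall>x\<in>I. \<forall>r. x * r \<in> I)"

definition right_primitive :: "('r::ring_1 \<Rightarrow> 'f::field) \<Rightarrow> bool" where
  "right_primitive \<mu> \<longleftrightarrow> linear_char \<mu> \<and>
     (\<forall>I. right_ideal I \<and> I \<subseteq> kernel (add_monoid class_ring) (units_of class_ring) \<mu> \<longrightarrow> I = {0})"


section \<open>Group representations over a field\<close>

(* An FG-module: an F-vector space with an action of the elements of G. The ring fields mult and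
   one that module records inherit are irrelevant. *)
record ('f, 'v, 'g) rep = "('f, 'v) module" +
  act :: "'g \<Rightarrow> 'v \<Rightarrow> 'v"

definition irreducible_rep :: "('g, 'm) monoid_scheme \<Rightarrow> ('f::field, 'v, 'g) rep \<Rightarrow> bool" where
  "irreducible_rep G V \<longleftrightarrow> carrier V \<noteq> {\<zero>\<^bsub>V\<^esub>} \<and>
     (\<forall>U. subspace class_ring U V \<and> (\<forall>g\<in>carrier G. \<forall>u\<in>U. act V g u \<in> U)
        \<longrightarrow> U = {\<zero>\<^bsub>V\<^esub>} \<or> U = carrier V)"

(* Hom_{FG}(X, Y); extensional functions, so that a homomorphism is determined on the carrier of X *)
definition hom_space ::
    "('g, 'm) monoid_scheme \<Rightarrow> ('f::field, 'v, 'g) rep \<Rightarrow> ('f, 'w, 'g) rep \<Rightarrow> ('f, 'v \<Rightarrow> 'w) module"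
  where
  "hom_space G X Y =
     \<lparr>carrier = {\<phi> \<in> extensional (carrier X). \<phi> \<in> module_hom class_ring X Y \<and>
                  (\<forall>g\<in>carrier G. \<forall>x\<in>carrier X. \<phi> (act X g x) = act Y g (\<phi> x))},
      mult = undefined, one = undefined,
      zero = (\<lambda>x\<in>carrier X. \<zero>\<^bsub>Y\<^esub>),
      add = (\<lambda>\<phi> \<psi>. \<lambda>x\<in>carrier X. \<phi> x \<oplus>\<^bsub>Y\<^esub> \<psi> x),
      smult = (\<lambda>c \<phi>. \<lambda>x\<in>carrier X. c \<odot>\<^bsub>Y\<^esub> \<phi> x)\<rparr>"

definition intertwining_number ::
    "('g, 'm) monoid_scheme \<Rightarrow> ('f::field, 'v, 'g) rep \<Rightarrow> ('f, 'w, 'g) rep \<Rightarrow> enat" where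
  "intertwining_number G X Y =
     (if vectorspace.fin_dim class_ring (hom_space G X Y)
      then enat (vectorspace.dim class_ring (hom_space G X Y)) else \<infinity>)"

definition char_rep :: "('g \<Rightarrow> 'f::field) \<Rightarrow> ('f, 'f, 'g) rep" where
  "char_rep \<chi> =
     \<lparr>carrier = UNIV, mult = undefined, one = undefined, zero = 0, add = (+), smult = (*),
      act = (\<lambda>g c. \<chi> g * c)\<rparr>"

definition quotient_rep ::
    "('f::field, 'v, 'g) rep \<Rightarrow> 'v set \<Rightarrow> ('f, 'v set, 'g) rep" where
  "quotient_rep V N =
     \<lparr>carrier = a_rcosets\<^bsub>V\<^esub> N, mult = undefined, one = undefined,
      zero = N, add = set_add V,
      smult = (\<lambda>c X. \<Union>x\<in>X. N +>\<^bsub>V\<^esub> (c \<odot>\<^bsub>V\<^esub> x)),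
      act = (\<lambda>g X. \<Union>x\<in>X. N +>\<^bsub>V\<^esub> act V g x)\<rparr>"

(* image of a finitely supported function under the linear extension of a map of basis elements *)
definition lin_ext :: "('s \<Rightarrow> 't) \<Rightarrow> ('s \<Rightarrow> 'f::field) \<Rightarrow> 't \<Rightarrow> 'f" where
  "lin_ext \<sigma> \<phi> = (\<lambda>t. \<Sum>s | \<phi> s \<noteq> 0 \<and> \<sigma> s = t. \<phi> s)"

definition basis_elt :: "'s \<Rightarrow> 's \<Rightarrow> 'f::field" where
  "basis_elt s = (\<lambda>t. if t = s then 1 else 0)"

(* the vector space with basis S on which g acts by permuting S through \<sigma> g *)
definition free_rep :: "'s set \<Rightarrow> ('g \<Rightarrow> 's \<Rightarrow> 's) \<Rightarrow> ('f::field, 's \<Rightarrow> 'f, 'g) rep" where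
  "free_rep S \<sigma> =
     \<lparr>carrier = {\<phi>. finite {s. \<phi> s \<noteq> 0} \<and> {s. \<phi> s \<noteq> 0} \<subseteq> S},
      mult = undefined, one = undefined,
      zero = (\<lambda>_. 0), add = (\<lambda>\<phi> \<psi> s. \<phi> s + \<psi> s), smult = (\<lambda>c \<phi> s. c * \<phi> s),
      act = (\<lambda>g. lin_ext (\<sigma> g))\<rparr>"

definition group_algebra :: "('g, 'm) monoid_scheme \<Rightarrow> ('f::field, 'g \<Rightarrow> 'f, 'g) rep" where
  "group_algebra G = free_rep (carrier G) (\<lambda>g x. g \<otimes>\<^bsub>G\<^esub> x)"

(* FG \<otimes>_{FH} W is the quotient of the free vector space on the pairs (a, w) by the relations below.
   Since FH is spanned by H, the relations (a h, w) = (a, h w) with h in H, together with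
   bilinearity over F, give those for all elements of FH. *)
definition ind_relations ::
    "('g, 'm) monoid_scheme \<Rightarrow> 'g set \<Rightarrow> ('f::field, 'w, 'g) rep \<Rightarrow> (('g \<Rightarrow> 'f) \<times> 'w \<Rightarrow> 'f) set"
  where
  "ind_relations G H W =
     (let A = (group_algebra G :: ('f, 'g \<Rightarrow> 'f, 'g) rep) in
       {(\<lambda>s. basis_elt (a \<oplus>\<^bsub>A\<^esub> b, w) s - (basis_elt (a, w) s + basis_elt (b, w) s)) | a b w.
           a \<in> carrier A \<and> b \<in> carrier A \<and> w \<in> carrier W}
     \<union> {(\<lambda>s. basis_elt (a, v \<oplus>\<^bsub>W\<^esub> w) s - (basis_elt (a, v) s + basis_elt (a, w) s)) | a v w.
           a \<in> carrier A \<and> v \<in> carrier W \<and> w \<in> carrier W}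
     \<union> {(\<lambda>s. basis_elt (c \<odot>\<^bsub>A\<^esub> a, w) s - c * basis_elt (a, w) s) | c a w.
           a \<in> carrier A \<and> w \<in> carrier W}
     \<union> {(\<lambda>s. basis_elt (a, c \<odot>\<^bsub>W\<^esub> w) s - c * basis_elt (a, w) s) | c a w.
           a \<in> carrier A \<and> w \<in> carrier W}
     \<union> {(\<lambda>s. basis_elt (lin_ext (\<lambda>x. x \<otimes>\<^bsub>G\<^esub> h) a, w) s - basis_elt (a, act W h w) s) | a h w.
           a \<in> carrier A \<and> h \<in> H \<and> w \<in> carrier W})"

definition ind_rep ::
    "('g, 'm) monoid_scheme \<Rightarrow> 'g set \<Rightarrow> ('f::field, 'w, 'g) rep
       \<Rightarrow> ('f, (('g \<Rightarrow> 'f) \<times> 'w \<Rightarrow> 'f) set, 'g) rep" where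
  "ind_rep G H W =
     (let E = (free_rep (carrier (group_algebra G :: ('f, 'g \<Rightarrow> 'f, 'g) rep) \<times> carrier W)
                 (\<lambda>g (a, w). (act (group_algebra G) g a, w)) :: ('f, _, 'g) rep)
      in quotient_rep E (module.span class_ring E (ind_relations G H W)))"

(* The tensor product over F of a family V of FG-modules indexed by D, with diagonal action: the
   quotient of the free vector space on the tuples in the product of the V d by the relations of
   multilinearity. *)
definition tensor_relations :: "'d set \<Rightarrow> ('d \<Rightarrow> ('f::field, 'v, 'g) rep) \<Rightarrow> (('d \<Rightarrow> 'v) \<Rightarrow> 'f) set"
  where
  "tensor_relations D V =
     {(\<lambda>s. basis_elt (t(d := v \<oplus>\<^bsub>V d\<^esub> w)) s - (basis_elt (t(d := v)) s + basis_elt (t(d := w)) s))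
         | t d v w. t \<in> (\<Pi>\<^sub>E d\<in>D. carrier (V d)) \<and> d \<in> D \<and> v \<in> carrier (V d) \<and> w \<in> carrier (V d)}
   \<union> {(\<lambda>s. basis_elt (t(d := c \<odot>\<^bsub>V d\<^esub> v)) s - c * basis_elt (t(d := v)) s)
         | t d c v. t \<in> (\<Pi>\<^sub>E d\<in>D. carrier (V d)) \<and> d \<in> D \<and> v \<in> carrier (V d)}"

definition tensor_rep ::
    "'d set \<Rightarrow> ('d \<Rightarrow> ('f::field, 'v, 'g) rep) \<Rightarrow> ('f, (('d \<Rightarrow> 'v) \<Rightarrow> 'f) set, 'g) rep" where
  "tensor_rep D V =
     (let E = (free_rep (\<Pi>\<^sub>E d\<in>D. carrier (V d)) (\<lambda>g t. \<lambda>d\<in>D. act (V d) g (t d)) :: ('f, _, 'g) rep)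
      in quotient_rep E (module.span class_ring E (tensor_relations D V)))"


section \<open>Elementary and basic modules\<close>

definition elem_L :: "'l::linorder \<times> 'l \<Rightarrow> ('l \<times> 'l \<Rightarrow> 'r::ring_1) set" where
  "elem_L = (\<lambda>(\<alpha>, \<beta>). mclain_subgroup {(\<gamma>, \<delta>). \<alpha> \<le> \<gamma> \<and> \<gamma> < \<delta> \<and> \<delta> \<le> \<beta>})"

definition elem_P_roots :: "'l::linorder \<times> 'l \<Rightarrow> ('l \<times> 'l) set" where
  "elem_P_roots = (\<lambda>(\<alpha>, \<beta>).
     {(\<gamma>, \<delta>). \<alpha> \<le> \<gamma> \<and> \<gamma> < \<beta> \<and> \<delta> = \<beta>} \<union> {(\<gamma>, \<delta>). \<alpha> < \<gamma> \<and> \<gamma> < \<delta> \<and> \<delta> < \<beta>})"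

definition elem_P :: "'l::linorder \<times> 'l \<Rightarrow> ('l \<times> 'l \<Rightarrow> 'r::ring_1) set" where
  "elem_P p = mclain_subgroup (elem_P_roots p)"

definition elem_N :: "'l::linorder \<times> 'l \<Rightarrow> ('l \<times> 'l \<Rightarrow> 'r::ring_1) set" where
  "elem_N = (\<lambda>(\<alpha>, \<beta>).
     \<Inter>{N. N \<lhd> mclain_group \<and>
        (\<Union>q \<in> {(\<gamma>, \<delta>). \<gamma> < \<delta> \<and> (\<gamma> < \<alpha> \<or> \<delta> > \<beta>)}. root_subgroup q) \<subseteq> N})"

(* The conditions determine the character on the subgroup elem_P p, and ind_rep uses only its
   values there. *)
definition elem_char ::
    "'l::linorder \<times> 'l \<Rightarrow> ('r::ring_1 \<Rightarrow> 'f::field) \<Rightarrow> ('l \<times> 'l \<Rightarrow> 'r) \<Rightarrow> 'f" where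
  "elem_char p \<mu> = (SOME \<chi>.
     \<chi> \<in> hom (mclain_group\<lparr>carrier := elem_P p\<rparr>) (units_of class_ring) \<and>
     (\<forall>r. \<chi> (root_elt r p) = \<mu> r) \<and>
     (\<forall>q\<in>elem_P_roots p - {p}. \<forall>r. \<chi> (root_elt r q) = 1))"

(* For M = N \<rtimes> L, let M act on an L-module through the projection of M onto L with kernel N. *)
definition inflate ::
    "('g, 'm) monoid_scheme \<Rightarrow> 'g set \<Rightarrow> 'g set \<Rightarrow> ('f::field, 'v, 'g) rep \<Rightarrow> ('f, 'v, 'g) rep" where
  "inflate M N L V =
     V\<lparr>act := (\<lambda>m. act V (THE l. l \<in> L \<and> (\<exists>n\<in>N. m = n \<otimes>\<^bsub>M\<^esub> l)))\<rparr>"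

definition elementary_rep ::
    "'l::linorder \<times> 'l \<Rightarrow> ('r::ring_1 \<Rightarrow> 'f::field)
       \<Rightarrow> ('f, ((('l \<times> 'l \<Rightarrow> 'r) \<Rightarrow> 'f) \<times> 'f \<Rightarrow> 'f) set, 'l \<times> 'l \<Rightarrow> 'r) rep" where
  "elementary_rep p \<mu> =
     inflate mclain_group (elem_N p) (elem_L p)
       (ind_rep (mclain_group\<lparr>carrier := elem_L p\<rparr>) (elem_P p) (char_rep (elem_char p \<mu>)))"

definition basic_set :: "('l::linorder \<times> 'l) set \<Rightarrow> bool" where
  "basic_set D \<longleftrightarrow> finite D \<and> D \<noteq> {} \<and> D \<subseteq> Phi \<and> inj_on fst D \<and> inj_on snd D"

(* V(D, f) *)
definition basic_rep ::
    "('l::linorder \<times> 'l) set \<Rightarrow> ('l \<times> 'l \<Rightarrow> 'r::ring_1 \<Rightarrow> 'f::field)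
       \<Rightarrow> ('f, (('l \<times> 'l \<Rightarrow> ((('l \<times> 'l \<Rightarrow> 'r) \<Rightarrow> 'f) \<times> 'f \<Rightarrow> 'f) set) \<Rightarrow> 'f) set, 'l \<times> 'l \<Rightarrow> 'r) rep"
  where
  "basic_rep D f = tensor_rep D (\<lambda>d. elementary_rep d (f d))"


section \<open>Notation attached to a basic set\<close>

definition Gamma_set :: "('l::linorder \<times> 'l) set \<Rightarrow> ('l \<times> 'l) set" where
  "Gamma_set D = Phi - (\<Union>(\<alpha>, \<beta>)\<in>D. {(\<alpha>', \<gamma>) \<in> Phi. \<alpha>' = \<alpha> \<and> \<gamma> < \<beta>})"

definition H_subgroup :: "('l::linorder \<times> 'l) set \<Rightarrow> ('l \<times> 'l \<Rightarrow> 'r::ring_1) set" where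
  "H_subgroup D = mclain_subgroup (Gamma_set D)"

definition Omega_set :: "('l::linorder \<times> 'l) set \<Rightarrow> ('l \<times> 'l) set" where
  "Omega_set D = {(\<alpha>, \<gamma>) \<in> Phi. \<exists>\<beta> \<delta>. (\<alpha>, \<beta>) \<in> D \<and> (\<gamma>, \<delta>) \<in> D \<and> \<alpha> < \<gamma> \<and> \<gamma> < \<beta> \<and> \<beta> < \<delta>}"

definition I_subgroup :: "('l::linorder \<times> 'l) set \<Rightarrow> ('l \<times> 'l \<Rightarrow> 'r::ring_1) set" where
  "I_subgroup D = mclain_subgroup (Gamma_set D \<union> Omega_set D)"

lemma closed_Gamma_set: "basic_set D \<Longrightarrow> closed_roots (Gamma_set D)"
  unfolding closed_roots_def Gamma_set_def basic_set_def Phi_def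
  by (auto; fastforce)

lemma closed_Gamma_Omega:
  assumes "basic_set D"
  shows "closed_roots (Gamma_set D \<union> Omega_set D)"
proof -
  have inj: "\<And>a b c. (a, b) \<in> D \<Longrightarrow> (a, c) \<in> D \<Longrightarrow> b = c"
    using assms unfolding basic_set_def inj_on_def by force
  have G: "(a, c) \<in> Gamma_set D \<longleftrightarrow> a < c \<and> (\<forall>b. (a, b) \<in> D \<longrightarrow> b \<le> c)" for a c
    unfolding Gamma_set_def Phi_def by (auto simp: not_less)
  have O: "(a, c) \<in> Omega_set D \<longleftrightarrow>
      a < c \<and> (\<exists>b d. (a, b) \<in> D \<and> (c, d) \<in> D \<and> c < b \<and> b < d)" for a c
    unfolding Omega_set_def Phi_def by auto
  show ?thesis
    unfolding closed_roots_def
  proof (intro conjI allI impI subsetI)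
    fix p assume "p \<in> Gamma_set D \<union> Omega_set D"
    then show "p \<in> Phi"
      by (cases p) (auto simp: Gamma_set_def Omega_set_def)
  next
    fix a b c
    assume h: "(a, b) \<in> Gamma_set D \<union> Omega_set D \<and> (b, c) \<in> Gamma_set D \<union> Omega_set D"
    show "(a, c) \<in> Gamma_set D \<union> Omega_set D"
    proof (cases "\<exists>e. (a, e) \<in> D")
      case True
      then obtain e where e: "(a, e) \<in> D" by blast
      show ?thesis using h e inj unfolding Un_iff G O
        by (smt (verit, del_insts) leD leI less_trans order_le_less_trans order_less_le_trans
              nless_le inj)
    next
      case False
      then show ?thesis using h unfolding Un_iff G O by auto
    qed
  qed
qed

definition overlapping :: "'l::linorder \<times> 'l \<Rightarrow> 'l \<times> 'l \<Rightarrow> bool" where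
  "overlapping = (\<lambda>(\<alpha>, \<beta>) (\<gamma>, \<delta>).
     (\<alpha> < \<gamma> \<and> \<gamma> < \<beta> \<and> \<beta> < \<delta>) \<or> (\<gamma> < \<alpha> \<and> \<alpha> < \<delta> \<and> \<delta> < \<beta>))"

definition non_overlapping :: "('l::linorder \<times> 'l) set \<Rightarrow> bool" where
  "non_overlapping D \<longleftrightarrow> (\<forall>p\<in>D. \<forall>q\<in>D. \<not> overlapping p q)"

end

(* The elementary module of (\<alpha>, \<beta>) and \<mu> has a basis indexed by the rows u supported in [\<alpha>, \<beta>) with
   u \<alpha> = 1. On functions of u, the element 1 + x of the McLain group acts by
   \<phi> \<mapsto> (u \<mapsto> \<mu> ((u (1 + x)) \<beta>) * \<phi> (u (1 + x) cut off below \<beta>)), so V(D, f) is a monomial representation on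
   families of rows indexed by D.

   If D is non-overlapping, then for every set of families that agree in the rows that start before \<alpha>
   a corrected column element in column \<beta> fixes all of these families and acts on them with scalars
   that separate their (\<alpha>, \<beta>)-rows, because \<mu> is right primitive. Hence a nonzero vector of minimal
   support in a submodule is a multiple of a basis vector, and an endomorphism maps a basis vector to a
   multiple of itself.

   If \<alpha> < \<gamma> < \<beta> < \<delta> for (\<alpha>, \<beta>), (\<gamma>, \<delta>) in D, then adding the row of (\<gamma>, \<delta>), cut off below \<beta>, to the
   row of (\<alpha>, \<beta>) commutes with the action up to a coboundary. This gives a nonscalar automorphism T that
   preserves a nonzero linear functional, and the image of T - 1 is a proper nonzero submodule. *)

theory Submission
  imports Defs
begin

section \<open>Rows as a faithful right module, and the subgroups M(\<Delta>) as support
  conditions\<close>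

section \<open>The McLain group acting on rows\<close>

text \<open>The modules may be infinite dimensional and F is an arbitrary field, so dimension counts
  and Schur's lemma are no help. Instead (a) and (e) both follow from one separation statement: on
  any set of families with at least two members some group element acts diagonally but not as a
  scalar. The obstacle is that an element supported in column \<beta> also disturbs rows that reach
  beyond \<beta>. Rows starting at or after \<beta> are safe and overlapping rows are excluded, but
  the column must be orthogonal to all enclosing rows at once. One column achieves this for a whole
  set of families only if they agree in those rows; hence the smallest \<alpha> at which two
  families differ is used. In the converse direction a nonscalar endomorphism refutes (e) but not
  (a), since an endomorphism ring may be a division algebra. The invariant functional is what shows
  that T - 1 is not onto. Its weights come from writing the multiplier m of T as a quotient
  \<open>w (\<theta> x)\<close> by \<open>w x\<close>.\<close>

abbreviation supp :: "('a \<Rightarrow> 'b::zero) \<Rightarrow> 'a set" where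
  "supp x \<equiv> {p. x p \<noteq> 0}"

(* the row u (1 + x), as x represents 1 + x *)
definition row_mult :: "('l \<Rightarrow> 'r::ring_1) \<Rightarrow> ('l \<times> 'l \<Rightarrow> 'r) \<Rightarrow> 'l \<Rightarrow> 'r" where
  "row_mult u x c = u c + (\<Sum>b | x (b, c) \<noteq> 0. u b * x (b, c))"

lemma mclain_carrier [simp]: "carrier mclain_group = mclain_ring"
  and mclain_mult: "x \<otimes>\<^bsub>mclain_group\<^esub> y = (\<lambda>p. x p + y p + mclain_ring_mult x y p)"
  and mclain_one [simp]: "\<one>\<^bsub>mclain_group\<^esub> = (\<lambda>_. 0)"
  by (simp_all add: mclain_group_def)

lemma mclain_ring_memD:
  assumes "x \<in> mclain_ring"
  shows "finite (supp x)" "x (a, b) \<noteq> 0 \<Longrightarrow> a < b"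
  using assms by (auto simp: mclain_ring_def Phi_def)

text \<open>The index set in \<open>row_mult\<close> varies with the column and with x; summing over
  one larger finite set B lets different products be compared term by term.\<close>

lemma row_mult_eq:
  assumes "finite B" "\<And>b. x (b, c) \<noteq> 0 \<Longrightarrow> b \<in> B"
  shows "row_mult u x c = u c + (\<Sum>b\<in>B. u b * x (b, c))"
proof -
  have "(\<Sum>b | x (b, c) \<noteq> 0. u b * x (b, c)) = (\<Sum>b\<in>B. u b * x (b, c))"
    using assms by (intro sum.mono_neutral_left) auto
  then show ?thesis by (simp add: row_mult_def)
qed

lemma mclain_ring_mult_eq:
  assumes "finite B" "\<And>b. y (b, c) \<noteq> 0 \<Longrightarrow> b \<in> B"
  shows "mclain_ring_mult x y (a, c) = (\<Sum>b\<in>B. x (a, b) * y (b, c))"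
proof -
  have "(\<Sum>b | x (a, b) \<noteq> 0 \<and> y (b, c) \<noteq> 0. x (a, b) * y (b, c)) = (\<Sum>b\<in>B. x (a, b) * y (b, c))"
    using assms by (intro sum.mono_neutral_left) auto
  then show ?thesis by (simp add: mclain_ring_mult_def)
qed

lemma mclain_ring_mult_nonzeroD:
  assumes "mclain_ring_mult x y (a, c) \<noteq> 0"
  shows "\<exists>b. x (a, b) \<noteq> 0 \<and> y (b, c) \<noteq> 0"
proof (rule ccontr)
  assume "\<not> ?thesis"
  then have "{b. x (a, b) \<noteq> 0 \<and> y (b, c) \<noteq> 0} = {}" by blast
  then show False using assms by (simp only: mclain_ring_mult_def prod.case sum.empty) simp
qed

lemma mclain_mult_supp:
  assumes "closed_roots \<Delta>" "supp x \<subseteq> \<Delta>" "supp y \<subseteq> \<Delta>"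
  shows "supp (x \<otimes>\<^bsub>mclain_group\<^esub> y) \<subseteq> \<Delta>"
proof
  fix p assume p: "p \<in> supp (x \<otimes>\<^bsub>mclain_group\<^esub> y)"
  obtain a c where ac: "p = (a, c)" by (cases p)
  show "p \<in> \<Delta>"
  proof (cases "x p = 0 \<and> y p = 0")
    case True
    then have "mclain_ring_mult x y (a, c) \<noteq> 0" using p ac by (simp add: mclain_mult)
    then obtain b where "x (a, b) \<noteq> 0" "y (b, c) \<noteq> 0"
      using mclain_ring_mult_nonzeroD by blast
    then show ?thesis using assms unfolding closed_roots_def ac by blast
  qed (use assms in auto)
qed

lemma closed_roots_Phi: "closed_roots Phi"
  by (auto simp: closed_roots_def Phi_def)

lemma mclain_mult_closed:
  assumes "x \<in> mclain_ring" "y \<in> mclain_ring"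
  shows "x \<otimes>\<^bsub>mclain_group\<^esub> y \<in> mclain_ring"
proof -
  have "supp (x \<otimes>\<^bsub>mclain_group\<^esub> y) \<subseteq> supp x \<union> supp y \<union> fst ` supp x \<times> snd ` supp y"
    by (force simp: mclain_mult dest: mclain_ring_mult_nonzeroD)
  moreover have "finite (supp x \<union> supp y \<union> fst ` supp x \<times> snd ` supp y)"
    using assms by (auto simp: mclain_ring_def)
  ultimately have "finite (supp (x \<otimes>\<^bsub>mclain_group\<^esub> y))"
    by (rule finite_subset)
  then show ?thesis
    using mclain_mult_supp[OF closed_roots_Phi, of x y] assms by (simp add: mclain_ring_def)
qed

text \<open>Everything is summed over one finite set B of first indices, large enough for x, y and
  their product, so that the double sum can be exchanged. This right action on rows stands in for
  matrix algebra: associativity of the group is deduced from it.\<close>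

lemma row_mult_mult:
  assumes x: "x \<in> mclain_ring" and y: "y \<in> mclain_ring"
  shows "row_mult u (x \<otimes>\<^bsub>mclain_group\<^esub> y) = row_mult (row_mult u x) y"
proof
  fix c
  define B where "B = fst ` (supp x \<union> supp y)"
  have B: "finite B" using x y by (auto simp: B_def mclain_ring_def)
  have Bx: "x (b, c) \<noteq> 0 \<Longrightarrow> b \<in> B" for b c
    unfolding B_def by force
  have By: "y (b, c) \<noteq> 0 \<Longrightarrow> b \<in> B" for b c
    unfolding B_def by force
  have mult: "mclain_ring_mult x y (b, c) = (\<Sum>b'\<in>B. x (b, b') * y (b', c))" for b
    using B By by (rule mclain_ring_mult_eq)
  have "b \<in> B" if "(x \<otimes>\<^bsub>mclain_group\<^esub> y) (b, c) \<noteq> 0" for b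
  proof (rule ccontr)
    assume "b \<notin> B"
    then have "x (b, e) = 0" "y (b, e) = 0" for e using Bx By by blast+
    then show False using that mclain_ring_mult_nonzeroD[of x y b c] by (auto simp: mclain_mult)
  qed
  then have "row_mult u (x \<otimes>\<^bsub>mclain_group\<^esub> y) c
      = u c + (\<Sum>b\<in>B. u b * (x \<otimes>\<^bsub>mclain_group\<^esub> y) (b, c))"
    by (rule row_mult_eq[OF B])
  also have "\<dots> = u c + (\<Sum>b\<in>B. u b * x (b, c)) + (\<Sum>b\<in>B. u b * y (b, c))
      + (\<Sum>b\<in>B. \<Sum>b'\<in>B. u b * x (b, b') * y (b', c))"
    by (simp add: mclain_mult mult distrib_left sum.distrib sum_distrib_left mult.assoc)
  also have "(\<Sum>b\<in>B. \<Sum>b'\<in>B. u b * x (b, b') * y (b', c))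
      = (\<Sum>b'\<in>B. (\<Sum>b\<in>B. u b * x (b, b')) * y (b', c))"
    by (subst sum.swap) (simp add: sum_distrib_right)
  also have "u c + (\<Sum>b\<in>B. u b * x (b, c)) + (\<Sum>b\<in>B. u b * y (b, c)) + \<dots>
      = row_mult u x c + (\<Sum>b'\<in>B. row_mult u x b' * y (b', c))"
    by (simp add: row_mult_eq[where x = x, OF B Bx] distrib_right sum.distrib)
  also have "\<dots> = row_mult (row_mult u x) y c"
    by (rule row_mult_eq[OF B By, symmetric])
  finally show "row_mult u (x \<otimes>\<^bsub>mclain_group\<^esub> y) c = row_mult (row_mult u x) y c" .
qed

lemma row_mult_zero [simp]: "row_mult u (\<lambda>_. 0) = u"
  by (simp add: row_mult_def fun_eq_iff)

definition unit_row :: "'l \<Rightarrow> 'l \<Rightarrow> 'r::ring_1" where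
  "unit_row a = (\<lambda>b. if b = a then 1 else 0)"

lemma row_mult_unit_row:
  assumes "x \<in> mclain_ring"
  shows "row_mult (unit_row a) x c = unit_row a c + x (a, c)"
proof -
  have fin: "finite (insert a (fst ` supp x))" using assms by (auto simp: mclain_ring_def)
  have "row_mult (unit_row a) x c
      = unit_row a c + (\<Sum>b\<in>insert a (fst ` supp x). unit_row a b * x (b, c))"
    by (rule row_mult_eq[OF fin]) force
  also have "(\<Sum>b\<in>insert a (fst ` supp x). unit_row a b * x (b, c))
      = (\<Sum>b\<in>insert a (fst ` supp x). if b = a then x (b, c) else 0)"
    by (rule sum.cong) (auto simp: unit_row_def)
  also have "\<dots> = x (a, c)" using fin by (subst sum.delta) auto
  finally show ?thesis .
qed

text \<open>The standard row \<open>unit_row a\<close> is sent to row a of 1 + x, so the action on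
  these rows determines x.\<close>

lemma row_mult_faithful:
  assumes "x \<in> mclain_ring" "y \<in> mclain_ring" "\<And>a. row_mult (unit_row a) x = row_mult (unit_row a) y"
  shows "x = y"
proof
  fix p show "x p = y p"
    using row_mult_unit_row[OF assms(1), of "fst p" "snd p"]
      row_mult_unit_row[OF assms(2), of "fst p" "snd p"] assms(3)[of "fst p"]
    by simp
qed

lemma root_elt_mem: "p \<in> Phi \<Longrightarrow> root_elt r p \<in> mclain_ring"
  by (auto simp: mclain_ring_def root_elt_def)

lemma supp_root_elt: "supp (root_elt r p) \<subseteq> {p}"
  by (auto simp: root_elt_def)

(* Removing an entry in the first nonzero row is right multiplication by a root element, because
   the corresponding column vanishes. *)
lemma mclain_split_root_elt:
  assumes x: "x \<in> mclain_ring" "supp x \<noteq> {}"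
  obtains p where "p \<in> supp x" "x = x(p := 0) \<otimes>\<^bsub>mclain_group\<^esub> root_elt (x p) p"
proof -
  define a where "a = Min (fst ` supp x)"
  have fin: "finite (fst ` supp x)" using x by (auto simp: mclain_ring_def)
  have "a \<in> fst ` supp x" unfolding a_def by (rule Min_in[OF fin]) (use x in auto)
  then obtain b where ab: "x (a, b) \<noteq> 0" by force
  have col: "x (c, a) = 0" for c
  proof (rule ccontr)
    assume *: "x (c, a) \<noteq> 0"
    then have "c < a" using mclain_ring_memD[OF x(1)] by blast
    moreover have "a \<le> c" unfolding a_def by (rule Min_le[OF fin]) (use * in force)
    ultimately show False by simp
  qed
  have "mclain_ring_mult (x((a, b) := 0)) (root_elt r (a, b)) p = 0" for r p
  proof (rule ccontr)
    assume "mclain_ring_mult (x((a, b) := 0)) (root_elt r (a, b)) p \<noteq> 0"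
    then obtain e where "(x((a, b) := 0)) (fst p, e) \<noteq> 0" "root_elt r (a, b) (e, snd p) \<noteq> 0"
      using mclain_ring_mult_nonzeroD[of "x((a, b) := 0)" "root_elt r (a, b)" "fst p" "snd p"]
      by (auto simp del: fun_upd_apply)
    then show False using col by (auto simp: root_elt_def split: if_splits)
  qed
  then have "x = x((a, b) := 0) \<otimes>\<^bsub>mclain_group\<^esub> root_elt (x (a, b)) (a, b)"
    by (auto simp: fun_eq_iff root_elt_def mclain_mult)
  then show ?thesis using that[of "(a, b)"] ab by simp
qed

text \<open>Each use of \<open>mclain_split_root_elt\<close> removes one entry, so induction on the
  size of the support writes an element as a product of root elements taken from its own
  support.\<close>

lemma mclain_induct [consumes 2, case_names one mult]:
  assumes "x \<in> mclain_ring" "supp x \<subseteq> \<Delta>"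
    and one: "P (\<lambda>_. 0)"
    and mult: "\<And>x r p. x \<in> mclain_ring \<Longrightarrow> supp x \<subseteq> \<Delta> \<Longrightarrow> p \<in> \<Delta> \<Longrightarrow> p \<in> Phi \<Longrightarrow> P x \<Longrightarrow>
      P (x \<otimes>\<^bsub>mclain_group\<^esub> root_elt r p)"
  shows "P x"
  using assms(1,2)
proof (induction "card (supp x)" arbitrary: x rule: less_induct)
  case less
  show ?case
  proof (cases "supp x = {}")
    case True
    then have "x = (\<lambda>_. 0)" by auto
    then show ?thesis using one by simp
  next
    case False
    obtain p where p: "p \<in> supp x" "x = x(p := 0) \<otimes>\<^bsub>mclain_group\<^esub> root_elt (x p) p"
      using mclain_split_root_elt[OF less.prems(1) False] by blast
    have fin: "finite (supp x)" using less.prems(1) by (simp add: mclain_ring_def)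
    have sub: "supp (x(p := 0)) = supp x - {p}" by auto
    have mem: "x(p := 0) \<in> mclain_ring"
      unfolding mclain_ring_def mem_Collect_eq sub
      using less.prems(1) fin by (auto simp: mclain_ring_def)
    have "P (x(p := 0))"
    proof (rule less.hyps[OF _ mem])
      show "card (supp (x(p := 0))) < card (supp x)"
        unfolding sub using fin p(1) by (rule card_Diff1_less)
    qed (use sub less.prems in auto)
    then have "P (x(p := 0) \<otimes>\<^bsub>mclain_group\<^esub> root_elt (x p) p)"
      using mem sub p(1) less.prems by (intro mult) (auto simp: mclain_ring_def)
    then show ?thesis using p(2) by simp
  qed
qed

text \<open>Both bracketings act on rows in the same way, and the action is faithful; no triple sum
  has to be rearranged.\<close>

lemma mclain_assoc:
  assumes "x \<in> mclain_ring" "y \<in> mclain_ring" "z \<in> mclain_ring"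
  shows "x \<otimes>\<^bsub>mclain_group\<^esub> y \<otimes>\<^bsub>mclain_group\<^esub> z
    = x \<otimes>\<^bsub>mclain_group\<^esub> (y \<otimes>\<^bsub>mclain_group\<^esub> z)"
  by (rule row_mult_faithful)
    (simp_all only: row_mult_mult mclain_mult_closed assms)

lemma mclain_one_mult [simp]:
  "(\<lambda>_. 0) \<otimes>\<^bsub>mclain_group\<^esub> x = x" "x \<otimes>\<^bsub>mclain_group\<^esub> (\<lambda>_. 0) = x"
  by (auto simp: mclain_mult mclain_ring_mult_def)

text \<open>The two ends of p differ, so e_p has square zero.\<close>

lemma root_elt_mult_inverse:
  assumes "p \<in> Phi"
  shows "root_elt (- r) p \<otimes>\<^bsub>mclain_group\<^esub> root_elt r p = (\<lambda>_. 0)"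
proof
  fix q
  have "mclain_ring_mult (root_elt (- r) p) (root_elt r p) q = 0"
  proof (rule ccontr)
    assume "mclain_ring_mult (root_elt (- r) p) (root_elt r p) q \<noteq> 0"
    then obtain e where "root_elt (- r) p (fst q, e) \<noteq> 0" "root_elt r p (e, snd q) \<noteq> 0"
      using mclain_ring_mult_nonzeroD[of _ _ "fst q" "snd q"] by auto
    then show False using assms by (auto simp: root_elt_def Phi_def split: if_splits)
  qed
  then show "(root_elt (- r) p \<otimes>\<^bsub>mclain_group\<^esub> root_elt r p) q = 0"
    by (simp add: root_elt_def mclain_mult)
qed

text \<open>Inverting a product of root elements factor by factor keeps the support in \<Delta>,
  because \<Delta> is closed. The geometric series of a nilpotent element is avoided.\<close>

lemma mclain_left_inverse:
  assumes "closed_roots \<Delta>" "x \<in> mclain_ring" "supp x \<subseteq> \<Delta>"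
  shows "\<exists>y\<in>mclain_ring. supp y \<subseteq> \<Delta> \<and> y \<otimes>\<^bsub>mclain_group\<^esub> x = (\<lambda>_. 0)"
  using assms(2,3)
proof (induction rule: mclain_induct)
  case one
  show ?case by (rule bexI[of _ "\<lambda>_. 0"]) (auto simp: mclain_ring_def)
next
  case (mult x r p)
  then obtain y where y: "y \<in> mclain_ring" "supp y \<subseteq> \<Delta>" "y \<otimes>\<^bsub>mclain_group\<^esub> x = (\<lambda>_. 0)"
    by blast
  have mem: "root_elt s p \<in> mclain_ring" for s :: 'b
    using mult by (simp add: root_elt_mem)
  have "root_elt (- r) p \<otimes>\<^bsub>mclain_group\<^esub> y \<otimes>\<^bsub>mclain_group\<^esub> (x \<otimes>\<^bsub>mclain_group\<^esub> root_elt r p)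
      = root_elt (- r) p \<otimes>\<^bsub>mclain_group\<^esub> (y \<otimes>\<^bsub>mclain_group\<^esub> x \<otimes>\<^bsub>mclain_group\<^esub> root_elt r p)"
    by (simp only: mclain_assoc mclain_mult_closed mem y(1) mult)
  also have "\<dots> = (\<lambda>_. 0)"
    unfolding y(3) mclain_one_mult using mult by (intro root_elt_mult_inverse)
  finally show ?case
    using mult mem y supp_root_elt[of "- r" p]
    by (intro bexI[of _ "root_elt (- r) p \<otimes>\<^bsub>mclain_group\<^esub> y"] conjI
        mclain_mult_closed mclain_mult_supp[OF assms(1)]) blast+
qed

lemma group_mclain: "group (mclain_group :: ('l::linorder \<times> 'l \<Rightarrow> 'r::ring_1) monoid)"
proof (rule groupI)
  fix x :: "'l \<times> 'l \<Rightarrow> 'r" assume "x \<in> carrier mclain_group"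
  then show "\<exists>y\<in>carrier mclain_group. y \<otimes>\<^bsub>mclain_group\<^esub> x = \<one>\<^bsub>mclain_group\<^esub>"
    using mclain_left_inverse[OF closed_roots_Phi, of x] by (auto simp: mclain_ring_def)
next
  fix x y z :: "'l \<times> 'l \<Rightarrow> 'r"
  assume "x \<in> carrier mclain_group" "y \<in> carrier mclain_group" "z \<in> carrier mclain_group"
  then show "x \<otimes>\<^bsub>mclain_group\<^esub> y \<otimes>\<^bsub>mclain_group\<^esub> z
    = x \<otimes>\<^bsub>mclain_group\<^esub> (y \<otimes>\<^bsub>mclain_group\<^esub> z)"
    by (simp only: mclain_carrier mclain_assoc)
next
  fix x y :: "'l \<times> 'l \<Rightarrow> 'r"
  assume "x \<in> carrier mclain_group" "y \<in> carrier mclain_group"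
  then show "x \<otimes>\<^bsub>mclain_group\<^esub> y \<in> carrier mclain_group"
    by (simp only: mclain_carrier mclain_mult_closed)
next
  show "\<one>\<^bsub>mclain_group\<^esub> \<in> carrier (mclain_group :: ('l \<times> 'l \<Rightarrow> 'r) monoid)"
    by (simp add: mclain_ring_def)
next
  fix x :: "'l \<times> 'l \<Rightarrow> 'r"
  show "\<one>\<^bsub>mclain_group\<^esub> \<otimes>\<^bsub>mclain_group\<^esub> x = x"
    by (simp only: mclain_one mclain_one_mult)
qed

interpretation mclain: group "mclain_group :: ('l::linorder \<times> 'l \<Rightarrow> 'r::ring_1) monoid"
  by (rule group_mclain)

lemma subgroup_supp:
  assumes "closed_roots \<Delta>"
  shows "subgroup {x \<in> mclain_ring. supp x \<subseteq> \<Delta>}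
    (mclain_group :: ('l::linorder \<times> 'l \<Rightarrow> 'r::ring_1) monoid)"
proof (rule mclain.subgroupI)
  fix x :: "'l \<times> 'l \<Rightarrow> 'r" assume x: "x \<in> {x \<in> mclain_ring. supp x \<subseteq> \<Delta>}"
  then obtain y where y: "y \<in> mclain_ring" "supp y \<subseteq> \<Delta>" "y \<otimes>\<^bsub>mclain_group\<^esub> x = (\<lambda>_. 0)"
    using mclain_left_inverse[OF assms, of x] by blast
  then have "inv\<^bsub>mclain_group\<^esub> x = y"
    using x by (intro mclain.inv_equality) auto
  then show "inv\<^bsub>mclain_group\<^esub> x \<in> {x \<in> mclain_ring. supp x \<subseteq> \<Delta>}"
    using y by simp
next
  fix x y :: "'l \<times> 'l \<Rightarrow> 'r"
  assume "x \<in> {x \<in> mclain_ring. supp x \<subseteq> \<Delta>}" "y \<in> {x \<in> mclain_ring. supp x \<subseteq> \<Delta>}"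
  then have "x \<otimes>\<^bsub>mclain_group\<^esub> y \<in> mclain_ring \<and> supp (x \<otimes>\<^bsub>mclain_group\<^esub> y) \<subseteq> \<Delta>"
    by (intro conjI mclain_mult_closed mclain_mult_supp[OF assms]) simp_all
  then show "x \<otimes>\<^bsub>mclain_group\<^esub> y \<in> {x \<in> mclain_ring. supp x \<subseteq> \<Delta>}"
    by (simp only: mem_Collect_eq)
next
  have "(\<lambda>_. 0) \<in> {x \<in> mclain_ring. supp x \<subseteq> \<Delta>}" by (simp add: mclain_ring_def)
  then show "{x :: 'l \<times> 'l \<Rightarrow> 'r. x \<in> mclain_ring \<and> supp x \<subseteq> \<Delta>} \<noteq> {}" by blast
qed auto

lemma mem_mclain_subgroup:
  assumes "x \<in> mclain_ring" "supp x \<subseteq> \<Delta>"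
  shows "x \<in> mclain_subgroup \<Delta>"
  using assms
proof (induction rule: mclain_induct)
  case one
  show ?case unfolding mclain_subgroup_def using generate.one[of mclain_group] by simp
next
  case (mult x r p)
  have "root_elt r p \<in> generate mclain_group (\<Union>p\<in>\<Delta>. root_subgroup p)"
    using mult(3) by (intro generate.incl) (auto simp: root_subgroup_def)
  then show ?case using mult(5) unfolding mclain_subgroup_def by (intro generate.eng)
qed

text \<open>Closedness bounds the supports in the generated subgroup; factorization into root
  elements gives the reverse inclusion. From here on membership in M(\<Delta>) is an entrywise
  condition.\<close>

lemma mclain_subgroup_eq:
  assumes "closed_roots \<Delta>"
  shows "mclain_subgroup \<Delta> = {x \<in> mclain_ring. supp x \<subseteq> \<Delta>}"
proof
  show "mclain_subgroup \<Delta> \<subseteq> {x \<in> mclain_ring. supp x \<subseteq> \<Delta>}"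
    unfolding mclain_subgroup_def
  proof (rule mclain.generate_subgroup_incl[OF _ subgroup_supp[OF assms]])
    show "(\<Union>p\<in>\<Delta>. root_subgroup p) \<subseteq> {x \<in> mclain_ring. supp x \<subseteq> \<Delta>}"
      using assms root_elt_mem supp_root_elt unfolding root_subgroup_def closed_roots_def
      by blast
  qed
qed (use mem_mclain_subgroup in blast)

section \<open>Linear maps on finitely supported functions\<close>

section \<open>Linear extension of functions on a basis\<close>

definition fin_fun :: "'s set \<Rightarrow> ('s \<Rightarrow> 'f::zero) set" where
  "fin_fun S = {\<phi>. finite (supp \<phi>) \<and> supp \<phi> \<subseteq> S}"

text \<open>The linear map with value \<kappa> s at the basis vector s, evaluated at t;
  \<open>lin_ext\<close> is the case in which every \<kappa> s is a basis vector.\<close>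

definition lext :: "('s \<Rightarrow> 't \<Rightarrow> 'f::field) \<Rightarrow> ('s \<Rightarrow> 'f) \<Rightarrow> 't \<Rightarrow> 'f" where
  "lext \<kappa> \<phi> t = (\<Sum>s | \<phi> s \<noteq> 0. \<phi> s * \<kappa> s t)"

lemma fin_funD:
  assumes "\<phi> \<in> fin_fun S"
  shows "finite (supp \<phi>)" "\<phi> s \<noteq> 0 \<Longrightarrow> s \<in> S" "s \<notin> S \<Longrightarrow> \<phi> s = 0"
  using assms by (auto simp: fin_fun_def)

lemma fin_fun_zero [simp]: "(\<lambda>_. 0) \<in> fin_fun S"
  by (simp add: fin_fun_def)

lemma fin_fun_add:
  fixes \<phi> \<psi> :: "'s \<Rightarrow> 'f::monoid_add"
  assumes "\<phi> \<in> fin_fun S" "\<psi> \<in> fin_fun S"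
  shows "(\<lambda>s. \<phi> s + \<psi> s) \<in> fin_fun S"
proof -
  have sub: "supp (\<lambda>s. \<phi> s + \<psi> s) \<subseteq> supp \<phi> \<union> supp \<psi>" by auto
  have "finite (supp \<phi> \<union> supp \<psi>)" using assms by (simp add: fin_fun_def)
  then have "finite (supp (\<lambda>s. \<phi> s + \<psi> s))" by (rule finite_subset[OF sub])
  then show ?thesis using sub assms unfolding fin_fun_def by blast
qed

lemma fin_fun_smult:
  fixes \<phi> :: "'s \<Rightarrow> 'f::mult_zero"
  assumes "\<phi> \<in> fin_fun S"
  shows "(\<lambda>s. c * \<phi> s) \<in> fin_fun S"
proof -
  have "supp (\<lambda>s. c * \<phi> s) \<subseteq> supp \<phi>" by auto
  then show ?thesis using assms finite_subset unfolding fin_fun_def by blast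
qed

lemma supp_basis_elt: "supp (basis_elt s :: _ \<Rightarrow> 'f::field) = {s}"
  by (auto simp: basis_elt_def)

lemma basis_elt_fin_fun [simp]: "basis_elt s \<in> fin_fun S \<longleftrightarrow> s \<in> S"
  by (simp add: fin_fun_def supp_basis_elt)

lemma lext_eq:
  assumes "finite A" "supp \<phi> \<subseteq> A"
  shows "lext \<kappa> \<phi> t = (\<Sum>s\<in>A. \<phi> s * \<kappa> s t)"
  unfolding lext_def using assms by (intro sum.mono_neutral_left) auto

lemma lext_zero [simp]: "lext \<kappa> (\<lambda>_. 0) = (\<lambda>_. 0)"
  by (simp add: lext_def fun_eq_iff)

lemma lext_add:
  assumes "finite (supp \<phi>)" "finite (supp \<psi>)"
  shows "lext \<kappa> (\<lambda>s. \<phi> s + \<psi> s) = (\<lambda>t. lext \<kappa> \<phi> t + lext \<kappa> \<psi> t)"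
proof
  fix t
  have fin: "finite (supp \<phi> \<union> supp \<psi>)" using assms by simp
  have sub: "supp (\<lambda>s. \<phi> s + \<psi> s) \<subseteq> supp \<phi> \<union> supp \<psi>" by auto
  have "lext \<kappa> \<chi> t = (\<Sum>s\<in>supp \<phi> \<union> supp \<psi>. \<chi> s * \<kappa> s t)"
    if "supp \<chi> \<subseteq> supp \<phi> \<union> supp \<psi>" for \<chi>
    using lext_eq[OF fin that] .
  from this[of \<phi>] this[of \<psi>] this[of "\<lambda>s. \<phi> s + \<psi> s"]
  show "lext \<kappa> (\<lambda>s. \<phi> s + \<psi> s) t = lext \<kappa> \<phi> t + lext \<kappa> \<psi> t"
    using sub by (simp add: distrib_right sum.distrib)
qed

lemma lext_smult:
  "lext \<kappa> (\<lambda>s. c * \<phi> s) = (\<lambda>t. c * lext \<kappa> \<phi> t)"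
  by (cases "c = 0") (auto simp: lext_def fun_eq_iff sum_distrib_left mult.assoc)

lemma lext_basis_elt [simp]: "lext \<kappa> (basis_elt s) = \<kappa> s"
  unfolding fun_eq_iff lext_def supp_basis_elt by (simp add: basis_elt_def)

lemma lin_ext_eq_lext:
  assumes "finite (supp \<phi>)"
  shows "lin_ext \<sigma> \<phi> = lext (\<lambda>s. basis_elt (\<sigma> s)) \<phi>"
proof
  fix t
  have "(\<Sum>s | \<phi> s \<noteq> 0. \<phi> s * basis_elt (\<sigma> s) t)
      = (\<Sum>s | \<phi> s \<noteq> 0. if \<sigma> s = t then \<phi> s else 0)"
    by (rule sum.cong) (auto simp: basis_elt_def)
  also have "\<dots> = (\<Sum>s \<in> {s \<in> supp \<phi>. \<sigma> s = t}. \<phi> s)"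
    using assms by (subst sum.inter_filter) auto
  finally show "lin_ext \<sigma> \<phi> t = lext (\<lambda>s. basis_elt (\<sigma> s)) \<phi> t"
    by (simp add: lin_ext_def lext_def)
qed

text \<open>Linearity in the form of an induction rule: a property stable under sums and multiples
  is checked on zero and on basis vectors. The inner induction runs over a finite set containing the
  support.\<close>

lemma fin_fun_induct [consumes 1, case_names zero basis add smult]:
  fixes \<phi> :: "'s \<Rightarrow> 'f::field"
  assumes "\<phi> \<in> fin_fun S"
    and zero: "P (\<lambda>_. 0)"
    and basis: "\<And>s. s \<in> S \<Longrightarrow> P (basis_elt s)"
    and add: "\<And>\<phi> \<psi>. \<phi> \<in> fin_fun S \<Longrightarrow> \<psi> \<in> fin_fun S \<Longrightarrow> P \<phi> \<Longrightarrow> P \<psi> \<Longrightarrow> P (\<lambda>s. \<phi> s + \<psi> s)"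
    and smult: "\<And>c \<phi>. \<phi> \<in> fin_fun S \<Longrightarrow> P \<phi> \<Longrightarrow> P (\<lambda>s. c * \<phi> s)"
  shows "P \<phi>"
proof -
  have "\<phi> \<in> fin_fun S \<Longrightarrow> supp \<phi> \<subseteq> A \<Longrightarrow> P \<phi>" if "finite A" for A and \<phi> :: "'s \<Rightarrow> 'f"
    using that
  proof (induction A arbitrary: \<phi>)
    case empty
    then have "\<phi> = (\<lambda>_. 0)" by auto
    then show ?case using zero by simp
  next
    case (insert a A)
    define \<psi> where "\<psi> = \<phi>(a := 0)"
    have fin: "finite (supp \<phi>)" using insert.prems by (simp add: fin_fun_def)
    have sub: "supp \<psi> \<subseteq> supp \<phi>" by (auto simp: \<psi>_def)
    have \<psi>: "\<psi> \<in> fin_fun S"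
      using insert.prems sub finite_subset[OF sub fin] by (auto simp: fin_fun_def)
    have "P \<psi>" using insert.prems by (intro insert.IH \<psi>) (auto simp: \<psi>_def)
    show ?case
    proof (cases "\<phi> a = 0")
      case True
      then have "\<phi> = \<psi>" by (auto simp: \<psi>_def)
      then show ?thesis using \<open>P \<psi>\<close> by simp
    next
      case False
      then have a: "a \<in> S" using insert.prems by (auto simp: fin_fun_def)
      have "P (\<lambda>s. \<psi> s + \<phi> a * basis_elt a s)"
        using a by (intro add smult basis \<psi> \<open>P \<psi>\<close> fin_fun_smult) auto
      moreover have "(\<lambda>s. \<psi> s + \<phi> a * basis_elt a s) = \<phi>"
        by (auto simp: \<psi>_def basis_elt_def)
      ultimately show ?thesis by simp
    qed
  qed
  then show ?thesis using assms(1) by (auto simp: fin_fun_def)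
qed

lemma lext_fin_fun:
  assumes "\<phi> \<in> fin_fun S" "\<And>s. s \<in> S \<Longrightarrow> \<kappa> s \<in> fin_fun T"
  shows "lext \<kappa> \<phi> \<in> fin_fun T"
  using assms(1)
  by (induction rule: fin_fun_induct)
    (auto simp: assms(2) lext_add lext_smult fin_funD(1) intro: fin_fun_add fin_fun_smult)

lemma lext_lext:
  assumes "\<phi> \<in> fin_fun S" "\<And>s. s \<in> S \<Longrightarrow> \<kappa> s \<in> fin_fun T"
  shows "lext \<kappa>' (lext \<kappa> \<phi>) = lext (\<lambda>s. lext \<kappa>' (\<kappa> s)) \<phi>"
  using assms(1)
proof (induction rule: fin_fun_induct)
  case (add \<phi> \<psi>)
  then show ?case
    using lext_fin_fun[where \<kappa> = \<kappa>, OF add(1) assms(2)]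
      lext_fin_fun[where \<kappa> = \<kappa>, OF add(2) assms(2)]
    by (simp add: lext_add fin_funD(1))
qed (simp_all add: lext_smult)

lemma lext_cong:
  assumes "\<phi> \<in> fin_fun S" "\<And>s. s \<in> S \<Longrightarrow> \<kappa> s = \<kappa>' s"
  shows "lext \<kappa> \<phi> = lext \<kappa>' \<phi>"
  using assms(1)
  by (induction rule: fin_fun_induct) (auto simp: assms(2) lext_add lext_smult fin_funD(1))

lemma lext_basis_id:
  assumes "\<phi> \<in> fin_fun S"
  shows "lext basis_elt \<phi> = \<phi>"
  using assms
  by (induction rule: fin_fun_induct) (auto simp: lext_add lext_smult fin_funD(1))

lemma fin_fun_diff:
  fixes \<phi> :: "'s \<Rightarrow> 'f::field"
  assumes "\<phi> \<in> fin_fun S" "\<psi> \<in> fin_fun S"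
  shows "(\<lambda>s. \<phi> s - \<psi> s) \<in> fin_fun S"
  using fin_fun_add[OF assms(1) fin_fun_smult[OF assms(2), of "-1"]] by simp

lemma lext_diff:
  assumes "\<phi> \<in> fin_fun S" "\<psi> \<in> fin_fun S"
  shows "lext \<kappa> (\<lambda>s. \<phi> s - \<psi> s) = (\<lambda>t. lext \<kappa> \<phi> t - lext \<kappa> \<psi> t)"
  using lext_add[OF fin_funD(1)[OF assms(1)] fin_funD(1)[OF fin_fun_smult[OF assms(2), of "-1"]],
      of \<kappa>] lext_smult[of \<kappa> "-1" \<psi>]
  by (simp add: fun_eq_iff)

lemma vectorspace_fin_fun:
  fixes V :: "('f::field, 's \<Rightarrow> 'f, 'm) module_scheme"
  assumes "carrier V = fin_fun S" "\<zero>\<^bsub>V\<^esub> = (\<lambda>_. 0)" "\<And>\<phi> \<psi>. \<phi> \<oplus>\<^bsub>V\<^esub> \<psi> = (\<lambda>s. \<phi> s + \<psi> s)"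
    "\<And>c \<phi>. c \<odot>\<^bsub>V\<^esub> \<phi> = (\<lambda>s. c * \<phi> s)"
  shows "vectorspace class_ring V"
proof (rule vs_criteria)
  show "\<forall>v\<in>carrier V. \<exists>neg_v\<in>carrier V. v \<oplus>\<^bsub>V\<^esub> neg_v = \<zero>\<^bsub>V\<^esub>"
  proof
    fix v assume v: "v \<in> carrier V"
    show "\<exists>neg_v\<in>carrier V. v \<oplus>\<^bsub>V\<^esub> neg_v = \<zero>\<^bsub>V\<^esub>"
      using fin_fun_smult[of v S "-1"] v
      by (intro bexI[of _ "\<lambda>s. (-1) * v s"]) (simp_all add: assms)
  qed
qed (auto simp: assms algebra_simps class_field fin_fun_add fin_fun_smult)


section \<open>Transport of structure along isomorphisms, and endomorphism spaces of dimension
  one\<close>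

section \<open>Representations and their isomorphisms\<close>

text \<open>Invariance and intertwining refer to one group element at a time, so linearity of each
  \<open>act V g\<close> is what is recorded.\<close>

definition linear_rep :: "('g, 'm) monoid_scheme \<Rightarrow> ('f::field, 'v, 'g) rep \<Rightarrow> bool" where
  "linear_rep G V \<longleftrightarrow> vectorspace class_ring V \<and>
     (\<forall>g\<in>carrier G. act V g \<in> module_hom class_ring V V)"

text \<open>Nothing is presupposed about W: \<open>linear_rep_iso\<close> transports the module
  axioms from V, so they never have to be verified on quotient records.\<close>

definition rep_iso ::
    "('g, 'm) monoid_scheme \<Rightarrow> ('f::field, 'v, 'g) rep \<Rightarrow> ('f, 'w, 'g) rep \<Rightarrow> ('v \<Rightarrow> 'w) \<Rightarrow> bool" where
  "rep_iso G V W \<psi> \<longleftrightarrow> bij_betw \<psi> (carrier V) (carrier W) \<and> \<psi> \<zero>\<^bsub>V\<^esub> = \<zero>\<^bsub>W\<^esub> \<and>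
     (\<forall>x\<in>carrier V. \<forall>y\<in>carrier V. \<psi> (x \<oplus>\<^bsub>V\<^esub> y) = \<psi> x \<oplus>\<^bsub>W\<^esub> \<psi> y) \<and>
     (\<forall>c. \<forall>x\<in>carrier V. \<psi> (c \<odot>\<^bsub>V\<^esub> x) = c \<odot>\<^bsub>W\<^esub> \<psi> x) \<and>
     (\<forall>g\<in>carrier G. \<forall>x\<in>carrier V. \<psi> (act V g x) = act W g (\<psi> x))"

lemma linear_repD:
  assumes "linear_rep G V"
  shows "vectorspace class_ring V"
    "\<zero>\<^bsub>V\<^esub> \<in> carrier V"
    "x \<in> carrier V \<Longrightarrow> y \<in> carrier V \<Longrightarrow> x \<oplus>\<^bsub>V\<^esub> y \<in> carrier V"
    "x \<in> carrier V \<Longrightarrow> c \<odot>\<^bsub>V\<^esub> x \<in> carrier V"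
    "g \<in> carrier G \<Longrightarrow> x \<in> carrier V \<Longrightarrow> act V g x \<in> carrier V"
    "g \<in> carrier G \<Longrightarrow> x \<in> carrier V \<Longrightarrow> y \<in> carrier V \<Longrightarrow>
       act V g (x \<oplus>\<^bsub>V\<^esub> y) = act V g x \<oplus>\<^bsub>V\<^esub> act V g y"
    "g \<in> carrier G \<Longrightarrow> x \<in> carrier V \<Longrightarrow> act V g (c \<odot>\<^bsub>V\<^esub> x) = c \<odot>\<^bsub>V\<^esub> act V g x"
proof -
  show vs: "vectorspace class_ring V" using assms by (simp add: linear_rep_def)
  interpret V: vectorspace class_ring V by (rule vs)
  show "\<zero>\<^bsub>V\<^esub> \<in> carrier V" "x \<in> carrier V \<Longrightarrow> y \<in> carrier V \<Longrightarrow> x \<oplus>\<^bsub>V\<^esub> y \<in> carrier V"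
    "x \<in> carrier V \<Longrightarrow> c \<odot>\<^bsub>V\<^esub> x \<in> carrier V"
    by auto
qed (use assms in \<open>auto simp: linear_rep_def module_hom_def\<close>)

lemma rep_isoD:
  assumes "rep_iso G V W \<psi>"
  shows "inj_on \<psi> (carrier V)" "\<psi> ` carrier V = carrier W"
    "\<And>x. x \<in> carrier V \<Longrightarrow> \<psi> x \<in> carrier W"
    "\<psi> \<zero>\<^bsub>V\<^esub> = \<zero>\<^bsub>W\<^esub>"
    "\<And>x y. x \<in> carrier V \<Longrightarrow> y \<in> carrier V \<Longrightarrow> \<psi> (x \<oplus>\<^bsub>V\<^esub> y) = \<psi> x \<oplus>\<^bsub>W\<^esub> \<psi> y"
    "\<And>c x. x \<in> carrier V \<Longrightarrow> \<psi> (c \<odot>\<^bsub>V\<^esub> x) = c \<odot>\<^bsub>W\<^esub> \<psi> x"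
    "\<And>g x. g \<in> carrier G \<Longrightarrow> x \<in> carrier V \<Longrightarrow> \<psi> (act V g x) = act W g (\<psi> x)"
  using assms by (auto simp: rep_iso_def bij_betw_def)

lemma rep_iso_inv:
  assumes V: "linear_rep G V" and iso: "rep_iso G V W \<psi>"
  shows "rep_iso G W V (inv_into (carrier V) \<psi>)"
proof -
  note D = rep_isoD[OF iso] and L = linear_repD[OF V]
  let ?i = "inv_into (carrier V) \<psi>"
  have inv: "?i (\<psi> x) = x" if "x \<in> carrier V" for x
    using that D(1) by simp
  have W: "\<exists>x\<in>carrier V. w = \<psi> x" if "w \<in> carrier W" for w
    using that D(2) by blast
  have "?i (\<psi> x \<oplus>\<^bsub>W\<^esub> \<psi> y) = x \<oplus>\<^bsub>V\<^esub> y" if "x \<in> carrier V" "y \<in> carrier V" for x y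
    using inv[OF L(3)[OF that]] D(5)[OF that] by simp
  moreover have "?i (c \<odot>\<^bsub>W\<^esub> \<psi> x) = c \<odot>\<^bsub>V\<^esub> x" if "x \<in> carrier V" for c x
    using inv[OF L(4)[OF that]] D(6)[OF that] by simp
  moreover have "?i (act W g (\<psi> x)) = act V g x" if "g \<in> carrier G" "x \<in> carrier V" for g x
    using inv[OF L(5)[OF that]] D(7)[OF that] by simp
  moreover have "?i \<zero>\<^bsub>W\<^esub> = \<zero>\<^bsub>V\<^esub>" using inv[OF L(2)] D(4) by simp
  moreover have "bij_betw ?i (carrier W) (carrier V)"
    using iso by (simp add: rep_iso_def bij_betw_inv_into)
  ultimately show ?thesis
    unfolding rep_iso_def using inv by (auto dest!: W)
qed

lemma linear_rep_iso:
  assumes V: "linear_rep G V" and iso: "rep_iso G V W \<psi>"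
  shows "linear_rep G W"
proof -
  note D = rep_isoD[OF iso] and L = linear_repD[OF V]
  interpret V: vectorspace class_ring V by (rule L(1))
  have W: "\<exists>x\<in>carrier V. w = \<psi> x" if "w \<in> carrier W" for w
    using that D(2) by blast
  note fold = D(4)[symmetric] D(5)[symmetric] D(6)[symmetric] D(7)[symmetric]
  have "vectorspace class_ring W"
  proof (rule vs_criteria)
    show "\<forall>v\<in>carrier W. \<exists>neg_v\<in>carrier W. v \<oplus>\<^bsub>W\<^esub> neg_v = \<zero>\<^bsub>W\<^esub>"
    proof
      fix v assume "v \<in> carrier W"
      then obtain x where x: "x \<in> carrier V" "v = \<psi> x" using W by blast
      then have "v \<oplus>\<^bsub>W\<^esub> \<psi> (\<ominus>\<^bsub>V\<^esub> x) = \<zero>\<^bsub>W\<^esub>"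
        by (simp add: fold V.M.r_neg)
      then show "\<exists>neg_v\<in>carrier W. v \<oplus>\<^bsub>W\<^esub> neg_v = \<zero>\<^bsub>W\<^esub>"
        using x D(3) by blast
    qed
  next
    show "\<forall>a b v. a \<in> carrier class_ring \<and> b \<in> carrier class_ring \<and> v \<in> carrier W \<longrightarrow>
       (a \<otimes>\<^bsub>class_ring\<^esub> b) \<odot>\<^bsub>W\<^esub> v = a \<odot>\<^bsub>W\<^esub> (b \<odot>\<^bsub>W\<^esub> v)"
      using V.smult_assoc1 by (auto dest!: W simp: fold L)
  next
    show "\<forall>a b v. a \<in> carrier class_ring \<and> b \<in> carrier class_ring \<and> v \<in> carrier W \<longrightarrow>
       (a \<oplus>\<^bsub>class_ring\<^esub> b) \<odot>\<^bsub>W\<^esub> v = a \<odot>\<^bsub>W\<^esub> v \<oplus>\<^bsub>W\<^esub> b \<odot>\<^bsub>W\<^esub> v"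
      using V.smult_l_distr by (auto dest!: W simp: fold L)
  next
    show "\<forall>a v w. a \<in> carrier class_ring \<and> v \<in> carrier W \<and> w \<in> carrier W \<longrightarrow>
       a \<odot>\<^bsub>W\<^esub> (v \<oplus>\<^bsub>W\<^esub> w) = a \<odot>\<^bsub>W\<^esub> v \<oplus>\<^bsub>W\<^esub> a \<odot>\<^bsub>W\<^esub> w"
      using V.smult_r_distr by (auto dest!: W simp: fold L)
  next
    show "\<forall>v\<in>carrier W. \<one>\<^bsub>class_ring\<^esub> \<odot>\<^bsub>W\<^esub> v = v"
      using V.smult_one by (auto dest!: W simp: fold L)
  qed (auto dest!: W simp: fold L class_field V.M.a_ac D(3))
  moreover have "act W g \<in> module_hom class_ring W W" if "g \<in> carrier G" for g
    using that by (auto dest!: W simp: module_hom_def fold L D(3))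
  ultimately show ?thesis by (simp add: linear_rep_def)
qed

lemma irreducible_rep_iso:
  assumes V: "linear_rep G V" and iso: "rep_iso G V W \<psi>" and irr: "irreducible_rep G V"
  shows "irreducible_rep G W"
proof -
  note D = rep_isoD[OF iso] and L = linear_repD[OF V]
  show ?thesis unfolding irreducible_rep_def
  proof (intro conjI allI impI)
    show "carrier W \<noteq> {\<zero>\<^bsub>W\<^esub>}"
    proof
      assume W: "carrier W = {\<zero>\<^bsub>W\<^esub>}"
      have "x = \<zero>\<^bsub>V\<^esub>" if "x \<in> carrier V" for x
        using D(3)[OF that] W D(4) L(2) inj_onD[OF D(1) _ that, of "\<zero>\<^bsub>V\<^esub>"] by auto
      then show False using irr L(2) unfolding irreducible_rep_def by blast
    qed
  next
    fix U assume U: "subspace class_ring U W \<and> (\<forall>g\<in>carrier G. \<forall>u\<in>U. act W g u \<in> U)"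
    then have sm: "submodule class_ring U W" by (simp add: subspace_def)
    define U' where "U' = {x \<in> carrier V. \<psi> x \<in> U}"
    have "submodule class_ring U' V"
      using submodule.m_closed[OF sm] submodule.zero_closed[OF sm] submodule.smult_closed[OF sm] L
      unfolding U'_def by (intro submodule.intro) (auto simp: D vectorspace_def)
    moreover have "\<forall>g\<in>carrier G. \<forall>u\<in>U'. act V g u \<in> U'"
      using U L by (auto simp: U'_def D)
    ultimately have "U' = {\<zero>\<^bsub>V\<^esub>} \<or> U' = carrier V"
      using irr L(1) unfolding irreducible_rep_def subspace_def by blast
    moreover have "U = \<psi> ` U'"
      using submodule.subset[OF sm] D(2) unfolding U'_def by force
    ultimately show "U = {\<zero>\<^bsub>W\<^esub>} \<or> U = carrier W"
      using D(2,4) by auto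
  qed
qed

lemma irreducible_rep_iso_iff:
  assumes "linear_rep G V" "rep_iso G V W \<psi>"
  shows "irreducible_rep G W \<longleftrightarrow> irreducible_rep G V"
  using irreducible_rep_iso[OF assms]
    irreducible_rep_iso[OF linear_rep_iso[OF assms] rep_iso_inv[OF assms]]
  by blast

lemma hom_spaceI:
  assumes "\<phi> \<in> extensional (carrier X)" "\<And>x. x \<in> carrier X \<Longrightarrow> \<phi> x \<in> carrier Y"
    "\<And>x y. x \<in> carrier X \<Longrightarrow> y \<in> carrier X \<Longrightarrow> \<phi> (x \<oplus>\<^bsub>X\<^esub> y) = \<phi> x \<oplus>\<^bsub>Y\<^esub> \<phi> y"
    "\<And>c x. x \<in> carrier X \<Longrightarrow> \<phi> (c \<odot>\<^bsub>X\<^esub> x) = c \<odot>\<^bsub>Y\<^esub> \<phi> x"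
    "\<And>g x. g \<in> carrier G \<Longrightarrow> x \<in> carrier X \<Longrightarrow> \<phi> (act X g x) = act Y g (\<phi> x)"
  shows "\<phi> \<in> carrier (hom_space G X Y)"
  using assms by (simp add: hom_space_def module_hom_def)

lemma hom_spaceD:
  assumes "\<phi> \<in> carrier (hom_space G X Y)"
  shows "\<phi> \<in> extensional (carrier X)" "\<And>x. x \<in> carrier X \<Longrightarrow> \<phi> x \<in> carrier Y"
    "\<And>x y. x \<in> carrier X \<Longrightarrow> y \<in> carrier X \<Longrightarrow> \<phi> (x \<oplus>\<^bsub>X\<^esub> y) = \<phi> x \<oplus>\<^bsub>Y\<^esub> \<phi> y"
    "\<And>c x. x \<in> carrier X \<Longrightarrow> \<phi> (c \<odot>\<^bsub>X\<^esub> x) = c \<odot>\<^bsub>Y\<^esub> \<phi> x"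
    "\<And>g x. g \<in> carrier G \<Longrightarrow> x \<in> carrier X \<Longrightarrow> \<phi> (act X g x) = act Y g (\<phi> x)"
  using assms by (auto simp: hom_space_def module_hom_def)

lemma hom_space_simps:
  "\<zero>\<^bsub>hom_space G X Y\<^esub> = (\<lambda>x\<in>carrier X. \<zero>\<^bsub>Y\<^esub>)"
  "\<phi> \<oplus>\<^bsub>hom_space G X Y\<^esub> \<psi> = (\<lambda>x\<in>carrier X. \<phi> x \<oplus>\<^bsub>Y\<^esub> \<psi> x)"
  "c \<odot>\<^bsub>hom_space G X Y\<^esub> \<phi> = (\<lambda>x\<in>carrier X. c \<odot>\<^bsub>Y\<^esub> \<phi> x)"
  by (simp_all add: hom_space_def)

lemma vectorspace_hom_space:
  assumes X: "linear_rep G X" and Y: "linear_rep G Y"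
  shows "vectorspace class_ring (hom_space G X Y)"
proof -
  note LX = linear_repD[OF X] and LY = linear_repD[OF Y]
  interpret Y: vectorspace class_ring Y by (rule LY(1))
  \<comment> \<open>Additivity makes the image of zero equal to its own double, hence zero.\<close>
  have neg: "act Y g \<zero>\<^bsub>Y\<^esub> = \<zero>\<^bsub>Y\<^esub>" if "g \<in> carrier G" for g
    using LY(6)[OF that LY(2) LY(2)] LY(5)[OF that LY(2)] by simp
  have zero: "(\<lambda>x\<in>carrier X. \<zero>\<^bsub>Y\<^esub>) \<in> carrier (hom_space G X Y)"
    by (rule hom_spaceI) (auto simp: LX neg)
  have add: "(\<lambda>x\<in>carrier X. \<phi> x \<oplus>\<^bsub>Y\<^esub> \<psi> x) \<in> carrier (hom_space G X Y)"
    if "\<phi> \<in> carrier (hom_space G X Y)" "\<psi> \<in> carrier (hom_space G X Y)" for \<phi> \<psi>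
    using hom_spaceD[OF that(1)] hom_spaceD[OF that(2)]
    by (intro hom_spaceI) (auto simp: LX LY Y.M.a_ac Y.smult_r_distr)
  have smult: "(\<lambda>x\<in>carrier X. c \<odot>\<^bsub>Y\<^esub> \<phi> x) \<in> carrier (hom_space G X Y)"
    if "\<phi> \<in> carrier (hom_space G X Y)" for c \<phi>
    using hom_spaceD[OF that] Y.smult_assoc1[symmetric]
    by (intro hom_spaceI) (auto simp: LX LY Y.smult_r_distr mult.commute)
  show ?thesis
  proof (rule vs_criteria)
    show "\<forall>v\<in>carrier (hom_space G X Y). \<exists>neg_v\<in>carrier (hom_space G X Y).
      v \<oplus>\<^bsub>hom_space G X Y\<^esub> neg_v = \<zero>\<^bsub>hom_space G X Y\<^esub>"
    proof
      fix v assume v: "v \<in> carrier (hom_space G X Y)"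
      have "y \<oplus>\<^bsub>Y\<^esub> (-1) \<odot>\<^bsub>Y\<^esub> y = \<zero>\<^bsub>Y\<^esub>" if "y \<in> carrier Y" for y
        using Y.smult_l_distr[of 1 "-1" y] Y.smult_one[OF that] Y.smult_l_null[OF that] that by simp
      then have "v \<oplus>\<^bsub>hom_space G X Y\<^esub> (\<lambda>x\<in>carrier X. (-1) \<odot>\<^bsub>Y\<^esub> v x) = \<zero>\<^bsub>hom_space G X Y\<^esub>"
        using hom_spaceD(2)[OF v] by (auto simp: hom_space_simps)
      then show "\<exists>neg_v\<in>carrier (hom_space G X Y).
        v \<oplus>\<^bsub>hom_space G X Y\<^esub> neg_v = \<zero>\<^bsub>hom_space G X Y\<^esub>"
        using smult[OF v] by blast
    qed
  next
    show "\<forall>a b v. a \<in> carrier class_ring \<and> b \<in> carrier class_ring \<and> v \<in> carrier (hom_space G X Y) \<longrightarrow>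
       (a \<otimes>\<^bsub>class_ring\<^esub> b) \<odot>\<^bsub>hom_space G X Y\<^esub> v
        = a \<odot>\<^bsub>hom_space G X Y\<^esub> (b \<odot>\<^bsub>hom_space G X Y\<^esub> v)"
      using Y.smult_assoc1 by (auto simp: hom_space_simps hom_spaceD(2) restrict_def)
  next
    show "\<forall>a b v. a \<in> carrier class_ring \<and> b \<in> carrier class_ring \<and> v \<in> carrier (hom_space G X Y) \<longrightarrow>
       (a \<oplus>\<^bsub>class_ring\<^esub> b) \<odot>\<^bsub>hom_space G X Y\<^esub> v
        = a \<odot>\<^bsub>hom_space G X Y\<^esub> v \<oplus>\<^bsub>hom_space G X Y\<^esub> b \<odot>\<^bsub>hom_space G X Y\<^esub> v"
      using Y.smult_l_distr by (auto simp: hom_space_simps hom_spaceD(2) restrict_def)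
  next
    show "\<forall>a v w. a \<in> carrier class_ring \<and> v \<in> carrier (hom_space G X Y) \<and> w \<in> carrier (hom_space G X Y) \<longrightarrow>
       a \<odot>\<^bsub>hom_space G X Y\<^esub> (v \<oplus>\<^bsub>hom_space G X Y\<^esub> w)
        = a \<odot>\<^bsub>hom_space G X Y\<^esub> v \<oplus>\<^bsub>hom_space G X Y\<^esub> a \<odot>\<^bsub>hom_space G X Y\<^esub> w"
      using Y.smult_r_distr by (auto simp: hom_space_simps hom_spaceD(2) restrict_def)
  next
    show "\<forall>v\<in>carrier (hom_space G X Y). \<one>\<^bsub>class_ring\<^esub> \<odot>\<^bsub>hom_space G X Y\<^esub> v = v"
      using Y.smult_one by (auto simp: hom_space_simps hom_spaceD(2) intro!: extensionalityI
          [where A = "carrier X"] dest: hom_spaceD(1))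
  next
    show "\<forall>v\<in>carrier (hom_space G X Y). v \<oplus>\<^bsub>hom_space G X Y\<^esub> \<zero>\<^bsub>hom_space G X Y\<^esub> = v"
      by (auto simp: hom_space_simps hom_spaceD(2) intro!: extensionalityI
          [where A = "carrier X"] dest: hom_spaceD(1))
  qed (auto simp: hom_space_simps zero add smult class_field hom_spaceD(2) Y.M.a_ac
        intro!: restrict_ext)
qed

text \<open>Since V is nonzero, the identity is a nonzero endomorphism, so dimension one means that
  it spans. Finite dimension is part of the claim, because \<open>intertwining_number\<close> is
  infinite otherwise.\<close>

lemma intertwining_number_eq_1_iff:
  assumes V: "linear_rep G V" and nonzero: "carrier V \<noteq> {\<zero>\<^bsub>V\<^esub>}"
  shows "intertwining_number G V V = 1 \<longleftrightarrow>
    (\<forall>\<phi>\<in>carrier (hom_space G V V). \<exists>c. \<forall>x\<in>carrier V. \<phi> x = c \<odot>\<^bsub>V\<^esub> x)"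
proof -
  note L = linear_repD[OF V]
  interpret V: vectorspace class_ring V by (rule L(1))
  define E where "E = hom_space G V V"
  interpret E: vectorspace class_ring E
    unfolding E_def by (rule vectorspace_hom_space[OF V V])
  define one where "one = (\<lambda>x\<in>carrier V. x)"
  have one: "one \<in> carrier E"
    unfolding E_def one_def by (rule hom_spaceI) (auto simp: L)
  have one_neq: "one \<noteq> \<zero>\<^bsub>E\<^esub>"
  proof
    assume eq: "one = \<zero>\<^bsub>E\<^esub>"
    have "x = \<zero>\<^bsub>V\<^esub>" if "x \<in> carrier V" for x
      using fun_cong[OF eq, of x] that by (simp add: one_def E_def hom_space_simps)
    then show False using nonzero L(2) by blast
  qed
  have span: "\<phi> \<in> E.span {b} \<Longrightarrow> \<exists>c. \<phi> = c \<odot>\<^bsub>E\<^esub> b" if b: "b \<in> carrier E" for b \<phi>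
  proof -
    assume "\<phi> \<in> E.span {b}"
    then obtain c where "\<phi> = E.lincomb c {b}"
      using E.finite_in_span[of "{b}" \<phi>] b by auto
    also have "\<dots> = c b \<odot>\<^bsub>E\<^esub> b"
      using b by (simp add: E.lincomb_def)
    finally show ?thesis by blast
  qed
  have "intertwining_number G V V = 1 \<longleftrightarrow> E.fin_dim \<and> E.dim = 1"
    by (simp add: intertwining_number_def E_def one_enat_def)
  also have "\<dots> \<longleftrightarrow> (\<forall>\<phi>\<in>carrier E. \<exists>c. \<forall>x\<in>carrier V. \<phi> x = c \<odot>\<^bsub>V\<^esub> x)"
  proof
    assume dim: "E.fin_dim \<and> E.dim = 1"
    then obtain B where B: "finite B" "E.basis B" using E.finite_basis_exists by blast
    then have "card B = 1" using E.dim_basis dim by metis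
    then obtain b where b: "B = {b}" by (auto simp: card_1_singleton_iff)
    then have bE: "b \<in> carrier E" and gen: "E.span {b} = carrier E"
      using B by (auto simp: E.basis_def)
    \<comment> \<open>The basis vector b is itself a scalar map: the identity is d times b with d
      nonzero, so c times b is the scalar c / d.\<close>
    obtain d where d: "one = d \<odot>\<^bsub>E\<^esub> b" using span[OF bE] gen one by blast
    have "d \<noteq> 0" using d one_neq E.smult_l_null[OF bE] by auto
    show "\<forall>\<phi>\<in>carrier E. \<exists>c. \<forall>x\<in>carrier V. \<phi> x = c \<odot>\<^bsub>V\<^esub> x"
    proof
      fix \<phi> assume "\<phi> \<in> carrier E"
      then obtain c where c: "\<phi> = c \<odot>\<^bsub>E\<^esub> b" using span[OF bE] gen by blast
      have "\<phi> x = (c / d) \<odot>\<^bsub>V\<^esub> x" if x: "x \<in> carrier V" for x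
      proof -
        have bx: "b x \<in> carrier V" using bE x unfolding E_def by (rule hom_spaceD)
        have "\<phi> x = c \<odot>\<^bsub>V\<^esub> b x" using c x by (simp add: E_def hom_space_simps)
        also have "\<dots> = (c / d * d) \<odot>\<^bsub>V\<^esub> b x" using \<open>d \<noteq> 0\<close> by simp
        also have "\<dots> = (c / d) \<odot>\<^bsub>V\<^esub> (d \<odot>\<^bsub>V\<^esub> b x)"
          using V.smult_assoc1[of "c / d" d "b x"] bx by simp
        also have "d \<odot>\<^bsub>V\<^esub> b x = x"
          using fun_cong[OF d, of x] x by (simp add: E_def hom_space_simps one_def)
        finally show ?thesis .
      qed
      then show "\<exists>c. \<forall>x\<in>carrier V. \<phi> x = c \<odot>\<^bsub>V\<^esub> x" by blast
    qed
  next
    assume scalar: "\<forall>\<phi>\<in>carrier E. \<exists>c. \<forall>x\<in>carrier V. \<phi> x = c \<odot>\<^bsub>V\<^esub> x"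
    have sm: "submodule class_ring (E.span {one}) E"
      using one by (intro E.span_is_submodule) simp
    have "carrier E \<subseteq> E.span {one}"
    proof
      fix \<phi> assume \<phi>: "\<phi> \<in> carrier E"
      then obtain c where c: "\<And>x. x \<in> carrier V \<Longrightarrow> \<phi> x = c \<odot>\<^bsub>V\<^esub> x" using scalar by blast
      have "\<phi> = c \<odot>\<^bsub>E\<^esub> one"
        by (rule extensionalityI[where A = "carrier V"])
          (use \<phi> c in \<open>auto simp: E_def hom_space_simps one_def dest: hom_spaceD(1)\<close>)
      then show "\<phi> \<in> E.span {one}"
        using submodule.smult_closed[OF sm, of c one] E.in_own_span[of "{one}"] one by auto
    qed
    then have gen: "E.span {one} = carrier E"
      using E.span_is_subset2[of "{one}"] one by auto
    have "E.lin_indpt {one}"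
    proof
      assume "E.lin_dep {one}"
      then obtain A a v where A: "A \<subseteq> {one}" "E.lincomb a A = \<zero>\<^bsub>E\<^esub>" "v \<in> A" "a v \<noteq> 0"
        unfolding E.lin_dep_def by auto
      then have "A = {one}" "v = one" by auto
      then have zero: "a one \<odot>\<^bsub>E\<^esub> one = \<zero>\<^bsub>E\<^esub>"
        using A one by (simp add: E.lincomb_def)
      have "one = inverse (a one) \<odot>\<^bsub>E\<^esub> (a one \<odot>\<^bsub>E\<^esub> one)"
        using E.smult_assoc1[of "inverse (a one)" "a one" one] A(4) \<open>v = one\<close> one E.smult_one[OF one]
        by simp
      also have "\<dots> = \<zero>\<^bsub>E\<^esub>" unfolding zero using E.smult_r_null[of "inverse (a one)"] by simp
      finally show False using one_neq by simp
    qed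
    then have "E.basis {one}" using gen one by (simp add: E.basis_def)
    then have "E.dim = 1" using E.dim_basis[of "{one}"] by simp
    moreover have "E.fin_dim" unfolding E.fin_dim_def using gen one by (intro exI[of _ "{one}"]) auto
    ultimately show "E.fin_dim \<and> E.dim = 1" by simp
  qed
  finally show ?thesis by (simp add: E_def)
qed

lemma scalar_endomorphisms_iso:
  assumes V: "linear_rep G V" and iso: "rep_iso G V W \<psi>"
    and scalar: "\<forall>\<phi>\<in>carrier (hom_space G W W). \<exists>c. \<forall>x\<in>carrier W. \<phi> x = c \<odot>\<^bsub>W\<^esub> x"
  shows "\<forall>\<phi>\<in>carrier (hom_space G V V). \<exists>c. \<forall>x\<in>carrier V. \<phi> x = c \<odot>\<^bsub>V\<^esub> x"
proof
  fix \<phi> assume \<phi>: "\<phi> \<in> carrier (hom_space G V V)"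
  note F = hom_spaceD[OF \<phi>] and D = rep_isoD[OF iso] and L = linear_repD[OF V]
    and W = linear_repD[OF linear_rep_iso[OF V iso]]
    and I = rep_isoD[OF rep_iso_inv[OF V iso]]
  let ?i = "inv_into (carrier V) \<psi>"
  have "(\<lambda>w\<in>carrier W. \<psi> (\<phi> (?i w))) \<in> carrier (hom_space G W W)"
    by (rule hom_spaceI) (auto simp: F D I L W)
  then obtain c where c: "\<And>w. w \<in> carrier W \<Longrightarrow> \<psi> (\<phi> (?i w)) = c \<odot>\<^bsub>W\<^esub> w"
    using scalar by fastforce
  have "\<phi> x = c \<odot>\<^bsub>V\<^esub> x" if x: "x \<in> carrier V" for x
  proof (rule inj_onD[OF D(1)])
    show "\<psi> (\<phi> x) = \<psi> (c \<odot>\<^bsub>V\<^esub> x)"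
      using c[OF D(3)[OF x]] D(1) x by (simp add: D(6))
  qed (auto simp: x F L)
  then show "\<exists>c. \<forall>x\<in>carrier V. \<phi> x = c \<odot>\<^bsub>V\<^esub> x" by blast
qed

lemma intertwining_number_eq_1_iso:
  assumes V: "linear_rep G V" and iso: "rep_iso G V W \<psi>" and nonzero: "carrier V \<noteq> {\<zero>\<^bsub>V\<^esub>}"
  shows "intertwining_number G W W = 1 \<longleftrightarrow>
    (\<forall>\<phi>\<in>carrier (hom_space G V V). \<exists>c. \<forall>x\<in>carrier V. \<phi> x = c \<odot>\<^bsub>V\<^esub> x)"
proof -
  have "carrier W \<noteq> {\<zero>\<^bsub>W\<^esub>}"
  proof
    assume W: "carrier W = {\<zero>\<^bsub>W\<^esub>}"
    note D = rep_isoD[OF iso] and L = linear_repD[OF V]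
    have "x = \<zero>\<^bsub>V\<^esub>" if "x \<in> carrier V" for x
      using D(3)[OF that] W D(4) L(2) inj_onD[OF D(1) _ that, of "\<zero>\<^bsub>V\<^esub>"] by auto
    then show False using nonzero L(2) by blast
  qed
  then show ?thesis
    using intertwining_number_eq_1_iff[OF linear_rep_iso[OF V iso]] scalar_endomorphisms_iso[OF V iso]
      scalar_endomorphisms_iso[OF linear_rep_iso[OF V iso] rep_iso_inv[OF V iso]]
    by blast
qed

section \<open>Monomial modules given by a right action and a cocycle\<close>

section \<open>Monomial representations\<close>

text \<open>Functions are pulled back along \<tau>; for a right action \<tau> this is a left action.
  The basis vector at \<open>\<tau> g x\<close> is sent to a multiple of the one at x. The value 0
  outside X keeps supports inside X.\<close>

definition mono_rep ::
    "'x set \<Rightarrow> ('g \<Rightarrow> 'x \<Rightarrow> 'f) \<Rightarrow> ('g \<Rightarrow> 'x \<Rightarrow> 'x) \<Rightarrow> ('f::field, 'x \<Rightarrow> 'f, 'g) rep" where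
  "mono_rep X k \<tau> =
     \<lparr>carrier = fin_fun X, mult = undefined, one = undefined,
      zero = (\<lambda>_. 0), add = (\<lambda>\<phi> \<psi> x. \<phi> x + \<psi> x), smult = (\<lambda>c \<phi> x. c * \<phi> x),
      act = (\<lambda>g \<phi> x. if x \<in> X then k g x * \<phi> (\<tau> g x) else 0)\<rparr>"

lemma mono_rep_simps [simp]:
  "carrier (mono_rep X k \<tau>) = fin_fun X"
  "\<zero>\<^bsub>mono_rep X k \<tau>\<^esub> = (\<lambda>_. 0)"
  "\<phi> \<oplus>\<^bsub>mono_rep X k \<tau>\<^esub> \<psi> = (\<lambda>x. \<phi> x + \<psi> x)"
  "c \<odot>\<^bsub>mono_rep X k \<tau>\<^esub> \<phi> = (\<lambda>x. c * \<phi> x)"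
  "act (mono_rep X k \<tau>) g \<phi> = (\<lambda>x. if x \<in> X then k g x * \<phi> (\<tau> g x) else 0)"
  by (simp_all add: mono_rep_def)

text \<open>\<open>k_mult\<close> is the cocycle identity that makes the twisted pullback
  multiplicative; together with \<open>k_one\<close> it forces the scalars to be nonzero.\<close>

locale monomial_action =
  group G for G :: "('g, 'm) monoid_scheme" (structure) +
  fixes X :: "'x set" and k :: "'g \<Rightarrow> 'x \<Rightarrow> 'f::field" and \<tau> :: "'g \<Rightarrow> 'x \<Rightarrow> 'x"
  assumes \<tau>_closed: "g \<in> carrier G \<Longrightarrow> x \<in> X \<Longrightarrow> \<tau> g x \<in> X"
    and \<tau>_one: "x \<in> X \<Longrightarrow> \<tau> \<one> x = x"
    and \<tau>_mult: "g \<in> carrier G \<Longrightarrow> h \<in> carrier G \<Longrightarrow> x \<in> X \<Longrightarrow> \<tau> (g \<otimes> h) x = \<tau> h (\<tau> g x)"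
    and k_one: "x \<in> X \<Longrightarrow> k \<one> x = 1"
    and k_mult: "g \<in> carrier G \<Longrightarrow> h \<in> carrier G \<Longrightarrow> x \<in> X \<Longrightarrow>
      k (g \<otimes> h) x = k g x * k h (\<tau> g x)"
begin

lemma \<tau>_inv: "g \<in> carrier G \<Longrightarrow> x \<in> X \<Longrightarrow> \<tau> (inv g) (\<tau> g x) = x"
  "g \<in> carrier G \<Longrightarrow> x \<in> X \<Longrightarrow> \<tau> g (\<tau> (inv g) x) = x"
  by (simp_all add: \<tau>_mult[symmetric] \<tau>_one)

lemma \<tau>_inj: "g \<in> carrier G \<Longrightarrow> x \<in> X \<Longrightarrow> y \<in> X \<Longrightarrow> \<tau> g x = \<tau> g y \<Longrightarrow> x = y"
  by (metis \<tau>_inv(1))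

lemma k_nonzero: "g \<in> carrier G \<Longrightarrow> x \<in> X \<Longrightarrow> k g x \<noteq> 0"
  using k_mult[of g "inv g" x] k_one by auto

lemma act_fin_fun:
  assumes g: "g \<in> carrier G" and \<phi>: "\<phi> \<in> fin_fun X"
  shows "act (mono_rep X k \<tau>) g \<phi> \<in> fin_fun X"
proof -
  have "supp (act (mono_rep X k \<tau>) g \<phi>) \<subseteq> \<tau> (inv g) ` supp \<phi>"
  proof
    fix x assume "x \<in> supp (act (mono_rep X k \<tau>) g \<phi>)"
    then have x: "x \<in> X" "\<phi> (\<tau> g x) \<noteq> 0" by (auto split: if_splits)
    then show "x \<in> \<tau> (inv g) ` supp \<phi>"
      using g by (intro image_eqI[of _ _ "\<tau> g x"]) (auto simp: \<tau>_inv)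
  qed
  moreover have "finite (\<tau> (inv g) ` supp \<phi>)" using \<phi> by (simp add: fin_fun_def)
  ultimately have "finite (supp (act (mono_rep X k \<tau>) g \<phi>))" by (rule finite_subset)
  then show ?thesis by (auto simp: fin_fun_def)
qed

lemma linear_rep_mono: "linear_rep G (mono_rep X k \<tau>)"
  unfolding linear_rep_def
proof (intro conjI ballI)
  show "vectorspace class_ring (mono_rep X k \<tau>)"
    by (rule vectorspace_fin_fun[where S = X]) simp_all
  fix g assume "g \<in> carrier G"
  then show "act (mono_rep X k \<tau>) g \<in> module_hom class_ring (mono_rep X k \<tau>) (mono_rep X k \<tau>)"
    using act_fin_fun[of g] by (auto simp: module_hom_def fun_eq_iff algebra_simps)
qed

lemma act_mult:
  assumes "g \<in> carrier G" "h \<in> carrier G"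
  shows "act (mono_rep X k \<tau>) (g \<otimes> h) \<phi>
    = act (mono_rep X k \<tau>) g (act (mono_rep X k \<tau>) h \<phi>)"
  using assms by (auto simp: fun_eq_iff \<tau>_mult k_mult \<tau>_closed)

lemma act_basis_elt:
  assumes "g \<in> carrier G" "x \<in> X"
  shows "act (mono_rep X k \<tau>) g (basis_elt (\<tau> g x)) = (\<lambda>y. k g x * basis_elt x y)"
  using assms by (auto simp: fun_eq_iff basis_elt_def dest: \<tau>_inj)

end

section \<open>Presentations of monomial modules by generators and relations\<close>

section \<open>Quotients of permutation representations\<close>

lemma free_rep_simps [simp]:
  "carrier (free_rep S \<sigma>) = fin_fun S"
  "\<zero>\<^bsub>free_rep S \<sigma>\<^esub> = (\<lambda>_. 0)"
  "\<phi> \<oplus>\<^bsub>free_rep S \<sigma>\<^esub> \<psi> = (\<lambda>x. \<phi> x + \<psi> x)"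
  "c \<odot>\<^bsub>free_rep S \<sigma>\<^esub> \<phi> = (\<lambda>x. c * \<phi> x)"
  "act (free_rep S \<sigma>) g = lin_ext (\<sigma> g)"
  by (simp_all add: free_rep_def fin_fun_def)

lemma vectorspace_free_rep: "vectorspace class_ring (free_rep S \<sigma> :: ('f::field, _, 'g) rep)"
  by (rule vectorspace_fin_fun[where S = S]) simp_all

abbreviation free_span :: "'s set \<Rightarrow> ('g \<Rightarrow> 's \<Rightarrow> 's) \<Rightarrow> ('s \<Rightarrow> 'f::field) set \<Rightarrow> ('s \<Rightarrow> 'f) set" where
  "free_span S \<sigma> R \<equiv> module.span class_ring (free_rep S \<sigma> :: ('f, 's \<Rightarrow> 'f, 'g) rep) R"

lemma free_span_closed:
  fixes R :: "('s \<Rightarrow> 'f::field) set"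
  assumes "R \<subseteq> fin_fun S"
  shows "R \<subseteq> free_span S \<sigma> R" "free_span S \<sigma> R \<subseteq> fin_fun S" "(\<lambda>_. 0) \<in> free_span S \<sigma> R"
    "\<phi> \<in> free_span S \<sigma> R \<Longrightarrow> \<psi> \<in> free_span S \<sigma> R \<Longrightarrow> (\<lambda>s. \<phi> s + \<psi> s) \<in> free_span S \<sigma> R"
    "\<phi> \<in> free_span S \<sigma> R \<Longrightarrow> (\<lambda>s. c * \<phi> s) \<in> free_span S \<sigma> R"
proof -
  let ?E = "free_rep S \<sigma> :: ('f, 's \<Rightarrow> 'f, _) rep"
  interpret E: vectorspace class_ring ?E by (rule vectorspace_free_rep)
  have R: "R \<subseteq> carrier ?E" using assms by simp
  have sm: "submodule class_ring (E.span R) ?E" by (rule E.span_is_submodule[OF R])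
  show "R \<subseteq> E.span R" "E.span R \<subseteq> fin_fun S" "(\<lambda>_. 0) \<in> E.span R"
    using E.in_own_span[OF R] submodule.subset[OF sm] submodule.zero_closed[OF sm] by simp_all
  show "(\<lambda>s. \<phi> s + \<psi> s) \<in> E.span R" if "\<phi> \<in> E.span R" "\<psi> \<in> E.span R"
    using submodule.m_closed[OF sm that] by simp
  show "(\<lambda>s. c * \<phi> s) \<in> E.span R" if "\<phi> \<in> E.span R"
    using submodule.smult_closed[OF sm, of c] that by simp
qed

lemma free_span_subset_kernel:
  fixes R :: "('s \<Rightarrow> 'f::field) set"
  assumes "R \<subseteq> fin_fun S" "\<And>\<phi>. \<phi> \<in> R \<Longrightarrow> lext \<kappa> \<phi> = (\<lambda>_. 0)" "\<phi> \<in> free_span S \<sigma> R"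
  shows "lext \<kappa> \<phi> = (\<lambda>_. 0)"
proof -
  let ?E = "free_rep S \<sigma> :: ('f, 's \<Rightarrow> 'f, _) rep"
  interpret E: vectorspace class_ring ?E by (rule vectorspace_free_rep)
  have "submodule class_ring {\<phi> \<in> fin_fun S. lext \<kappa> \<phi> = (\<lambda>_. 0)} ?E"
    using E.module_axioms
    by (intro submodule.intro) (auto simp: fin_fun_add fin_fun_smult lext_add lext_smult fin_funD(1))
  then have "E.span R \<subseteq> {\<phi> \<in> fin_fun S. lext \<kappa> \<phi> = (\<lambda>_. 0)}"
    using assms by (intro E.span_is_subset) auto
  then show ?thesis using assms(3) by blast
qed

(* The relations R present the monomial representation on T: every basis vector s is congruent to
   the combination of the basis vectors j t that has the same image \<kappa> s. *)
lemma quotient_rep_iso_mono: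
  fixes \<kappa> :: "'s \<Rightarrow> 't \<Rightarrow> 'f::field" and R :: "('s \<Rightarrow> 'f) set" and \<sigma> :: "'g \<Rightarrow> 's \<Rightarrow> 's"
  assumes "monomial_action G T k \<tau>"
    and R: "R \<subseteq> fin_fun S" "\<And>\<phi>. \<phi> \<in> R \<Longrightarrow> lext \<kappa> \<phi> = (\<lambda>_. 0)"
    and \<kappa>: "\<And>s. s \<in> S \<Longrightarrow> \<kappa> s \<in> fin_fun T"
    and j: "\<And>t. t \<in> T \<Longrightarrow> j t \<in> S" "\<And>t. t \<in> T \<Longrightarrow> \<kappa> (j t) = basis_elt t"
    and rel: "\<And>s. s \<in> S \<Longrightarrow>
      (\<lambda>u. basis_elt s u - lext (\<lambda>t. basis_elt (j t)) (\<kappa> s) u) \<in> free_span S \<sigma> R"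
    and \<sigma>: "\<And>g s. g \<in> carrier G \<Longrightarrow> s \<in> S \<Longrightarrow> \<sigma> g s \<in> S"
    and equiv: "\<And>g s. g \<in> carrier G \<Longrightarrow> s \<in> S \<Longrightarrow> \<kappa> (\<sigma> g s) = act (mono_rep T k \<tau>) g (\<kappa> s)"
  shows "rep_iso G (mono_rep T k \<tau>) (quotient_rep (free_rep S \<sigma>) (free_span S \<sigma> R))
    (\<lambda>w. {\<phi> \<in> fin_fun S. lext \<kappa> \<phi> = w})"
proof -
  interpret monomial_action G T k \<tau> by (rule assms(1))
  let ?E = "free_rep S \<sigma> :: ('f, 's \<Rightarrow> 'f, 'g) rep"
  define N where "N = free_span S \<sigma> R"
  note N_closed = free_span_closed[OF R(1), where \<sigma> = \<sigma>, folded N_def]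
  define sec where "sec = lext (\<lambda>t. basis_elt (j t) :: 's \<Rightarrow> 'f)"
  have sec_mem: "sec w \<in> fin_fun S" if "w \<in> fin_fun T" for w
    unfolding sec_def using that by (rule lext_fin_fun) (simp add: j)
  have sec: "lext \<kappa> (sec w) = w" if w: "w \<in> fin_fun T" for w
  proof -
    have "lext \<kappa> (sec w) = lext (\<lambda>t. \<kappa> (j t)) w"
      unfolding sec_def using w by (subst lext_lext[where T = S]) (auto simp: j)
    also have "\<dots> = lext basis_elt w" using w by (rule lext_cong) (simp add: j)
    finally show ?thesis using lext_basis_id[OF w] by simp
  qed
  have \<kappa>_mem: "lext \<kappa> \<phi> \<in> fin_fun T" if "\<phi> \<in> fin_fun S" for \<phi>
    using that \<kappa> by (rule lext_fin_fun)
  \<comment> \<open>Linearity extends \<open>rel\<close> from basis vectors: modulo N every \<phi>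
    equals the section applied to its image.\<close>
  have cong: "(\<lambda>u. \<phi> u - sec (lext \<kappa> \<phi>) u) \<in> N" if "\<phi> \<in> fin_fun S" for \<phi>
    using that
  proof (induction rule: fin_fun_induct)
    case zero
    show ?case using N_closed(3) by (simp add: sec_def)
  next
    case (basis s)
    then show ?case using rel[OF basis] by (simp add: sec_def N_def)
  next
    case (add \<phi> \<psi>)
    have "sec (lext \<kappa> (\<lambda>s. \<phi> s + \<psi> s)) = (\<lambda>u. sec (lext \<kappa> \<phi>) u + sec (lext \<kappa> \<psi>) u)"
      using add(1,2) by (simp add: sec_def lext_add fin_funD(1) fin_funD(1)[OF \<kappa>_mem])
    then show ?case using N_closed(4)[OF add(3,4)] by (simp add: algebra_simps)
  next
    case (smult c \<phi>)
    have "sec (lext \<kappa> (\<lambda>s. c * \<phi> s)) = (\<lambda>u. c * sec (lext \<kappa> \<phi>) u)"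
      by (simp add: sec_def lext_smult)
    then show ?case using N_closed(5)[OF smult(2), of c] by (simp add: algebra_simps)
  qed
  \<comment> \<open>So N is exactly the kernel of the extended \<kappa>, and its cosets are the
    fibres \<open>fib w\<close>.\<close>
  have N_iff: "\<phi> \<in> N \<longleftrightarrow> \<phi> \<in> fin_fun S \<and> lext \<kappa> \<phi> = (\<lambda>_. 0)" for \<phi>
  proof
    assume "\<phi> \<in> N"
    then show "\<phi> \<in> fin_fun S \<and> lext \<kappa> \<phi> = (\<lambda>_. 0)"
      using N_closed(2) free_span_subset_kernel[OF R] unfolding N_def by blast
  next
    assume "\<phi> \<in> fin_fun S \<and> lext \<kappa> \<phi> = (\<lambda>_. 0)"
    then show "\<phi> \<in> N" using cong[of \<phi>] by (simp add: sec_def)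
  qed
  define fib where "fib w = {\<phi> \<in> fin_fun S. lext \<kappa> \<phi> = w}" for w
  have coset: "N +>\<^bsub>?E\<^esub> \<phi> = fib (lext \<kappa> \<phi>)" if \<phi>: "\<phi> \<in> fin_fun S" for \<phi>
  proof
    show "N +>\<^bsub>?E\<^esub> \<phi> \<subseteq> fib (lext \<kappa> \<phi>)"
      unfolding a_r_coset_def' fib_def
      using \<phi> by (auto simp: N_iff fin_fun_add lext_add fin_funD(1))
    show "fib (lext \<kappa> \<phi>) \<subseteq> N +>\<^bsub>?E\<^esub> \<phi>"
    proof
      fix \<psi> assume \<psi>: "\<psi> \<in> fib (lext \<kappa> \<phi>)"
      then have "(\<lambda>s. \<psi> s - \<phi> s) \<in> N"
        using \<phi> by (auto simp: N_iff fib_def fin_fun_diff lext_diff[of _ S])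
      then have "(\<lambda>s. (\<psi> s - \<phi> s) + \<phi> s) \<in> N +>\<^bsub>?E\<^esub> \<phi>"
        unfolding a_r_coset_def' by force
      then show "\<psi> \<in> N +>\<^bsub>?E\<^esub> \<phi>" by simp
    qed
  qed
  have fib_ne: "sec w \<in> fib w" if "w \<in> fin_fun T" for w
    using sec[OF that] sec_mem[OF that] by (simp add: fib_def)
  define Q where "Q = quotient_rep ?E N"
  have Q: "carrier Q = fib ` fin_fun T"
  proof -
    have "carrier Q = (\<lambda>\<phi>. fib (lext \<kappa> \<phi>)) ` fin_fun S"
      unfolding Q_def quotient_rep_def A_RCOSETS_def' using coset by auto
    also have "\<dots> = fib ` (lext \<kappa> ` fin_fun S)" by auto
    also have "lext \<kappa> ` fin_fun S = fin_fun T"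
      using \<kappa>_mem sec sec_mem by (metis (no_types, lifting) image_subsetI rev_image_eqI subsetI subset_antisym)
    finally show ?thesis .
  qed
  have inj: "inj_on fib (fin_fun T)"
  proof (rule inj_onI)
    fix v w assume "v \<in> fin_fun T" "w \<in> fin_fun T" "fib v = fib w"
    then have "sec v \<in> fib w" using fib_ne by metis
    then show "v = w" using sec[OF \<open>v \<in> fin_fun T\<close>] by (simp add: fib_def)
  qed
  have act_lext: "lext \<kappa> (lin_ext (\<sigma> g) \<phi>) = act (mono_rep T k \<tau>) g (lext \<kappa> \<phi>)"
    if g: "g \<in> carrier G" and \<phi>: "\<phi> \<in> fin_fun S" for g \<phi>
  proof -
    have "lext \<kappa> (lin_ext (\<sigma> g) \<phi>) = lext (\<lambda>s. \<kappa> (\<sigma> g s)) \<phi>"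
      using \<phi> lext_lext[OF \<phi>, of "\<lambda>s. basis_elt (\<sigma> g s)" S \<kappa>]
      by (simp add: lin_ext_eq_lext fin_funD(1) \<sigma> g)
    also have "\<dots> = lext (\<lambda>s. act (mono_rep T k \<tau>) g (\<kappa> s)) \<phi>"
      using \<phi> by (rule lext_cong) (simp only: equiv g)
    also have "\<dots> = act (mono_rep T k \<tau>) g (lext \<kappa> \<phi>)"
      by (auto simp: lext_def fun_eq_iff sum_distrib_left mult_ac)
    finally show ?thesis .
  qed
  have act_mem: "lin_ext (\<sigma> g) \<phi> \<in> fin_fun S" if g: "g \<in> carrier G" and \<phi>: "\<phi> \<in> fin_fun S" for g \<phi>
    using lext_fin_fun[OF \<phi>, of "\<lambda>s. basis_elt (\<sigma> g s)" S] \<phi> g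
    by (simp add: lin_ext_eq_lext fin_funD(1) \<sigma>)
  \<comment> \<open>The quotient operations are unions over all representatives. Every
    representative yields the same coset and \<open>fib w\<close> is nonempty, so the union is that
    coset.\<close>
  have union: "(\<Union>\<phi>\<in>fib w. N +>\<^bsub>?E\<^esub> F \<phi>) = fib w'"
    if w: "w \<in> fin_fun T" and F: "\<And>\<phi>. \<phi> \<in> fib w \<Longrightarrow> F \<phi> \<in> fin_fun S \<and> lext \<kappa> (F \<phi>) = w'" for w w' F
  proof -
    have "(\<Union>\<phi>\<in>fib w. N +>\<^bsub>?E\<^esub> F \<phi>) = (\<Union>\<phi>\<in>fib w. fib w')"
      using F by (auto simp: coset)
    then show ?thesis using fib_ne[OF w] by blast
  qed
  have "rep_iso G (mono_rep T k \<tau>) Q fib"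
    unfolding rep_iso_def
  proof (intro conjI ballI allI)
    show "bij_betw fib (carrier (mono_rep T k \<tau>)) (carrier Q)"
      using inj Q by (simp add: bij_betw_def)
    show "fib \<zero>\<^bsub>mono_rep T k \<tau>\<^esub> = \<zero>\<^bsub>Q\<^esub>"
      by (auto simp: Q_def quotient_rep_def fib_def N_iff)
  next
    fix v w assume "v \<in> carrier (mono_rep T k \<tau>)" "w \<in> carrier (mono_rep T k \<tau>)"
    then have v: "v \<in> fin_fun T" and w: "w \<in> fin_fun T" by simp_all
    have "fib (\<lambda>t. v t + w t) = (\<Union>\<phi>\<in>fib v. \<Union>\<psi>\<in>fib w. {\<lambda>s. \<phi> s + \<psi> s})"
    proof
      show "(\<Union>\<phi>\<in>fib v. \<Union>\<psi>\<in>fib w. {\<lambda>s. \<phi> s + \<psi> s}) \<subseteq> fib (\<lambda>t. v t + w t)"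
        by (auto simp: fib_def fin_fun_add lext_add fin_funD(1))
      show "fib (\<lambda>t. v t + w t) \<subseteq> (\<Union>\<phi>\<in>fib v. \<Union>\<psi>\<in>fib w. {\<lambda>s. \<phi> s + \<psi> s})"
      proof
        fix \<phi> assume \<phi>: "\<phi> \<in> fib (\<lambda>t. v t + w t)"
        then have "(\<lambda>s. \<phi> s - sec v s) \<in> fib w"
          using sec[OF v] sec_mem[OF v] by (auto simp: fib_def fin_fun_diff lext_diff[of _ S])
        moreover have "\<phi> = (\<lambda>s. sec v s + (\<phi> s - sec v s))" by simp
        ultimately show "\<phi> \<in> (\<Union>\<phi>\<in>fib v. \<Union>\<psi>\<in>fib w. {\<lambda>s. \<phi> s + \<psi> s})"
          using fib_ne[OF v] by blast
      qed
    qed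
    then show "fib (v \<oplus>\<^bsub>mono_rep T k \<tau>\<^esub> w) = fib v \<oplus>\<^bsub>Q\<^esub> fib w"
      by (simp add: Q_def quotient_rep_def set_add_def')
  next
    fix c w assume "w \<in> carrier (mono_rep T k \<tau>)"
    then have w: "w \<in> fin_fun T" by simp
    have "(\<Union>\<phi>\<in>fib w. N +>\<^bsub>?E\<^esub> (\<lambda>s. c * \<phi> s)) = fib (\<lambda>t. c * w t)"
      by (rule union[OF w]) (auto simp: fib_def fin_fun_smult lext_smult)
    then show "fib (c \<odot>\<^bsub>mono_rep T k \<tau>\<^esub> w) = c \<odot>\<^bsub>Q\<^esub> fib w"
      by (simp add: Q_def quotient_rep_def)
  next
    fix g w assume g: "g \<in> carrier G" and "w \<in> carrier (mono_rep T k \<tau>)"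
    then have w: "w \<in> fin_fun T" by simp
    have "(\<Union>\<phi>\<in>fib w. N +>\<^bsub>?E\<^esub> lin_ext (\<sigma> g) \<phi>) = fib (act (mono_rep T k \<tau>) g w)"
      by (rule union[OF w]) (use g in \<open>auto simp: fib_def act_mem act_lext\<close>)
    then show "fib (act (mono_rep T k \<tau>) g w) = act Q g (fib w)"
      by (simp add: Q_def quotient_rep_def)
  qed
  then show ?thesis by (simp add: Q_def N_def fib_def[abs_def])
qed

section \<open>Pure tensors of basis vectors as a basis of the tensor product\<close>

section \<open>Tensor products of monomial representations\<close>

definition tensor_k :: "'d set \<Rightarrow> ('d \<Rightarrow> 'g \<Rightarrow> 'x \<Rightarrow> 'f::field) \<Rightarrow> 'g \<Rightarrow> ('d \<Rightarrow> 'x) \<Rightarrow> 'f" where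
  "tensor_k D k g u = (\<Prod>d\<in>D. k d g (u d))"

definition tensor_tau :: "'d set \<Rightarrow> ('d \<Rightarrow> 'g \<Rightarrow> 'x \<Rightarrow> 'x) \<Rightarrow> 'g \<Rightarrow> ('d \<Rightarrow> 'x) \<Rightarrow> 'd \<Rightarrow> 'x" where
  "tensor_tau D \<tau> g u = (\<lambda>d\<in>D. \<tau> d g (u d))"

lemma tensor_monomial_action:
  assumes "group G" "\<And>d. d \<in> D \<Longrightarrow> monomial_action G (X d) (k d) (\<tau> d)"
  shows "monomial_action G (PiE D X) (tensor_k D k) (tensor_tau D \<tau>)"
proof -
  interpret group G by fact
  note a = assms(2)[THEN monomial_action.\<tau>_closed] assms(2)[THEN monomial_action.\<tau>_one]
    assms(2)[THEN monomial_action.\<tau>_mult] assms(2)[THEN monomial_action.k_one]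
    assms(2)[THEN monomial_action.k_mult]
  show ?thesis
  proof (unfold_locales, goal_cases)
    case (1 g x)
    then show ?case by (auto simp: tensor_tau_def a(1) PiE_mem)
  next
    case (2 x)
    then have "tensor_tau D \<tau> \<one>\<^bsub>G\<^esub> x = restrict x D"
      unfolding tensor_tau_def by (intro restrict_ext) (simp add: a(2) PiE_mem)
    then show ?case using 2 by (simp add: PiE_restrict)
  next
    case (3 g h x)
    then show ?case
      unfolding tensor_tau_def by (intro restrict_ext) (simp add: a(3) PiE_mem)
  next
    case (4 x)
    then show ?case by (simp add: tensor_k_def a(4) PiE_mem)
  next
    case (5 g h x)
    then have "tensor_k D k (g \<otimes>\<^bsub>G\<^esub> h) x = (\<Prod>d\<in>D. k d g (x d) * k d h (\<tau> d g (x d)))"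
      unfolding tensor_k_def by (intro prod.cong) (simp_all add: a(5) PiE_mem)
    then show ?case by (simp add: tensor_k_def tensor_tau_def prod.distrib)
  qed
qed

lemma basis_elt_PiE:
  assumes "finite D" "u \<in> PiE D X" "v \<in> PiE D X"
  shows "(\<Prod>d\<in>D. basis_elt (u d) (v d)) = (basis_elt u v :: 'f::field)"
proof (cases "u = v")
  case False
  then obtain d where "d \<in> D" "v d \<noteq> u d" using PiE_ext[OF assms(2,3)] by metis
  then have "(\<Prod>d\<in>D. basis_elt (u d) (v d)) = (0 :: 'f)"
    using assms(1) by (intro prod_zero) (auto simp: basis_elt_def)
  then show ?thesis using False by (simp add: basis_elt_def)
qed (simp add: basis_elt_def)

text \<open>The pure tensor t corresponds to the function on families u that multiplies the
  coordinates of the \<open>t d\<close> at \<open>u d\<close>; conversely a family u is lifted to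
  the tensor of its basis vectors. The tensor relations express exactly that this function is
  multilinear in t.\<close>

lemma tensor_rep_iso_mono:
  fixes V :: "'d \<Rightarrow> ('f::field, 'v, 'g) rep" and X :: "'d \<Rightarrow> 'x set"
  assumes "group G" and D: "finite D"
    and mono: "\<And>d. d \<in> D \<Longrightarrow> monomial_action G (X d) (k d) (\<tau> d)"
    and iso: "\<And>d. d \<in> D \<Longrightarrow> rep_iso G (mono_rep (X d) (k d) (\<tau> d)) (V d) (\<psi> d)"
  shows "\<exists>\<Psi>. rep_iso G (mono_rep (PiE D X) (tensor_k D k) (tensor_tau D \<tau>)) (tensor_rep D V) \<Psi>"
proof -
  let ?W = "\<lambda>d. mono_rep (X d) (k d) (\<tau> d) :: ('f, 'x \<Rightarrow> 'f, 'g) rep"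
  define T where "T = PiE D X"
  define S where "S = (\<Pi>\<^sub>E d\<in>D. carrier (V d))"
  define i where "i d = inv_into (carrier (?W d)) (\<psi> d)" for d
  have lin: "linear_rep G (?W d)" if "d \<in> D" for d
    using monomial_action.linear_rep_mono[OF mono[OF that]] .
  note \<psi> = rep_isoD[OF iso, simplified] and
    I = rep_isoD[OF rep_iso_inv[OF lin iso], folded i_def, simplified] and
    LV = linear_repD[OF linear_rep_iso[OF lin iso]]
  have i_\<psi>: "i d (\<psi> d \<phi>) = \<phi>" if "d \<in> D" "\<phi> \<in> fin_fun (X d)" for d \<phi>
    unfolding i_def using \<psi>(1)[OF that(1)] that(2) by simp
  have \<psi>_i: "\<psi> d (i d v) = v" if "d \<in> D" "v \<in> carrier (V d)" for d v
    unfolding i_def using \<psi>(2)[OF that(1)] that(2) by (simp add: f_inv_into_f)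
  define \<kappa> where "\<kappa> t = (\<lambda>u. if u \<in> T then \<Prod>d\<in>D. i d (t d) (u d) else 0)" for t
  define j where "j u = (\<lambda>d\<in>D. \<psi> d (basis_elt (u d)))" for u
  define \<sigma> where "\<sigma> = (\<lambda>g t. \<lambda>d\<in>D. act (V d) g (t d))"
  define R where "R = tensor_relations D V"
  have S_upd: "t(d := v) \<in> S" if "t \<in> S" "d \<in> D" "v \<in> carrier (V d)" for t d v
    using that by (auto simp: S_def PiE_def extensional_def Pi_def)
  have S_mem: "t d \<in> carrier (V d)" if "t \<in> S" "d \<in> D" for t d
    using that by (auto simp: S_def)
  have \<kappa>_mem: "\<kappa> t \<in> fin_fun T" if t: "t \<in> S" for t
  proof -
    have "finite (PiE D (\<lambda>d. supp (i d (t d))))"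
      using D I(3) S_mem[OF t] fin_funD(1) by (intro finite_PiE) blast+
    moreover have "supp (\<kappa> t) \<subseteq> PiE D (\<lambda>d. supp (i d (t d)))"
    proof
      fix u assume "u \<in> supp (\<kappa> t)"
      then have "u \<in> T" "(\<Prod>d\<in>D. i d (t d) (u d)) \<noteq> 0" by (auto simp: \<kappa>_def split: if_splits)
      then show "u \<in> PiE D (\<lambda>d. supp (i d (t d)))"
        using D by (auto simp: T_def PiE_def Pi_def)
    qed
    ultimately have "finite (supp (\<kappa> t))" by (rule finite_subset[rotated])
    then show ?thesis by (auto simp: fin_fun_def \<kappa>_def)
  qed
  have \<kappa>_upd: "\<kappa> (t(d := v)) = (\<lambda>u. if u \<in> T then i d v (u d) * (\<Prod>e\<in>D - {d}. i e (t e) (u e)) else 0)"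
    if "d \<in> D" for t d v
    unfolding \<kappa>_def fun_eq_iff using that
    by (auto simp: prod.remove[OF D that])
  have \<kappa>_add: "\<kappa> (t(d := v \<oplus>\<^bsub>V d\<^esub> w)) = (\<lambda>u. \<kappa> (t(d := v)) u + \<kappa> (t(d := w)) u)"
    if "d \<in> D" "v \<in> carrier (V d)" "w \<in> carrier (V d)" for t d v w
    using that by (simp add: \<kappa>_upd I(5) fun_eq_iff distrib_right)
  have \<kappa>_smult: "\<kappa> (t(d := c \<odot>\<^bsub>V d\<^esub> v)) = (\<lambda>u. c * \<kappa> (t(d := v)) u)"
    if "d \<in> D" "v \<in> carrier (V d)" for t d v c
    using that by (simp add: \<kappa>_upd I(6) fun_eq_iff mult.assoc)
  have j_mem: "j u \<in> S" if "u \<in> T" for u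
    using that \<psi>(3) by (auto simp: j_def S_def T_def PiE_mem)
  have \<kappa>_j: "\<kappa> (j u) = basis_elt u" if u: "u \<in> T" for u
  proof
    fix v
    show "\<kappa> (j u) v = basis_elt u v"
    proof (cases "v \<in> T")
      case True
      have "(\<Prod>d\<in>D. i d (j u d) (v d)) = (\<Prod>d\<in>D. basis_elt (u d) (v d))"
        using u by (intro prod.cong) (auto simp: j_def T_def i_\<psi> PiE_mem)
      then show ?thesis
        using True basis_elt_PiE[OF D] u by (simp add: \<kappa>_def T_def)
    qed (use u in \<open>auto simp: \<kappa>_def basis_elt_def\<close>)
  qed
  have R_sub: "R \<subseteq> fin_fun S"
    unfolding R_def tensor_relations_def S_def[symmetric]
    by (auto intro!: fin_fun_diff fin_fun_add fin_fun_smult simp: S_upd LV)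
  have R_ker: "lext \<kappa> \<phi> = (\<lambda>_. 0)" if "\<phi> \<in> R" for \<phi>
  proof -
    have bm: "basis_elt (t(d := v)) \<in> fin_fun S" if "t \<in> S" "d \<in> D" "v \<in> carrier (V d)" for t d v
      using S_upd[OF that] by simp
    consider (add) t d v w where "t \<in> S" "d \<in> D" "v \<in> carrier (V d)" "w \<in> carrier (V d)"
        "\<phi> = (\<lambda>s. basis_elt (t(d := v \<oplus>\<^bsub>V d\<^esub> w)) s
           - (basis_elt (t(d := v)) s + basis_elt (t(d := w)) s))"
      | (smult) t d c v where "t \<in> S" "d \<in> D" "v \<in> carrier (V d)"
        "\<phi> = (\<lambda>s. basis_elt (t(d := c \<odot>\<^bsub>V d\<^esub> v)) s - c * basis_elt (t(d := v)) s)"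
      using \<open>\<phi> \<in> R\<close> unfolding R_def tensor_relations_def S_def[symmetric] by blast
    then show ?thesis
    proof cases
      case add
      have "lext \<kappa> \<phi> = (\<lambda>u. lext \<kappa> (basis_elt (t(d := v \<oplus>\<^bsub>V d\<^esub> w))) u
         - lext \<kappa> (\<lambda>s. basis_elt (t(d := v)) s + basis_elt (t(d := w)) s) u)"
        unfolding add(5)
        by (intro lext_diff[of _ S] fin_fun_add bm add(1-4) LV(3))
      also have "lext \<kappa> (\<lambda>s. basis_elt (t(d := v)) s + basis_elt (t(d := w)) s)
         = (\<lambda>u. lext \<kappa> (basis_elt (t(d := v))) u + lext \<kappa> (basis_elt (t(d := w))) u)"
        by (rule lext_add) (simp_all add: supp_basis_elt)
      finally show ?thesis by (simp only: lext_basis_elt \<kappa>_add[OF add(2-4)]) simp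
    next
      case smult
      have "lext \<kappa> \<phi> = (\<lambda>u. lext \<kappa> (basis_elt (t(d := c \<odot>\<^bsub>V d\<^esub> v))) u
         - lext \<kappa> (\<lambda>s. c * basis_elt (t(d := v)) s) u)"
        unfolding smult(4)
        by (intro lext_diff[of _ S] fin_fun_smult bm smult(1-3) LV(4))
      then show ?thesis by (simp only: lext_basis_elt lext_smult \<kappa>_smult[OF smult(2,3)]) simp
    qed
  qed
  define N where "N = free_span S \<sigma> R"
  note N_closed = free_span_closed[OF R_sub, where \<sigma> = \<sigma>, folded N_def]
  define sec where "sec = lext (\<lambda>u. basis_elt (j u) :: ('d \<Rightarrow> 'v) \<Rightarrow> 'f)"
  have sec_add: "sec (\<lambda>u. \<phi> u + \<phi>' u) = (\<lambda>s. sec \<phi> s + sec \<phi>' s)"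
    if "\<phi> \<in> fin_fun T" "\<phi>' \<in> fin_fun T" for \<phi> \<phi>'
    using that by (simp add: sec_def lext_add fin_funD(1))
  have sec_smult: "sec (\<lambda>u. c * \<phi> u) = (\<lambda>s. c * sec \<phi> s)" for c \<phi>
    by (simp add: sec_def lext_smult)
  have rel_add: "(\<lambda>s. basis_elt (t(d := v \<oplus>\<^bsub>V d\<^esub> w)) s
      - (basis_elt (t(d := v)) s + basis_elt (t(d := w)) s)) \<in> N"
    if "t \<in> S" "d \<in> D" "v \<in> carrier (V d)" "w \<in> carrier (V d)" for t d v w
    by (rule subsetD[OF N_closed(1)]) (use that in \<open>unfold R_def tensor_relations_def S_def[symmetric], blast\<close>)
  have rel_smult: "(\<lambda>s. basis_elt (t(d := c \<odot>\<^bsub>V d\<^esub> v)) s - c * basis_elt (t(d := v)) s) \<in> N"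
    if "t \<in> S" "d \<in> D" "v \<in> carrier (V d)" for t d v c
    by (rule subsetD[OF N_closed(1)]) (use that in \<open>unfold R_def tensor_relations_def S_def[symmetric], blast\<close>)
  \<comment> \<open>A contains the factors that are not yet known to be basis vectors;
    multilinearity expands them one at a time. For A = D no factor is restricted.\<close>
  have cong: "(\<lambda>s. basis_elt t s - sec (\<kappa> t) s) \<in> N"
    if "A \<subseteq> D" "t \<in> S" "\<And>d. d \<in> D - A \<Longrightarrow> \<exists>x\<in>X d. t d = \<psi> d (basis_elt x)" for A t
    using finite_subset[OF that(1) D] that
  proof (induction A arbitrary: t)
    case empty
    then have "\<forall>d\<in>D. \<exists>x. x \<in> X d \<and> t d = \<psi> d (basis_elt x)" by blast
    then obtain x where x: "\<And>d. d \<in> D \<Longrightarrow> x d \<in> X d \<and> t d = \<psi> d (basis_elt (x d))"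
      by metis
    define u where "u = restrict x D"
    have u: "u \<in> T" using x by (auto simp: u_def T_def)
    have "restrict t D = j u"
      unfolding j_def u_def using x by (intro restrict_ext) simp
    then have "t = j u" using empty.prems(2) by (simp add: S_def PiE_restrict)
    then show ?case using N_closed(3) \<kappa>_j[OF u] by (simp add: sec_def)
  next
    case (insert a A)
    then have a: "a \<in> D" by simp
    have "(\<lambda>s. basis_elt (t(a := \<psi> a \<phi>)) s - sec (\<kappa> (t(a := \<psi> a \<phi>))) s) \<in> N"
      if "\<phi> \<in> fin_fun (X a)" for \<phi>
      using that
    proof (induction rule: fin_fun_induct)
      case zero
      have z: "\<psi> a (\<lambda>_. 0) \<in> carrier (V a)" using \<psi>(3)[OF a] by simp
      \<comment> \<open>A tensor with a zero factor lies in N by homogeneity with scalar 0.\<close>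
      have "0 \<odot>\<^bsub>V a\<^esub> \<psi> a (\<lambda>_. 0) = \<psi> a (\<lambda>_. 0)"
        using \<psi>(6)[OF a, of "\<lambda>_. 0" 0] by simp
      then show ?case
        using rel_smult[OF insert.prems(2) a z, of 0] \<kappa>_smult[OF a z, of t 0]
        by (simp add: sec_def del: fun_upd_apply)
    next
      case (basis x)
      have "\<psi> a (basis_elt x) \<in> carrier (V a)" using \<psi>(3)[OF a] basis by simp
      then show ?case
        using insert.prems basis
        by (intro insert.IH S_upd a) auto
    next
      case (add \<phi> \<phi>')
      note v = \<psi>(3)[OF a add(1)] \<psi>(3)[OF a add(2)]
      have eq: "\<psi> a (\<lambda>x. \<phi> x + \<phi>' x) = \<psi> a \<phi> \<oplus>\<^bsub>V a\<^esub> \<psi> a \<phi>'"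
        using \<psi>(5)[OF a add(1,2)] .
      note S = S_upd[OF insert.prems(2) a]
      show ?case
        using N_closed(4)[OF N_closed(4)[OF add(3,4)] rel_add[OF insert.prems(2) a v]]
        unfolding eq \<kappa>_add[OF a v] sec_add[OF \<kappa>_mem[OF S[OF v(1)]] \<kappa>_mem[OF S[OF v(2)]]]
        by (simp add: algebra_simps del: fun_upd_apply)
    next
      case (smult c \<phi>)
      note v = \<psi>(3)[OF a smult(1)]
      have eq: "\<psi> a (\<lambda>x. c * \<phi> x) = c \<odot>\<^bsub>V a\<^esub> \<psi> a \<phi>"
        using \<psi>(6)[OF a smult(1)] .
      show ?case
        using N_closed(4)[OF N_closed(5)[OF smult(2), of c] rel_smult[OF insert.prems(2) a v, of c]]
        unfolding eq \<kappa>_smult[OF a v] sec_smult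
        by (simp add: algebra_simps del: fun_upd_apply)
    qed
    from this[of "i a (t a)"] show ?case
      using \<psi>_i[OF a S_mem[OF insert.prems(2) a]] I(3)[OF a a S_mem[OF insert.prems(2) a]] by simp
  qed
  have "rep_iso G (mono_rep T (tensor_k D k) (tensor_tau D \<tau>))
      (quotient_rep (free_rep S \<sigma>) (free_span S \<sigma> R)) (\<lambda>w. {\<phi> \<in> fin_fun S. lext \<kappa> \<phi> = w})"
  proof (rule quotient_rep_iso_mono)
    show "monomial_action G T (tensor_k D k) (tensor_tau D \<tau>)"
      unfolding T_def by (rule tensor_monomial_action[OF assms(1) mono])
  next
    fix s assume "s \<in> S"
    then show "(\<lambda>u. basis_elt s u - lext (\<lambda>t. basis_elt (j t)) (\<kappa> s) u) \<in> free_span S \<sigma> R"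
      using cong[of D s] by (simp add: N_def sec_def)
  next
    fix g s assume g: "g \<in> carrier G" and s: "s \<in> S"
    show "\<sigma> g s \<in> S" using g s LV(5) S_mem[OF s] by (auto simp: \<sigma>_def S_def)
    show "\<kappa> (\<sigma> g s) = act (mono_rep T (tensor_k D k) (tensor_tau D \<tau>)) g (\<kappa> s)"
    proof
      fix u
      show "\<kappa> (\<sigma> g s) u = act (mono_rep T (tensor_k D k) (tensor_tau D \<tau>)) g (\<kappa> s) u"
      proof (cases "u \<in> T")
        case True
        then have "tensor_tau D \<tau> g u \<in> T"
          using monomial_action.\<tau>_closed[OF mono _] g by (auto simp: T_def tensor_tau_def PiE_mem)
        moreover have "i d (act (V d) g (s d)) (u d) = k d g (u d) * i d (s d) (\<tau> d g (u d))"
          if "d \<in> D" for d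
          using True I(7)[OF that that g S_mem[OF s that]] that by (auto simp: T_def PiE_mem)
        ultimately show ?thesis
          using True by (simp add: \<kappa>_def \<sigma>_def tensor_k_def tensor_tau_def prod.distrib)
      qed (simp add: \<kappa>_def)
    qed
  qed (use R_sub R_ker \<kappa>_mem j_mem \<kappa>_j in auto)
  then show ?thesis
    unfolding tensor_rep_def Let_def S_def \<sigma>_def R_def T_def by blast
qed

section \<open>Induced modules by orbit and stabilizer\<close>

section \<open>Induction of a linear character from a point stabilizer\<close>

lemma char_rep_simps [simp]:
  "carrier (char_rep \<chi>) = UNIV"
  "v \<oplus>\<^bsub>char_rep \<chi>\<^esub> w = v + w"
  "c \<odot>\<^bsub>char_rep \<chi>\<^esub> w = c * w"
  "act (char_rep \<chi>) g w = \<chi> g * w"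
  by (simp_all add: char_rep_def)

lemma group_algebra_simps [simp]:
  "carrier (group_algebra G) = fin_fun (carrier G)"
  "a \<oplus>\<^bsub>group_algebra G\<^esub> b = (\<lambda>x. a x + b x)"
  "c \<odot>\<^bsub>group_algebra G\<^esub> a = (\<lambda>x. c * a x)"
  "act (group_algebra G) g = lin_ext (\<lambda>x. g \<otimes>\<^bsub>G\<^esub> x)"
  by (simp_all add: group_algebra_def)

lemma (in monomial_action) act_lext:
  "act (mono_rep X k \<tau>) g (lext \<kappa> \<phi>) = lext (\<lambda>s. act (mono_rep X k \<tau>) g (\<kappa> s)) \<phi>"
  by (auto simp: lext_def fun_eq_iff sum_distrib_left mult_ac)

text \<open>Orbit and stabilizer in module form: H is the stabilizer of u0 and acts there through
  \<chi>, so the tensor of g with w corresponds to w times the g-translate of the basis vector at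
  u0. The element \<open>r x\<close> carries that vector to the one at x with scalar 1, hence the
  tensors of the \<open>r x\<close> with 1 form a basis.\<close>

lemma (in monomial_action) ind_rep_iso_mono:
  assumes H: "H \<subseteq> carrier G" and u0: "u0 \<in> X"
    and stab: "\<And>g. g \<in> carrier G \<Longrightarrow> \<tau> g u0 = u0 \<Longrightarrow> g \<in> H"
    and H_fix: "\<And>h. h \<in> H \<Longrightarrow> \<tau> h u0 = u0" and \<chi>: "\<And>h. h \<in> H \<Longrightarrow> k h u0 = \<chi> h"
    and r: "\<And>x. x \<in> X \<Longrightarrow> r x \<in> carrier G" "\<And>x. x \<in> X \<Longrightarrow> \<tau> (r x) x = u0"
      "\<And>x. x \<in> X \<Longrightarrow> k (r x) x = 1"
  shows "\<exists>\<psi>. rep_iso G (mono_rep X k \<tau>) (ind_rep G H (char_rep \<chi>)) \<psi>"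
proof -
  let ?W = "mono_rep X k \<tau> :: ('f, 'x \<Rightarrow> 'f, 'g) rep"
  define S where "S = (fin_fun (carrier G) :: ('g \<Rightarrow> 'f) set) \<times> (UNIV :: 'f set)"
  define \<sigma> where "\<sigma> = (\<lambda>g (a :: 'g \<Rightarrow> 'f, w :: 'f). (lin_ext (\<lambda>x. g \<otimes> x) a, w))"
  define R where "R = ind_relations G H (char_rep \<chi>)"
  define e where "e g = act ?W g (basis_elt u0)" for g
  define \<kappa> where "\<kappa> = (\<lambda>(a :: 'g \<Rightarrow> 'f, w). \<lambda>x. w * lext e a x)"
  define j where "j x = (basis_elt (r x) :: 'g \<Rightarrow> 'f, 1 :: 'f)" for x
  have e_mem: "e g \<in> fin_fun X" if "g \<in> carrier G" for g
    unfolding e_def using act_fin_fun[OF that] u0 by simp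
  have e_r: "e (r x) = basis_elt x" if "x \<in> X" for x
    using act_basis_elt[OF r(1) that, OF that] r(2,3)[OF that] by (simp add: e_def)
  have e_H: "e (g \<otimes> h) = (\<lambda>x. \<chi> h * e g x)" if "g \<in> carrier G" "h \<in> H" for g h
  proof -
    have h: "h \<in> carrier G" using that H by blast
    have "e (g \<otimes> h) = act ?W g (act ?W h (basis_elt u0))"
      unfolding e_def by (rule act_mult[OF that(1) h])
    also have "act ?W h (basis_elt u0) = (\<lambda>x. \<chi> h * basis_elt u0 x)"
      using act_basis_elt[OF h u0] by (simp only: H_fix[OF that(2)] \<chi>[OF that(2)])
    also have "act ?W g \<dots> = (\<lambda>x. \<chi> h * e g x)"
      by (auto simp: e_def fun_eq_iff)
    finally show ?thesis .
  qed
  have trans_mem: "lin_ext (\<lambda>x. x \<otimes> h) a \<in> fin_fun (carrier G)"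
    if "h \<in> carrier G" "a \<in> fin_fun (carrier G)" for h and a :: "'g \<Rightarrow> 'f"
    using that lext_fin_fun[OF that(2), of "\<lambda>x. basis_elt (x \<otimes> h)"]
    by (simp add: lin_ext_eq_lext fin_funD(1))
  have left_mem: "lin_ext (\<lambda>x. h \<otimes> x) a \<in> fin_fun (carrier G)"
    if "h \<in> carrier G" "a \<in> fin_fun (carrier G)" for h and a :: "'g \<Rightarrow> 'f"
    using that lext_fin_fun[OF that(2), of "\<lambda>x. basis_elt (h \<otimes> x)"]
    by (simp add: lin_ext_eq_lext fin_funD(1))
  \<comment> \<open>Elimination rule for the five kinds of relations, with the record operations
    already unfolded.\<close>
  have R_cases: "P" if "\<phi> \<in> R"
    and "\<And>a b w. a \<in> fin_fun (carrier G) \<Longrightarrow> b \<in> fin_fun (carrier G) \<Longrightarrow>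
      \<phi> = (\<lambda>s. basis_elt (\<lambda>x. a x + b x, w) s - (basis_elt (a, w) s + basis_elt (b, w) s)) \<Longrightarrow> P"
    and "\<And>a v w. a \<in> fin_fun (carrier G) \<Longrightarrow>
      \<phi> = (\<lambda>s. basis_elt (a, v + w) s - (basis_elt (a, v) s + basis_elt (a, w) s)) \<Longrightarrow> P"
    and "\<And>c a w. a \<in> fin_fun (carrier G) \<Longrightarrow>
      \<phi> = (\<lambda>s. basis_elt (\<lambda>x. c * a x, w) s - c * basis_elt (a, w) s) \<Longrightarrow> P"
    and "\<And>c a w. a \<in> fin_fun (carrier G) \<Longrightarrow>
      \<phi> = (\<lambda>s. basis_elt (a, c * w) s - c * basis_elt (a, w) s) \<Longrightarrow> P"
    and "\<And>a h w. a \<in> fin_fun (carrier G) \<Longrightarrow> h \<in> H \<Longrightarrow>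
      \<phi> = (\<lambda>s. basis_elt (lin_ext (\<lambda>x. x \<otimes> h) a, w) s - basis_elt (a, \<chi> h * w) s) \<Longrightarrow> P"
    for \<phi> P
    using that(1) unfolding R_def ind_relations_def Let_def Un_iff mem_Collect_eq
      group_algebra_simps char_rep_simps
    by (elim disjE exE conjE) (rule that(2-); assumption)+
  have R_sub: "R \<subseteq> fin_fun S"
  proof
    fix \<phi> assume "\<phi> \<in> R"
    then show "\<phi> \<in> fin_fun S"
      by (rule R_cases)
        (use H in \<open>auto intro!: fin_fun_diff fin_fun_add fin_fun_smult trans_mem simp: S_def\<close>)
  qed
  have \<kappa>_lext_diff: "lext \<kappa> (\<lambda>s. basis_elt p s - \<phi> s) = (\<lambda>x. \<kappa> p x - lext \<kappa> \<phi> x)"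
    if "finite (supp \<phi>)" for p \<phi>
    using lext_diff[of "basis_elt p" UNIV \<phi> \<kappa>] that by (simp add: fin_fun_def supp_basis_elt)
  have \<kappa>_lext_add: "lext \<kappa> (\<lambda>s. basis_elt p s + basis_elt q s) = (\<lambda>x. \<kappa> p x + \<kappa> q x)" for p q
    using lext_add[of "basis_elt p" "basis_elt q" \<kappa>] by (simp add: supp_basis_elt)
  have fin_add: "finite (supp (\<lambda>s. basis_elt p s + basis_elt q s :: 'f))" for p q :: "('g \<Rightarrow> 'f) \<times> 'f"
    using fin_fun_add[of "basis_elt p" UNIV "basis_elt q"] by (simp add: fin_fun_def supp_basis_elt)
  have fin_smult: "finite (supp (\<lambda>s. c * basis_elt p s :: 'f))" for p :: "('g \<Rightarrow> 'f) \<times> 'f" and c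
    using fin_fun_smult[of "basis_elt p" UNIV c] by (simp add: fin_fun_def supp_basis_elt)
  have R_ker: "lext \<kappa> \<phi> = (\<lambda>_. 0)" if "\<phi> \<in> R" for \<phi>
    using that
  proof (rule R_cases)
    fix a b :: "'g \<Rightarrow> 'f" and w
    assume "a \<in> fin_fun (carrier G)" "b \<in> fin_fun (carrier G)"
      and \<phi>: "\<phi> = (\<lambda>s. basis_elt (\<lambda>x. a x + b x, w) s - (basis_elt (a, w) s + basis_elt (b, w) s))"
    then show "lext \<kappa> \<phi> = (\<lambda>_. 0)"
      unfolding \<phi> \<kappa>_lext_diff[OF fin_add] \<kappa>_lext_add
      by (simp add: \<kappa>_def lext_add fin_funD(1) distrib_left)
  next
    fix a :: "'g \<Rightarrow> 'f" and v w
    assume \<phi>: "\<phi> = (\<lambda>s. basis_elt (a, v + w) s - (basis_elt (a, v) s + basis_elt (a, w) s))"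
    then show "lext \<kappa> \<phi> = (\<lambda>_. 0)"
      unfolding \<phi> \<kappa>_lext_diff[OF fin_add] \<kappa>_lext_add
      by (simp add: \<kappa>_def distrib_right)
  next
    fix c w and a :: "'g \<Rightarrow> 'f"
    assume \<phi>: "\<phi> = (\<lambda>s. basis_elt (\<lambda>x. c * a x, w) s - c * basis_elt (a, w) s)"
    then show "lext \<kappa> \<phi> = (\<lambda>_. 0)"
      unfolding \<phi> \<kappa>_lext_diff[OF fin_smult]
      by (simp add: \<kappa>_def lext_smult mult_ac)
  next
    fix c w and a :: "'g \<Rightarrow> 'f"
    assume \<phi>: "\<phi> = (\<lambda>s. basis_elt (a, c * w) s - c * basis_elt (a, w) s)"
    then show "lext \<kappa> \<phi> = (\<lambda>_. 0)"
      unfolding \<phi> \<kappa>_lext_diff[OF fin_smult]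
      by (simp add: \<kappa>_def lext_smult mult_ac)
  next
    fix a :: "'g \<Rightarrow> 'f" and h w
    assume a: "a \<in> fin_fun (carrier G)" and h: "h \<in> H"
      and \<phi>: "\<phi> = (\<lambda>s. basis_elt (lin_ext (\<lambda>x. x \<otimes> h) a, w) s - basis_elt (a, \<chi> h * w) s)"
    have "lext e (lin_ext (\<lambda>x. x \<otimes> h) a) = lext (\<lambda>g. e (g \<otimes> h)) a"
      using lext_lext[OF a, of "\<lambda>g. basis_elt (g \<otimes> h)" "carrier G" e] h H
      by (simp add: lin_ext_eq_lext fin_funD(1)[OF a] subset_iff)
    also have "\<dots> = lext (\<lambda>g x. \<chi> h * e g x) a"
      using a by (rule lext_cong) (rule e_H[OF _ h])
    also have "\<dots> = (\<lambda>x. \<chi> h * lext e a x)"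
      by (simp add: lext_def fun_eq_iff sum_distrib_left mult_ac)
    finally have "\<kappa> (lin_ext (\<lambda>x. x \<otimes> h) a, w) = \<kappa> (a, \<chi> h * w)"
      by (simp add: \<kappa>_def mult_ac)
    moreover have "finite (supp (basis_elt (a, \<chi> h * w) :: _ \<Rightarrow> 'f))"
      unfolding supp_basis_elt by simp
    ultimately show "lext \<kappa> \<phi> = (\<lambda>_. 0)"
      unfolding \<phi> by (subst \<kappa>_lext_diff) simp_all
  qed
  define N where "N = free_span S \<sigma> R"
  note N_closed = free_span_closed[OF R_sub, where \<sigma> = \<sigma>, folded N_def]
  have N_add: "(\<lambda>s. basis_elt (\<lambda>x. a x + b x, w) s - (basis_elt (a, w) s + basis_elt (b, w) s)) \<in> N"
    if "a \<in> fin_fun (carrier G)" "b \<in> fin_fun (carrier G)" for a b w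
    by (rule subsetD[OF N_closed(1)])
      (use that in \<open>unfold R_def ind_relations_def Let_def group_algebra_simps char_rep_simps, blast\<close>)
  have N_smult: "(\<lambda>s. basis_elt (\<lambda>x. c * a x, w) s - c * basis_elt (a, w) s) \<in> N"
    if "a \<in> fin_fun (carrier G)" for a c w
    by (rule subsetD[OF N_closed(1)])
      (use that in \<open>unfold R_def ind_relations_def Let_def group_algebra_simps char_rep_simps, blast\<close>)
  have N_scalar: "(\<lambda>s. basis_elt (a, c * w) s - c * basis_elt (a, w) s) \<in> N"
    if "a \<in> fin_fun (carrier G)" for a c w
    by (rule subsetD[OF N_closed(1)])
      (use that in \<open>unfold R_def ind_relations_def Let_def group_algebra_simps char_rep_simps, blast\<close>)
  have N_H: "(\<lambda>s. basis_elt (lin_ext (\<lambda>x. x \<otimes> h) a, w) s - basis_elt (a, \<chi> h * w) s) \<in> N"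
    if "a \<in> fin_fun (carrier G)" "h \<in> H" for a h w
    by (rule subsetD[OF N_closed(1)])
      (use that in \<open>unfold R_def ind_relations_def Let_def group_algebra_simps char_rep_simps, blast\<close>)
  define sec where "sec = lext (\<lambda>x. basis_elt (j x) :: ('g \<Rightarrow> 'f) \<times> 'f \<Rightarrow> 'f)"
  have \<kappa>_mem: "\<kappa> s \<in> fin_fun X" if "s \<in> S" for s
    using that lext_fin_fun[of _ "carrier G" e X] e_mem
    by (auto simp: S_def \<kappa>_def intro!: fin_fun_smult)
  have cong: "(\<lambda>s. basis_elt (a, w) s - sec (\<kappa> (a, w)) s) \<in> N" if "a \<in> fin_fun (carrier G)" for a w
    using that
  proof (induction rule: fin_fun_induct)
    case zero
    have "(\<lambda>s. basis_elt (\<lambda>x. 0 * 0, w) s - 0 * basis_elt (\<lambda>_. 0, w) s) \<in> N"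
      by (rule N_smult) simp
    then show ?case by (simp add: \<kappa>_def sec_def)
  next
    case (basis g)
    \<comment> \<open>g sends the basis vector at u0 to a multiple of the one at x, so g lies in the
      coset of \<open>r x\<close>, and h is its part in H.\<close>
    define x where "x = \<tau> (inv g) u0"
    define h where "h = inv (r x) \<otimes> g"
    have x: "x \<in> X" "\<tau> g x = u0" using basis u0 by (simp_all add: x_def \<tau>_closed \<tau>_inv)
    have rx: "r x \<in> carrier G" using r x by simp
    have "\<tau> (inv (r x)) u0 = x" using \<tau>_inv(1)[OF rx x(1)] r(2)[OF x(1)] by simp
    then have "\<tau> h u0 = u0" using rx basis u0 x by (simp add: h_def \<tau>_mult)
    then have h: "h \<in> H" using rx basis by (intro stab) (simp_all add: h_def)
    have g: "g = r x \<otimes> h" using rx basis by (simp add: h_def m_assoc[symmetric])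
    have trans: "lin_ext (\<lambda>y. y \<otimes> h) (basis_elt (r x) :: 'g \<Rightarrow> 'f) = basis_elt g"
      by (simp add: lin_ext_eq_lext supp_basis_elt g)
    \<comment> \<open>Move h across the tensor sign, then extract the scalar
      \<open>\<chi> h * w\<close>.\<close>
    have "(\<lambda>s. basis_elt (basis_elt g, w) s - basis_elt (basis_elt (r x), \<chi> h * w) s) \<in> N"
      using N_H[of "basis_elt (r x)" h w] rx h by (simp add: trans)
    moreover have "(\<lambda>s. basis_elt (basis_elt (r x), \<chi> h * w) s - (\<chi> h * w) * basis_elt (j x) s) \<in> N"
      using N_scalar[of "basis_elt (r x)" "\<chi> h * w" 1] rx by (simp add: j_def)
    ultimately have "(\<lambda>s. basis_elt (basis_elt g, w) s - (\<chi> h * w) * basis_elt (j x) s) \<in> N"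
      using N_closed(4) by fastforce
    moreover have "\<kappa> (basis_elt g, w) = (\<lambda>y. (\<chi> h * w) * basis_elt x y)"
      using e_H[OF rx h] e_r[OF x(1)] by (simp add: \<kappa>_def g mult_ac)
    ultimately show ?case by (simp add: sec_def lext_smult)
  next
    case (add a b)
    have "\<kappa> (\<lambda>s. a s + b s, w) = (\<lambda>x. \<kappa> (a, w) x + \<kappa> (b, w) x)"
      using add(1,2) by (simp add: \<kappa>_def lext_add fin_funD(1) distrib_left)
    moreover have "sec (\<lambda>x. \<kappa> (a, w) x + \<kappa> (b, w) x) = (\<lambda>s. sec (\<kappa> (a, w)) s + sec (\<kappa> (b, w)) s)"
      unfolding sec_def using add(1,2) \<kappa>_mem by (intro lext_add fin_funD(1)[of _ X]) (auto simp: S_def)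
    ultimately show ?case
      using N_closed(4)[OF N_closed(4)[OF add(3,4)] N_add[OF add(1,2), of w]]
      by (simp add: algebra_simps)
  next
    case (smult c a)
    have "\<kappa> (\<lambda>s. c * a s, w) = (\<lambda>x. c * \<kappa> (a, w) x)"
      by (simp add: \<kappa>_def lext_smult mult_ac)
    then show ?case
      using N_closed(4)[OF N_closed(5)[OF smult(2), of c] N_smult[OF smult(1), of c w]]
      by (simp add: sec_def lext_smult algebra_simps)
  qed
  have "rep_iso G ?W (quotient_rep (free_rep S \<sigma>) (free_span S \<sigma> R))
      (\<lambda>w. {\<phi> \<in> fin_fun S. lext \<kappa> \<phi> = w})"
  proof (rule quotient_rep_iso_mono)
    show "monomial_action G X k \<tau>" by unfold_locales
  next
    fix s assume "s \<in> S"
    then show "(\<lambda>u. basis_elt s u - lext (\<lambda>t. basis_elt (j t)) (\<kappa> s) u) \<in> free_span S \<sigma> R"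
      using cong by (auto simp: S_def N_def sec_def)
  next
    fix g s assume g: "g \<in> carrier G" and "s \<in> S"
    then obtain a w where s: "s = (a, w)" "a \<in> fin_fun (carrier G)" by (auto simp: S_def)
    show "\<sigma> g s \<in> S" using left_mem[OF g s(2)] by (simp add: s \<sigma>_def S_def)
    have "lext e (lin_ext (\<lambda>x. g \<otimes> x) a) = lext (\<lambda>h. e (g \<otimes> h)) a"
      using lext_lext[OF s(2), of "\<lambda>h. basis_elt (g \<otimes> h)" "carrier G" e] g
      by (simp add: lin_ext_eq_lext fin_funD(1)[OF s(2)])
    also have "\<dots> = lext (\<lambda>h. act ?W g (e h)) a"
      unfolding e_def using s(2) by (rule lext_cong) (simp only: act_mult g)
    also have "\<dots> = act ?W g (lext e a)" by (rule act_lext[symmetric])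
    finally show "\<kappa> (\<sigma> g s) = act ?W g (\<kappa> s)"
      by (simp add: s \<sigma>_def \<kappa>_def fun_eq_iff)
  next
    fix x assume "x \<in> X"
    then show "j x \<in> S" "\<kappa> (j x) = basis_elt x"
      using r(1) e_r by (auto simp: j_def S_def \<kappa>_def)
  qed (use R_sub R_ker \<kappa>_mem in auto)
  then show ?thesis
    unfolding ind_rep_def Let_def S_def \<sigma>_def R_def group_algebra_simps char_rep_simps by blast
qed

section \<open>Rows as a model of the elementary modules\<close>

section \<open>Elementary modules\<close>

text \<open>Column c of x is supported on indices below c, so the increment at c sees only earlier
  entries of the row. This triangularity makes truncation compatible with the action.\<close>

lemma row_mult_cong:
  assumes "x \<in> mclain_ring" "\<And>b. b < c \<Longrightarrow> u b = v b"
  shows "row_mult u x c - u c = row_mult v x c - v c"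
proof -
  have "(\<Sum>b | x (b, c) \<noteq> 0. u b * x (b, c)) = (\<Sum>b | x (b, c) \<noteq> 0. v b * x (b, c))"
    using assms mclain_ring_memD(2)[OF assms(1)] by (intro sum.cong) auto
  then show ?thesis by (simp add: row_mult_def)
qed

lemma row_mult_below:
  assumes "x \<in> mclain_ring" "\<And>b. b < c \<Longrightarrow> u b = 0"
  shows "row_mult u x c = u c"
  using row_mult_cong[OF assms(1), of c u "\<lambda>_. 0"] assms(2) by (simp add: row_mult_def)

lemma finite_supp_row_mult:
  assumes "x \<in> mclain_ring" "finite (supp u)"
  shows "finite (supp (row_mult u x))"
proof (rule finite_subset)
  show "supp (row_mult u x) \<subseteq> supp u \<union> snd ` supp x"
  proof
    fix c assume c: "c \<in> supp (row_mult u x)"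
    show "c \<in> supp u \<union> snd ` supp x"
    proof (rule ccontr)
      assume n: "c \<notin> supp u \<union> snd ` supp x"
      then have "{b. x (b, c) \<noteq> 0} = {}" by force
      then show False using c n by (simp add: row_mult_def)
    qed
  qed
  show "finite (supp u \<union> snd ` supp x)" using assms by (simp add: mclain_ring_def)
qed

definition trunc_below :: "'l::linorder \<Rightarrow> ('l \<Rightarrow> 'r::zero) \<Rightarrow> 'l \<Rightarrow> 'r" where
  "trunc_below b u = (\<lambda>c. if c < b then u c else 0)"

(* elem_X parametrizes the cosets of P in L by the row of index \<alpha> *)
definition elem_X :: "'l::linorder \<times> 'l \<Rightarrow> ('l \<Rightarrow> 'r::ring_1) set" where
  "elem_X p = {u. finite (supp u) \<and> supp u \<subseteq> {fst p..<snd p} \<and> u (fst p) = 1}"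

definition elem_tau :: "'l::linorder \<times> 'l \<Rightarrow> ('l \<times> 'l \<Rightarrow> 'r::ring_1) \<Rightarrow> ('l \<Rightarrow> 'r) \<Rightarrow> 'l \<Rightarrow> 'r" where
  "elem_tau p g u = trunc_below (snd p) (row_mult u g)"

definition elem_k ::
    "'l::linorder \<times> 'l \<Rightarrow> ('r::ring_1 \<Rightarrow> 'f::field) \<Rightarrow> ('l \<times> 'l \<Rightarrow> 'r) \<Rightarrow> ('l \<Rightarrow> 'r) \<Rightarrow> 'f" where
  "elem_k p \<mu> g u = \<mu> (row_mult u g (snd p))"

text \<open>Truncation first does not affect the new entries after cutting off again, but lowers the
  one in column b by the entry removed. This defect is the source of the cocycle identity for
  \<open>elem_k\<close> and of the multiplier in the overlapping case.\<close>

lemma row_mult_trunc_below: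
  assumes "x \<in> mclain_ring" "c \<le> b"
  shows "row_mult (trunc_below b u) x c = row_mult u x c - (if c = b then u b else 0)"
proof -
  have "row_mult (trunc_below b u) x c - trunc_below b u c = row_mult u x c - u c"
    using assms by (intro row_mult_cong) (auto simp: trunc_below_def)
  moreover have "trunc_below b u c = (if c = b then 0 else u c)"
    using assms(2) by (auto simp: trunc_below_def)
  ultimately show ?thesis by (cases "c = b") simp_all
qed

lemma linear_charD:
  assumes "linear_char \<mu>"
  shows "\<mu> (a + b) = \<mu> a * \<mu> b" "\<mu> a \<noteq> 0" "\<mu> 0 = 1"
proof -
  have h: "\<mu> \<in> UNIV \<rightarrow> Units class_ring" and add: "\<mu> (a + b) = \<mu> a * \<mu> b" for a b
    using assms by (auto simp: linear_char_def hom_def units_of_def)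
  show "\<mu> (a + b) = \<mu> a * \<mu> b" by (rule add)
  show nz: "\<mu> a \<noteq> 0" for a
  proof -
    have "\<mu> a \<in> Units class_ring" using h by blast
    then show ?thesis by (auto simp: Units_def)
  qed
  show "\<mu> 0 = 1" using add[of 0 0] nz[of 0] by simp
qed

lemma elem_XD:
  assumes "u \<in> elem_X (a, b)"
  shows "finite (supp u)" "c < a \<Longrightarrow> u c = 0" "u a = 1" "b \<le> c \<Longrightarrow> u c = 0"
  using assms unfolding elem_X_def by (auto simp: subset_iff not_le[symmetric])

text \<open>The entry in column b that truncation removes after g is exactly the argument of \<mu>
  in the first scalar, so the two scalars multiply to that of the product.\<close>

lemma elem_monomial_action:
  assumes p: "p \<in> Phi" and \<mu>: "linear_char \<mu>"
  shows "monomial_action mclain_group (elem_X p) (elem_k p \<mu>) (elem_tau p)"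
proof -
  obtain a b where ab: "p = (a, b)" "a < b" using p by (auto simp: Phi_def)
  have trunc: "trunc_below b u = u" if "u \<in> elem_X p" for u
    using elem_XD(4)[of u a b] that by (auto simp: trunc_below_def ab fun_eq_iff)
  show ?thesis
  proof (unfold_locales, goal_cases)
    case (1 g x)
    then have g: "g \<in> mclain_ring" and x: "x \<in> elem_X (a, b)" by (simp_all add: ab)
    define w where "w = trunc_below b (row_mult x g)"
    have fin: "finite (supp w)"
      by (rule finite_subset[OF _ finite_supp_row_mult[OF g elem_XD(1)[OF x]]])
        (auto simp: w_def trunc_below_def)
    \<comment> \<open>The row vanishes before a, so the action cannot change its entries up to
      a.\<close>
    have low: "row_mult x g c = x c" if "c \<le> a" for c
      using row_mult_below[OF g, of c x] elem_XD(2)[OF x] that by auto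
    have "w c = 0" if "\<not> (a \<le> c \<and> c < b)" for c
      using that elem_XD(2)[OF x, of c] low[of c] by (auto simp: w_def trunc_below_def)
    then have "supp w \<subseteq> {a..<b}" by (metis (mono_tags, lifting) atLeastLessThan_iff mem_Collect_eq subsetI)
    moreover have "w a = 1"
      using low[of a] elem_XD(3)[OF x] ab by (simp add: w_def trunc_below_def)
    ultimately show ?case
      using fin by (simp add: elem_X_def elem_tau_def ab w_def[symmetric])
  next
    case (2 x)
    then show ?case using trunc by (simp add: elem_tau_def ab)
  next
    case (3 g h x)
    then have "trunc_below b (row_mult (row_mult x g) h)
        = trunc_below b (row_mult (trunc_below b (row_mult x g)) h)"
      by (auto simp: trunc_below_def[of _ "row_mult _ h"] row_mult_trunc_below)
    then show ?case using 3 unfolding elem_tau_def ab by (simp only: row_mult_mult mclain_carrier snd_conv)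
  next
    case (4 x)
    then show ?case using elem_XD(4)[of x a b b] linear_charD(3)[OF \<mu>] by (simp add: elem_k_def ab)
  next
    case (5 g h x)
    then show ?case
      using linear_charD(1)[OF \<mu>, symmetric]
      by (simp add: elem_k_def elem_tau_def row_mult_mult row_mult_trunc_below ab)
  qed
qed

lemma monomial_action_subgroup:
  assumes "monomial_action G X k \<tau>" "subgroup H G"
  shows "monomial_action (G\<lparr>carrier := H\<rparr>) X k \<tau>"
proof -
  interpret monomial_action G X k \<tau> by fact
  interpret H: group "G\<lparr>carrier := H\<rparr>"
    using assms(2) by (rule subgroup.subgroup_is_group) (rule is_group)
  have "h \<in> carrier G" if "h \<in> H" for h using subgroup.mem_carrier[OF assms(2) that] .
  then show ?thesis
    by unfold_locales (auto simp: \<tau>_closed \<tau>_one \<tau>_mult k_one k_mult)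
qed

section \<open>The subgroup P of L, its linear character, and induction from P to L\<close>

definition interval_roots :: "'l::linorder \<times> 'l \<Rightarrow> ('l \<times> 'l) set" where
  "interval_roots = (\<lambda>(a, b). {(c, d). a \<le> c \<and> c < d \<and> d \<le> b})"

lemma closed_interval_roots: "closed_roots (interval_roots p)"
  by (cases p) (auto simp: closed_roots_def interval_roots_def Phi_def)

lemma closed_elem_P_roots: "closed_roots (elem_P_roots p)"
  by (cases p) (auto simp: closed_roots_def elem_P_roots_def Phi_def)

lemma elem_L_eq: "elem_L p = {x \<in> mclain_ring. supp x \<subseteq> interval_roots p}"
  using mclain_subgroup_eq[OF closed_interval_roots, of p]
  by (cases p) (simp add: elem_L_def interval_roots_def)

lemma elem_P_eq: "elem_P p = {x \<in> mclain_ring. supp x \<subseteq> elem_P_roots p}"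
  unfolding elem_P_def by (rule mclain_subgroup_eq[OF closed_elem_P_roots])

lemma subgroup_elem_L: "subgroup (elem_L p) mclain_group"
  unfolding elem_L_eq by (rule subgroup_supp[OF closed_interval_roots])

text \<open>A product contributing to entry (a, b) would pass through some c with (a, c) a root of
  P; this forces c = b, and (b, b) is no root.\<close>

lemma elem_P_mult:
  assumes "x \<in> elem_P p" "y \<in> elem_P p"
  shows "(x \<otimes>\<^bsub>mclain_group\<^esub> y) p = x p + y p"
proof -
  obtain a b where ab: "p = (a, b)" by (cases p)
  have "mclain_ring_mult x y (a, b) = 0"
  proof (rule ccontr)
    assume "mclain_ring_mult x y (a, b) \<noteq> 0"
    then obtain c where "x (a, c) \<noteq> 0" "y (c, b) \<noteq> 0" using mclain_ring_mult_nonzeroD by blast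
    then have "(a, c) \<in> elem_P_roots (a, b)" "(c, b) \<in> elem_P_roots (a, b)"
      using assms unfolding elem_P_eq ab by auto
    then show False by (auto simp: elem_P_roots_def)
  qed
  then show ?thesis by (simp add: mclain_mult ab)
qed

lemma root_elt_elem_P: "q \<in> elem_P_roots p \<Longrightarrow> root_elt r q \<in> elem_P p"
  unfolding elem_P_def mclain_subgroup_def root_subgroup_def by (rule generate.incl) blast

text \<open>Taking h to \<mu> of its entry at p is a character with the prescribed values, so the
  choice in \<open>elem_char\<close> succeeds. Any such character is determined on P, because P is
  generated by the root elements on which it is prescribed.\<close>

lemma elem_char_eq:
  fixes \<mu> :: "'r::ring_1 \<Rightarrow> 'f::field" and p :: "'l::linorder \<times> 'l"
  assumes p: "p \<in> Phi" and \<mu>: "linear_char \<mu>" and h: "h \<in> elem_P p"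
  shows "elem_char p \<mu> h = \<mu> (h p)"
proof -
  define Q where "Q \<chi> \<longleftrightarrow>
     \<chi> \<in> hom (mclain_group\<lparr>carrier := elem_P p\<rparr>) (units_of class_ring) \<and>
     (\<forall>r. \<chi> (root_elt r p) = \<mu> r) \<and>
     (\<forall>q\<in>elem_P_roots p - {p}. \<forall>r. \<chi> (root_elt r q) = 1)"
    for \<chi> :: "('l \<times> 'l \<Rightarrow> 'r) \<Rightarrow> 'f"
  have p_root: "p \<in> elem_P_roots p"
    using p by (auto simp: elem_P_roots_def Phi_def)
  have "Q (\<lambda>h. \<mu> (h p))"
    unfolding Q_def
  proof (intro conjI allI ballI)
    have "\<mu> \<in> UNIV \<rightarrow> Units class_ring"
      using \<mu> by (auto simp: linear_char_def hom_def units_of_def)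
    then show "(\<lambda>h. \<mu> (h p)) \<in> hom (mclain_group\<lparr>carrier := elem_P p\<rparr>) (units_of class_ring)"
      by (auto simp: hom_def units_of_def elem_P_mult linear_charD(1)[OF \<mu>] Pi_def)
  qed (auto simp: root_elt_def linear_charD(3)[OF \<mu>])
  then have "Q (SOME \<chi>. Q \<chi>)" by (rule someI[where P = Q])
  then have Q: "Q (elem_char p \<mu>)" unfolding elem_char_def Q_def .
  then have hom: "elem_char p \<mu> (x \<otimes>\<^bsub>mclain_group\<^esub> y) = elem_char p \<mu> x * elem_char p \<mu> y"
    if "x \<in> elem_P p" "y \<in> elem_P p" for x y
    using that by (auto simp: Q_def hom_def units_of_def)
  have root: "elem_char p \<mu> (root_elt r q) = \<mu> (root_elt r q p)" if "q \<in> elem_P_roots p" for r q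
    using Q that linear_charD(3)[OF \<mu>] by (auto simp: Q_def root_elt_def)
  have "h \<in> mclain_ring" "supp h \<subseteq> elem_P_roots p" using h by (simp_all add: elem_P_eq)
  then show ?thesis
  proof (induction rule: mclain_induct)
    case one
    have "root_elt 0 p = (\<lambda>_. 0 :: 'r)" by (auto simp: root_elt_def)
    then show ?case using root[OF p_root, of 0] by simp
  next
    case (mult x r q)
    then have "x \<in> elem_P p" by (simp add: elem_P_eq)
    note P = this root_elt_elem_P[OF mult(3), of r]
    show ?case
      unfolding hom[OF P] root[OF mult(3)] mult(5) elem_P_mult[OF P] by (rule linear_charD(1)[OF \<mu>, symmetric])
  qed
qed

text \<open>The entry u a = 1 is dropped because the element stands for 1 plus this matrix. Its
  inverse will serve as the coset representative belonging to u.\<close>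

definition row_elt :: "'l \<Rightarrow> ('l \<Rightarrow> 'r::ring_1) \<Rightarrow> 'l \<times> 'l \<Rightarrow> 'r" where
  "row_elt a u = (\<lambda>(c, d). if c = a \<and> d \<noteq> a then u d else 0)"

lemma row_elt_mem:
  assumes "u \<in> elem_X (a, b)"
  shows "row_elt a u \<in> mclain_ring" "supp (row_elt a u) \<subseteq> interval_roots (a, b)"
    "row_mult (unit_row a) (row_elt a u) = u"
proof -
  have sub: "supp (row_elt a u) \<subseteq> {a} \<times> (supp u \<inter> {a<..<b})"
    using elem_XD[OF assms] by (fastforce simp: row_elt_def not_le[symmetric] split: if_splits)
  then have "finite (supp (row_elt a u))"
    by (rule finite_subset) (use elem_XD(1)[OF assms] in auto)
  then show mem: "row_elt a u \<in> mclain_ring"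
    using sub by (auto simp: mclain_ring_def Phi_def)
  show "supp (row_elt a u) \<subseteq> interval_roots (a, b)"
  proof -
    have "{a} \<times> (supp u \<inter> {a<..<b}) \<subseteq> interval_roots (a, b)" by (auto simp: interval_roots_def)
    then show ?thesis using sub by blast
  qed
  show "row_mult (unit_row a) (row_elt a u) = u"
    using elem_XD(3)[OF assms] row_mult_unit_row[OF mem]
    by (auto simp: fun_eq_iff unit_row_def row_elt_def)
qed

lemma unit_row_elem_X: "a < b \<Longrightarrow> unit_row a \<in> elem_X (a, b)"
  by (auto simp: elem_X_def unit_row_def)

text \<open>L moves \<open>unit_row a\<close> to every row, and an element of L fixes it after
  truncation exactly when its entries (a, c) with c < b vanish, that is, when it lies in P. Its
  scalar there is \<mu> of the entry at p.\<close>

lemma elem_ind_rep_iso: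
  fixes \<mu> :: "'r::ring_1 \<Rightarrow> 'f::field" and p :: "'l::linorder \<times> 'l"
  assumes p: "p \<in> Phi" and \<mu>: "linear_char \<mu>"
  shows "\<exists>\<psi>. rep_iso (mclain_group\<lparr>carrier := elem_L p\<rparr>)
    (mono_rep (elem_X p) (elem_k p \<mu>) (elem_tau p))
    (ind_rep (mclain_group\<lparr>carrier := elem_L p\<rparr>) (elem_P p) (char_rep (elem_char p \<mu>))) \<psi>"
proof -
  obtain a b where ab: "p = (a, b)" "a < b" using p by (auto simp: Phi_def)
  let ?u0 = "unit_row a :: 'l \<Rightarrow> 'r"
  interpret L: monomial_action "mclain_group\<lparr>carrier := elem_L p\<rparr>" "elem_X p" "elem_k p \<mu>" "elem_tau p"
    by (rule monomial_action_subgroup[OF elem_monomial_action[OF assms] subgroup_elem_L])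
  have row: "row_mult ?u0 g c = ?u0 c + g (a, c)" if "g \<in> mclain_ring" for g c
    using that by (rule row_mult_unit_row)
  show ?thesis
  proof (rule L.ind_rep_iso_mono)
    show "elem_P p \<subseteq> carrier (mclain_group\<lparr>carrier := elem_L p\<rparr>)"
      by (auto simp: elem_P_eq elem_L_eq elem_P_roots_def interval_roots_def ab)
    show u0: "?u0 \<in> elem_X p" using ab unit_row_elem_X by simp
    fix g :: "'l \<times> 'l \<Rightarrow> 'r" assume "g \<in> carrier (mclain_group\<lparr>carrier := elem_L p\<rparr>)" and stab: "elem_tau p g ?u0 = ?u0"
    then have g: "g \<in> mclain_ring" "supp g \<subseteq> interval_roots p" by (simp_all add: elem_L_eq)
    have "g (a, c) = 0" if "c < b" for c
      using fun_cong[OF stab, of c] that row[OF g(1)] by (simp add: elem_tau_def trunc_below_def ab)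
    then have "supp g \<subseteq> elem_P_roots p"
      using g(2) by (force simp: interval_roots_def elem_P_roots_def ab)
    then show "g \<in> elem_P p" using g by (simp add: elem_P_eq)
  next
    fix h :: "'l \<times> 'l \<Rightarrow> 'r" assume h: "h \<in> elem_P p"
    then have h': "h \<in> mclain_ring" "supp h \<subseteq> elem_P_roots p" by (simp_all add: elem_P_eq)
    have "h (a, c) = 0" if "c < b" for c
    proof (rule ccontr)
      assume "h (a, c) \<noteq> 0"
      then have "(a, c) \<in> elem_P_roots p" using h'(2) by blast
      then show False using that by (auto simp: elem_P_roots_def ab)
    qed
    then show "elem_tau p h ?u0 = ?u0"
      using ab unfolding elem_tau_def trunc_below_def row[OF h'(1)] by (auto simp: fun_eq_iff unit_row_def)
    show "elem_k p \<mu> h ?u0 = elem_char p \<mu> h"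
      using ab unfolding elem_char_eq[OF p \<mu> h] elem_k_def row[OF h'(1)] by (auto simp: unit_row_def)
  next
    \<comment> \<open>The inverse row element takes u back to the unit row even before truncation,
      so the entry in column b is 0 and the scalar is 1.\<close>
    let ?r = "\<lambda>u. inv\<^bsub>mclain_group\<^esub> (row_elt a u)"
    fix u :: "'l \<Rightarrow> 'r" assume "u \<in> elem_X p"
    then have u: "u \<in> elem_X (a, b)" by (simp add: ab)
    note r = row_elt_mem[OF u]
    have "row_elt a u \<in> elem_L p" using r by (simp add: elem_L_eq ab)
    then have rL: "?r u \<in> elem_L p" by (rule subgroup.m_inv_closed[OF subgroup_elem_L])
    then show "?r u \<in> carrier (mclain_group\<lparr>carrier := elem_L p\<rparr>)" by simp
    have rM: "?r u \<in> mclain_ring" using rL by (simp add: elem_L_eq)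
    have "row_mult u (?r u) = row_mult (row_mult ?u0 (row_elt a u)) (?r u)" by (simp add: r(3))
    also have "\<dots> = row_mult ?u0 (row_elt a u \<otimes>\<^bsub>mclain_group\<^esub> ?r u)"
      by (rule row_mult_mult[OF r(1) rM, symmetric])
    also have "\<dots> = ?u0" using mclain.r_inv[of "row_elt a u"] r(1) by simp
    finally have "row_mult u (?r u) = ?u0" .
    then show "elem_tau p (?r u) u = ?u0" "elem_k p \<mu> (?r u) u = 1"
      using ab linear_charD(3)[OF \<mu>]
      by (auto simp: elem_tau_def elem_k_def trunc_below_def unit_row_def fun_eq_iff)
  qed
qed

section \<open>The projection of M onto L with kernel N\<close>

definition interval_part :: "'l::linorder \<times> 'l \<Rightarrow> ('l \<times> 'l \<Rightarrow> 'r::ring_1) \<Rightarrow> 'l \<times> 'l \<Rightarrow> 'r" where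
  "interval_part p x = (\<lambda>q. if q \<in> interval_roots p then x q else 0)"

lemma interval_part_mem:
  "x \<in> mclain_ring \<Longrightarrow> interval_part p x \<in> mclain_ring"
proof -
  assume x: "x \<in> mclain_ring"
  have sub: "supp (interval_part p x) \<subseteq> supp x" by (auto simp: interval_part_def)
  moreover have "finite (supp (interval_part p x))"
    using x by (intro finite_subset[OF sub]) (simp add: mclain_ring_def)
  ultimately show ?thesis using x by (auto simp: mclain_ring_def)
qed

lemma interval_part_elem_L: "x \<in> mclain_ring \<Longrightarrow> interval_part p x \<in> elem_L p"
  using interval_part_mem[of x p] by (auto simp: elem_L_eq interval_part_def)

lemma interval_part_id: "x \<in> elem_L p \<Longrightarrow> interval_part p x = x"
  by (auto simp: elem_L_eq interval_part_def fun_eq_iff)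

text \<open>Two facts about intervals are behind this: an index strictly between the ends of an
  inner root gives two inner roots, and two composable inner roots compose to an inner root.\<close>

lemma interval_part_mult:
  assumes x: "x \<in> mclain_ring" and y: "y \<in> mclain_ring"
  shows "interval_part p (x \<otimes>\<^bsub>mclain_group\<^esub> y)
    = interval_part p x \<otimes>\<^bsub>mclain_group\<^esub> interval_part p y"
proof
  fix q :: "'a \<times> 'a"
  obtain a b c d where pq: "p = (a, b)" "q = (c, d)" by (cases p, cases q)
  define B where "B = fst ` supp y"
  have B: "finite B" using y by (auto simp: B_def mclain_ring_def)
  have By: "e \<in> B" if "y (e, d) \<noteq> 0" for e using that unfolding B_def by force
  have By': "e \<in> B" if "interval_part p y (e, d) \<noteq> 0" for e
    using that By by (auto simp: interval_part_def split: if_splits)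
  show "interval_part p (x \<otimes>\<^bsub>mclain_group\<^esub> y) q
    = (interval_part p x \<otimes>\<^bsub>mclain_group\<^esub> interval_part p y) q"
  proof (cases "q \<in> interval_roots p")
    case True
    have "x (c, e) * y (e, d) = interval_part p x (c, e) * interval_part p y (e, d)" for e
    proof (cases "c < e \<and> e < d")
      case True
      then show ?thesis using \<open>q \<in> interval_roots p\<close> by (auto simp: interval_part_def interval_roots_def pq)
    next
      case False
      then have "x (c, e) = 0 \<or> y (e, d) = 0"
        using mclain_ring_memD(2)[OF x, of c e] mclain_ring_memD(2)[OF y, of e d] by blast
      then show ?thesis by (auto simp: interval_part_def)
    qed
    then have "mclain_ring_mult x y (c, d)
        = mclain_ring_mult (interval_part p x) (interval_part p y) (c, d)"
      by (simp add: mclain_ring_mult_eq[where c = d and B = B, OF B] By By')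
    then show ?thesis using True by (simp add: interval_part_def mclain_mult pq)
  next
    case False
    have "mclain_ring_mult (interval_part p x) (interval_part p y) (c, d) = 0"
    proof (rule ccontr)
      assume "mclain_ring_mult (interval_part p x) (interval_part p y) (c, d) \<noteq> 0"
      then obtain e where "interval_part p x (c, e) \<noteq> 0" "interval_part p y (e, d) \<noteq> 0"
        using mclain_ring_mult_nonzeroD by blast
      then have "(c, e) \<in> interval_roots p" "(e, d) \<in> interval_roots p"
        by (auto simp: interval_part_def split: if_splits)
      then show False using False by (auto simp: interval_roots_def pq)
    qed
    then show ?thesis using False by (simp add: interval_part_def mclain_mult pq)
  qed
qed

lemma group_hom_interval_part:
  "group_hom mclain_group mclain_group (interval_part p)"
  by (intro group_hom.intro group_mclain group_hom_axioms.intro homI)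
    (simp_all only: mclain_carrier interval_part_mem interval_part_mult)

text \<open>\<open>elem_N\<close> is the smallest normal subgroup containing the outer root
  subgroups. The kernel of the projection is one such subgroup; conversely an element of the kernel
  is supported on outer roots, hence is a product of their root elements.\<close>

lemma elem_N_eq:
  "elem_N p = {x \<in> mclain_ring. interval_part p x = (\<lambda>_. 0)}"
proof
  obtain a b where ab: "p = (a, b)" by (cases p)
  interpret group_hom mclain_group mclain_group "interval_part p"
    by (rule group_hom_interval_part)
  let ?J = "{(c, d). c < d \<and> (c < a \<or> b < d)}"
  show "elem_N p \<subseteq> {x \<in> mclain_ring. interval_part p x = (\<lambda>_. 0)}"
  proof -
    have "kernel mclain_group mclain_group (interval_part p) \<lhd> mclain_group"
      by (rule normal_kernel)
    moreover have "(\<Union>q\<in>?J. root_subgroup q) \<subseteq> kernel mclain_group mclain_group (interval_part p)"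
    proof -
      have "root_elt r q \<in> mclain_ring" "interval_part p (root_elt r q) = (\<lambda>_. 0)" if "q \<in> ?J" for r q
        using that root_elt_mem[of q r]
        by (auto simp: Phi_def interval_part_def root_elt_def interval_roots_def ab fun_eq_iff)
      then show ?thesis unfolding root_subgroup_def kernel_def mclain_one mclain_carrier by blast
    qed
    ultimately have "elem_N p \<subseteq> kernel mclain_group mclain_group (interval_part p)"
      unfolding elem_N_def ab by auto
    then show ?thesis by (simp add: kernel_def)
  qed
  show "{x \<in> mclain_ring. interval_part p x = (\<lambda>_. 0)} \<subseteq> elem_N p"
  proof
    fix x assume "x \<in> {x \<in> mclain_ring. interval_part p x = (\<lambda>_. 0)}"
    then have x: "x \<in> mclain_ring" "interval_part p x = (\<lambda>_. 0)" by auto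
    have "supp x \<subseteq> ?J"
    proof
      fix q assume q: "q \<in> supp x"
      obtain c d where cd: "q = (c, d)" by (cases q)
      have "c < d" using mclain_ring_memD(2)[OF x(1), of c d] q cd by simp
      moreover have "q \<notin> interval_roots p"
        using fun_cong[OF x(2), of q] q by (auto simp: interval_part_def)
      ultimately show "q \<in> ?J" by (auto simp: cd ab interval_roots_def)
    qed
    then have "x \<in> mclain_subgroup ?J" by (rule mem_mclain_subgroup[OF x(1)])
    moreover have "mclain_subgroup ?J \<subseteq> K"
      if "K \<lhd> mclain_group" "(\<Union>q\<in>?J. root_subgroup q) \<subseteq> K" for K
      unfolding mclain_subgroup_def
      by (rule mclain.generate_subgroup_incl[OF that(2) normal_imp_subgroup[OF that(1)]])
    ultimately show "x \<in> elem_N p" unfolding elem_N_def ab by blast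
  qed
qed

text \<open>The projection is multiplicative, trivial on N and the identity on L, so it must return
  the factor in L. Existence comes from taking n as m times the inverse of the projection.\<close>

lemma inflate_proj:
  assumes m: "m \<in> mclain_ring"
  shows "(THE l. l \<in> elem_L p \<and> (\<exists>n\<in>elem_N p. m = n \<otimes>\<^bsub>mclain_group\<^esub> l)) = interval_part p m"
proof (rule the_equality)
  interpret group_hom mclain_group mclain_group "interval_part p"
    by (rule group_hom_interval_part)
  define l where "l = interval_part p m"
  have l: "l \<in> carrier mclain_group" "l \<in> elem_L p"
    using m by (simp_all add: l_def interval_part_mem interval_part_elem_L)
  have ll: "interval_part p l = l" using l(2) by (rule interval_part_id)
  define n where "n = m \<otimes>\<^bsub>mclain_group\<^esub> inv\<^bsub>mclain_group\<^esub> l"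
  have n: "n \<in> carrier mclain_group" unfolding n_def using m mclain.inv_closed[OF l(1)] by (intro mclain.m_closed) simp_all
  have "interval_part p n = interval_part p m \<otimes>\<^bsub>mclain_group\<^esub> interval_part p (inv\<^bsub>mclain_group\<^esub> l)"
    unfolding n_def using m mclain.inv_closed[OF l(1)] by (intro interval_part_mult) simp_all
  also have "\<dots> = l \<otimes>\<^bsub>mclain_group\<^esub> inv\<^bsub>mclain_group\<^esub> l"
    unfolding hom_inv[OF l(1)] ll by (simp only: l_def)
  also have "\<dots> = (\<lambda>_. 0)" using mclain.r_inv[OF l(1)] by simp
  finally have nN: "n \<in> elem_N p" using n by (simp add: elem_N_eq)
  have "m = n \<otimes>\<^bsub>mclain_group\<^esub> l"
    unfolding n_def using m l mclain.inv_closed[OF l(1)] mclain.l_inv[OF l(1)]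
    by (simp add: mclain.m_assoc)
  then show "interval_part p m \<in> elem_L p \<and>
      (\<exists>n\<in>elem_N p. m = n \<otimes>\<^bsub>mclain_group\<^esub> interval_part p m)"
    using l nN by (auto simp: l_def)
next
  fix l assume "l \<in> elem_L p \<and> (\<exists>n\<in>elem_N p. m = n \<otimes>\<^bsub>mclain_group\<^esub> l)"
  then obtain n where l: "l \<in> elem_L p" and n: "n \<in> elem_N p" "m = n \<otimes>\<^bsub>mclain_group\<^esub> l" by blast
  have "interval_part p m = interval_part p n \<otimes>\<^bsub>mclain_group\<^esub> interval_part p l"
    unfolding n(2) using l n(1) by (intro interval_part_mult) (simp_all add: elem_L_eq elem_N_eq)
  also have "interval_part p n = (\<lambda>_. 0)" using n(1) by (simp add: elem_N_eq)
  finally show "l = interval_part p m" using interval_part_id[OF l] by simp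
qed

text \<open>A row starting at a, read up to column b, meets only entries of x inside the interval.
  Hence the row formulas found for L describe the inflated action of M without change.\<close>

lemma row_mult_interval_part:
  assumes x: "x \<in> mclain_ring" and u: "\<And>c. c < a \<Longrightarrow> u c = 0" and c: "c \<le> b"
  shows "row_mult u (interval_part (a, b) x) c = row_mult u x c"
proof -
  have fin: "finite (fst ` supp x)" using x by (simp add: mclain_ring_def)
  have "row_mult u (interval_part (a, b) x) c
      = u c + (\<Sum>e\<in>fst ` supp x. u e * interval_part (a, b) x (e, c))"
    by (rule row_mult_eq[OF fin]) (force simp: interval_part_def split: if_splits)
  also have "(\<Sum>e\<in>fst ` supp x. u e * interval_part (a, b) x (e, c))
      = (\<Sum>e\<in>fst ` supp x. u e * x (e, c))"
  proof (rule sum.cong)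
    fix e
    show "u e * interval_part (a, b) x (e, c) = u e * x (e, c)"
      using u[of e] c mclain_ring_memD(2)[OF x, of e c]
      by (cases "e < a"; cases "x (e, c) = 0") (auto simp: interval_part_def interval_roots_def)
  qed simp
  also have "u c + \<dots> = row_mult u x c"
    by (rule row_mult_eq[OF fin, symmetric]) force
  finally show ?thesis .
qed

text \<open>The isomorphism obtained for L also serves for M, because both sides see a group element
  only through its projection to L.\<close>

lemma elementary_rep_iso:
  fixes \<mu> :: "'r::ring_1 \<Rightarrow> 'f::field" and p :: "'l::linorder \<times> 'l"
  assumes p: "p \<in> Phi" and \<mu>: "linear_char \<mu>"
  shows "\<exists>\<psi>. rep_iso mclain_group (mono_rep (elem_X p) (elem_k p \<mu>) (elem_tau p))
    (elementary_rep p \<mu>) \<psi>"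
proof -
  obtain a b where ab: "p = (a, b)" "a < b" using p by (auto simp: Phi_def)
  let ?W = "mono_rep (elem_X p) (elem_k p \<mu>) (elem_tau p)
    :: ('f, ('l \<Rightarrow> 'r) \<Rightarrow> 'f, 'l \<times> 'l \<Rightarrow> 'r) rep"
  define V where
    "V = ind_rep (mclain_group\<lparr>carrier := elem_L p\<rparr>) (elem_P p) (char_rep (elem_char p \<mu>))"
  obtain \<psi> where \<psi>: "rep_iso (mclain_group\<lparr>carrier := elem_L p\<rparr>) ?W V \<psi>"
    using elem_ind_rep_iso[OF assms] V_def by blast
  have act: "act ?W m \<phi> = act ?W (interval_part p m) \<phi>" if m: "m \<in> mclain_ring" for m :: "'l \<times> 'l \<Rightarrow> 'r" and \<phi>
  proof -
    have "row_mult u (interval_part p m) c = row_mult u m c" if "u \<in> elem_X p" "c \<le> b"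
      for u :: "'l \<Rightarrow> 'r" and c
      using that row_mult_interval_part[OF m elem_XD(2)[of u a b]] by (simp add: ab)
    then show ?thesis
      by (auto simp: fun_eq_iff elem_k_def elem_tau_def trunc_below_def[abs_def] ab cong: if_cong)
  qed
  have "rep_iso mclain_group ?W (elementary_rep p \<mu>) \<psi>"
    unfolding rep_iso_def
  proof (intro conjI ballI)
    fix g :: "'l \<times> 'l \<Rightarrow> 'r" and \<phi> assume g: "g \<in> carrier mclain_group" and \<phi>: "\<phi> \<in> carrier ?W"
    have "\<psi> (act ?W g \<phi>) = \<psi> (act ?W (interval_part p g) \<phi>)" using act g by simp
    also have "\<dots> = act V (interval_part p g) (\<psi> \<phi>)"
      using rep_isoD(7)[OF \<psi>, of "interval_part p g" \<phi>]
        interval_part_elem_L[of g p] g \<phi> by simp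
    also have "\<dots> = act (elementary_rep p \<mu>) g (\<psi> \<phi>)"
      using g inflate_proj[of g p] by (simp add: elementary_rep_def inflate_def V_def[symmetric])
    finally show "\<psi> (act ?W g \<phi>) = act (elementary_rep p \<mu>) g (\<psi> \<phi>)" .
  qed (use \<psi> in \<open>auto simp: rep_iso_def elementary_rep_def inflate_def V_def[symmetric]\<close>)
  then show ?thesis by blast
qed

lemma basic_rep_iso:
  fixes f :: "'l::linorder \<times> 'l \<Rightarrow> 'r::ring_1 \<Rightarrow> 'f::field"
  assumes D: "basic_set D" and f: "\<And>d. d \<in> D \<Longrightarrow> linear_char (f d)"
  defines "k \<equiv> tensor_k D (\<lambda>d. elem_k d (f d))" and "\<tau> \<equiv> tensor_tau D elem_tau"
  shows "monomial_action mclain_group (PiE D elem_X) k \<tau>"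
    "\<exists>\<Psi>. rep_iso mclain_group (mono_rep (PiE D elem_X) k \<tau>) (basic_rep D f) \<Psi>"
proof -
  have Phi: "d \<in> Phi" if "d \<in> D" for d using D that by (auto simp: basic_set_def)
  have mono: "monomial_action mclain_group (elem_X d) (elem_k d (f d)) (elem_tau d)" if "d \<in> D" for d
    by (rule elem_monomial_action[OF Phi[OF that] f[OF that]])
  show "monomial_action mclain_group (PiE D elem_X) k \<tau>"
    unfolding k_def \<tau>_def by (rule tensor_monomial_action[OF group_mclain mono])
  have "\<forall>d\<in>D. \<exists>\<psi>. rep_iso mclain_group (mono_rep (elem_X d) (elem_k d (f d)) (elem_tau d))
      (elementary_rep d (f d)) \<psi>"
    using elementary_rep_iso[OF Phi f] by blast
  then obtain \<psi> where \<psi>: "\<And>d. d \<in> D \<Longrightarrow> rep_iso mclain_group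
      (mono_rep (elem_X d) (elem_k d (f d)) (elem_tau d)) (elementary_rep d (f d)) (\<psi> d)"
    by metis
  then show "\<exists>\<Psi>. rep_iso mclain_group (mono_rep (PiE D elem_X) k \<tau>) (basic_rep D f) \<Psi>"
    unfolding k_def \<tau>_def basic_rep_def using D
    by (intro tensor_rep_iso_mono[OF group_mclain _ mono \<psi>]) (simp_all add: basic_set_def)
qed

section \<open>Irreducibility and scalar endomorphisms read off from the monomial data\<close>

section \<open>Criteria for monomial representations\<close>

context monomial_action
begin

text \<open>As \<open>\<tau> g\<close> is injective on X and fixes S pointwise, it maps no point
  outside S into S; so nothing new enters the support.\<close>

lemma act_fixed:
  assumes g: "g \<in> carrier G" and S: "S \<subseteq> X" "\<And>u. u \<in> S \<Longrightarrow> \<tau> g u = u" and \<phi>: "supp \<phi> \<subseteq> S"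
  shows "act (mono_rep X k \<tau>) g \<phi> = (\<lambda>x. k g x * \<phi> x)"
proof
  fix x
  have "\<tau> g x \<notin> S" if "x \<in> X" "x \<notin> S"
  proof
    assume "\<tau> g x \<in> S"
    then have "\<tau> g x = x"
      using \<tau>_inj[OF g, of "\<tau> g x" x] S \<tau>_closed[OF g] that by auto
    then show False using \<open>\<tau> g x \<in> S\<close> that by simp
  qed
  moreover have "\<phi> y = 0" if "y \<notin> S" for y using \<phi> that by auto
  ultimately show "act (mono_rep X k \<tau>) g \<phi> x = k g x * \<phi> x"
    using S by (cases "x \<in> S") auto
qed

lemma transitive:
  assumes u0: "u0 \<in> X" "\<And>x. x \<in> X \<Longrightarrow> \<exists>g\<in>carrier G. \<tau> g u0 = x" and "x \<in> X" "y \<in> X"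
  shows "\<exists>g\<in>carrier G. \<tau> g y = x"
proof -
  obtain g h where gh: "g \<in> carrier G" "\<tau> g u0 = y" "h \<in> carrier G" "\<tau> h u0 = x"
    using u0(2) assms(3,4) by meson
  then have "\<tau> (inv g) y = u0" using \<tau>_inv(1)[OF gh(1) u0(1)] by simp
  then have "\<tau> (inv g \<otimes> h) y = x" using gh assms(4) by (simp add: \<tau>_mult)
  then show ?thesis using gh by blast
qed

text \<open>Separation provides group elements that are diagonal on a given support with two
  different eigenvalues; subtracting one eigenvalue shortens a vector. The second claim is proved
  directly, since irreducibility alone would make the endomorphisms only a division algebra.\<close>

lemma
  assumes u0: "u0 \<in> X" "\<And>x. x \<in> X \<Longrightarrow> \<exists>g\<in>carrier G. \<tau> g u0 = x"
    and sep: "\<And>S u v. S \<subseteq> X \<Longrightarrow> u \<in> S \<Longrightarrow> v \<in> S \<Longrightarrow> u \<noteq> v \<Longrightarrow>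
      \<exists>g\<in>carrier G. (\<forall>x\<in>S. \<tau> g x = x) \<and> (\<exists>x\<in>S. \<exists>y\<in>S. k g x \<noteq> k g y)"
  shows irreducible_if_separated: "irreducible_rep G (mono_rep X k \<tau>)"
    and scalar_if_separated: "\<phi> \<in> carrier (hom_space G (mono_rep X k \<tau>) (mono_rep X k \<tau>)) \<Longrightarrow>
      \<exists>c. \<forall>x\<in>fin_fun X. \<phi> x = (\<lambda>y. c * x y)"
proof -
  let ?W = "mono_rep X k \<tau> :: ('f, 'x \<Rightarrow> 'f, 'g) rep"
  have move: "\<exists>g\<in>carrier G. k g y \<noteq> 0 \<and> act ?W g (basis_elt x) = (\<lambda>z. k g y * basis_elt y z)"
    if "x \<in> X" "y \<in> X" for x y
  proof -
    obtain g where "g \<in> carrier G" "\<tau> g y = x"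
      using transitive[OF u0] \<open>x \<in> X\<close> \<open>y \<in> X\<close> by blast
    then show ?thesis
      using act_basis_elt[of g y] k_nonzero[of g y] that by auto
  qed
  show "irreducible_rep G ?W"
    unfolding irreducible_rep_def
  proof (intro conjI allI impI)
    show "carrier ?W \<noteq> {\<zero>\<^bsub>?W\<^esub>}"
    proof
      assume "carrier ?W = {\<zero>\<^bsub>?W\<^esub>}"
      then have "basis_elt u0 = (\<lambda>_. 0 :: 'f)"
        using u0(1) basis_elt_fin_fun[of u0 X, where 'b = 'f] by auto
      from fun_cong[OF this, of u0] show False by (simp add: basis_elt_def)
    qed
    fix U assume U: "subspace class_ring U ?W \<and> (\<forall>g\<in>carrier G. \<forall>u\<in>U. act ?W g u \<in> U)"
    then have sm: "submodule class_ring U ?W" by (simp add: subspace_def)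
    have U_sub: "U \<subseteq> fin_fun X" using submodule.subset[OF sm] by simp
    have U_add: "(\<lambda>x. \<phi> x + \<psi> x) \<in> U" if "\<phi> \<in> U" "\<psi> \<in> U" for \<phi> \<psi>
      using submodule.m_closed[OF sm that] by simp
    have U_smult: "(\<lambda>x. c * \<phi> x) \<in> U" if "\<phi> \<in> U" for c \<phi>
      using submodule.smult_closed[OF sm, of c \<phi>] that by simp
    have U_zero: "(\<lambda>_. 0) \<in> U" using submodule.zero_closed[OF sm] by simp
    show "U = {\<zero>\<^bsub>?W\<^esub>} \<or> U = carrier ?W"
    proof (cases "U = {\<lambda>_. 0}")
      case False
      then obtain \<phi>0 where "\<phi>0 \<in> U" "\<phi>0 \<noteq> (\<lambda>_. 0)" using U_zero by blast
      then obtain \<phi> where \<phi>: "\<phi> \<in> U" "\<phi> \<noteq> (\<lambda>_. 0)"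
        and min: "\<And>\<psi>. \<psi> \<in> U \<Longrightarrow> \<psi> \<noteq> (\<lambda>_. 0) \<Longrightarrow> card (supp \<phi>) \<le> card (supp \<psi>)"
        using ex_has_least_nat[of "\<lambda>\<phi>. \<phi> \<in> U \<and> \<phi> \<noteq> (\<lambda>_. 0)" \<phi>0 "\<lambda>\<phi>. card (supp \<phi>)"] by blast
      have \<phi>X: "\<phi> \<in> fin_fun X" using \<phi>(1) U_sub by blast
      then have S: "supp \<phi> \<subseteq> X" "finite (supp \<phi>)" by (simp_all add: fin_fun_def)
      have single: "u = v" if "u \<in> supp \<phi>" "v \<in> supp \<phi>" for u v
      proof (rule ccontr)
        assume "u \<noteq> v"
        then obtain g x y where g: "g \<in> carrier G" "\<And>x. x \<in> supp \<phi> \<Longrightarrow> \<tau> g x = x"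
          and xy: "x \<in> supp \<phi>" "y \<in> supp \<phi>" "k g x \<noteq> k g y"
          using sep[OF S(1) \<open>u \<in> supp \<phi>\<close> \<open>v \<in> supp \<phi>\<close>] by blast
        \<comment> \<open>This combination lies in U, vanishes at x but not at y, and so is a
          shorter nonzero vector.\<close>
        define \<psi> where "\<psi> = (\<lambda>z. k g z * \<phi> z + (- k g x) * \<phi> z)"
        have "(\<lambda>z. k g z * \<phi> z) \<in> U"
          using act_fixed[OF g(1) S(1) g(2)] U g(1) \<phi>(1) by fastforce
        then have "\<psi> \<in> U" unfolding \<psi>_def by (rule U_add[OF _ U_smult[OF \<phi>(1)]])
        moreover have "\<psi> y \<noteq> 0" using xy by (simp add: \<psi>_def)
        ultimately have "card (supp \<phi>) \<le> card (supp \<psi>)" by (intro min) auto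
        moreover have "supp \<psi> \<subseteq> supp \<phi> - {x}" by (auto simp: \<psi>_def)
        then have "card (supp \<psi>) \<le> card (supp \<phi> - {x})" using S(2) by (intro card_mono) auto
        moreover have "card (supp \<phi> - {x}) < card (supp \<phi>)"
          using S(2) xy(1) by (rule card_Diff1_less)
        ultimately show False by simp
      qed
      obtain u where u: "\<phi> u \<noteq> 0" using \<phi>(2) by auto
      then have "\<phi> = (\<lambda>x. \<phi> u * basis_elt u x)" using single by (auto simp: basis_elt_def fun_eq_iff)
      then have "basis_elt u = (\<lambda>x. inverse (\<phi> u) * \<phi> x)"
        using u by (metis (no_types, lifting) ext left_inverse mult.assoc mult_1)
      then have uU: "basis_elt u \<in> U" using U_smult[OF \<phi>(1), of "inverse (\<phi> u)"] by simp
      have basis: "basis_elt y \<in> U" if "y \<in> X" for y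
      proof -
        have "u \<in> X" using u S(1) by auto
        from move[OF this that] obtain g where g: "g \<in> carrier G" "k g y \<noteq> 0"
          "act ?W g (basis_elt u) = (\<lambda>z. k g y * basis_elt y z)"
          by (elim bexE conjE)
        have "act ?W g (basis_elt u) \<in> U" using U g(1) uU by blast
        then have "(\<lambda>z. k g y * basis_elt y z) \<in> U" unfolding g(3) .
        from U_smult[OF this, of "inverse (k g y)"] g(2) show ?thesis
          by (simp add: mult.assoc[symmetric])
      qed
      have "\<psi> \<in> U" if "\<psi> \<in> fin_fun X" for \<psi>
        using that
        by (induction rule: fin_fun_induct) (auto intro: U_zero basis U_add U_smult)
      then show ?thesis using U_sub by auto
    qed simp
  qed
  assume "\<phi> \<in> carrier (hom_space G ?W ?W)"
  note F = hom_spaceD[OF this, simplified mono_rep_simps(1-4)]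
  define \<eta> where "\<eta> = \<phi> (basis_elt u0)"
  have \<eta>: "\<eta> \<in> fin_fun X" using F(2) u0(1) by (simp add: \<eta>_def)
  \<comment> \<open>Including u0 makes g fix u0 as well, so both sides of the intertwining relation
    can be evaluated for the same g.\<close>
  define S where "S = insert u0 (supp \<eta>)"
  have S: "S \<subseteq> X" using \<eta> u0(1) by (auto simp: S_def fin_fun_def)
  have "S = {u0}"
  proof (rule ccontr)
    assume "S \<noteq> {u0}"
    then obtain v where "v \<in> S" "u0 \<noteq> v" by (auto simp: S_def)
    then obtain g x y where g: "g \<in> carrier G" "\<And>x. x \<in> S \<Longrightarrow> \<tau> g x = x"
      and xy: "x \<in> S" "y \<in> S" "k g x \<noteq> k g y"
      using sep[OF S, of u0 v] by (auto simp: S_def)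
    have b: "basis_elt u0 \<in> fin_fun X" using u0(1) by simp
    have "act ?W g (basis_elt u0) = (\<lambda>x. k g u0 * basis_elt u0 x)"
      using act_fixed[OF g(1) S g(2), of "basis_elt u0"]
      by (auto simp: S_def supp_basis_elt basis_elt_def fun_eq_iff)
    then have "\<phi> (act ?W g (basis_elt u0)) = (\<lambda>x. k g u0 * \<eta> x)"
      using F(4)[OF b] by (simp add: \<eta>_def)
    moreover have "\<phi> (act ?W g (basis_elt u0)) = (\<lambda>x. k g x * \<eta> x)"
      unfolding F(5)[OF g(1) b] \<eta>_def[symmetric]
      by (rule act_fixed[OF g(1) S g(2)]) (auto simp: S_def)
    \<comment> \<open>Wherever \<eta> is nonzero the scalar of g equals \<open>k g u0\<close>; so it
      is constant on S, against the choice of g.\<close>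
    ultimately have eq: "k g u0 * \<eta> z = k g z * \<eta> z" for z by metis
    have "k g z = k g u0" if "z \<in> S" for z using that eq[of z] by (auto simp: S_def)
    then show False using xy by simp
  qed
  then have \<eta>_eq: "\<eta> = (\<lambda>x. \<eta> u0 * basis_elt u0 x)"
    by (auto simp: S_def basis_elt_def fun_eq_iff)
  have basis: "\<phi> (basis_elt y) = (\<lambda>z. \<eta> u0 * basis_elt y z)" if y: "y \<in> X" for y
  proof -
    have b: "basis_elt u0 \<in> fin_fun X" "basis_elt y \<in> fin_fun X" using u0(1) y by simp_all
    from move[OF u0(1) y] obtain g where g: "g \<in> carrier G" "k g y \<noteq> 0"
      "act ?W g (basis_elt u0) = (\<lambda>z. k g y * basis_elt y z)"
      by (elim bexE conjE)
    have "(\<lambda>z. k g y * \<phi> (basis_elt y) z) = act ?W g \<eta>"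
      using F(5)[OF g(1) b(1)] F(4)[OF b(2), of "k g y"] unfolding g(3) \<eta>_def by simp
    also have "\<dots> = (\<lambda>z. \<eta> u0 * act ?W g (basis_elt u0) z)"
      by (subst \<eta>_eq) (auto simp: fun_eq_iff)
    finally have eq: "(\<lambda>z. k g y * \<phi> (basis_elt y) z) = (\<lambda>z. \<eta> u0 * (k g y * basis_elt y z))"
      unfolding g(3) .
    have "k g y * \<phi> (basis_elt y) z = k g y * (\<eta> u0 * basis_elt y z)" for z
      using fun_cong[OF eq, of z] by (simp add: mult_ac)
    then show ?thesis using g(2) by auto
  qed
  have "\<phi> \<psi> = (\<lambda>y. \<eta> u0 * \<psi> y)" if "\<psi> \<in> fin_fun X" for \<psi>
    using that
  proof (induction rule: fin_fun_induct)
    case zero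
    have "\<phi> (\<lambda>x. 0 * 0) = (\<lambda>x. 0 * \<phi> (\<lambda>_. 0) x)" by (rule F(4)) simp
    then show ?case by simp
  qed (simp_all add: basis F(3,4) distrib_left mult_ac)
  then show "\<exists>c. \<forall>x\<in>fin_fun X. \<phi> x = (\<lambda>y. c * x y)" by blast
qed

(* T \<phi> x = m x \<phi> (\<theta> x) is a nonscalar endomorphism, and the image of T - 1 lies in the kernel of
   the T-invariant functional with weights w. *)
lemma
  assumes \<theta>: "bij_betw \<theta> X X" and x0: "x0 \<in> X" "\<theta> x0 \<noteq> x0" "w x0 \<noteq> 0"
    and m: "\<And>x. x \<in> X \<Longrightarrow> m x \<noteq> 0" and w: "\<And>x. x \<in> X \<Longrightarrow> m x * w x = w (\<theta> x)"
    and \<theta>\<tau>: "\<And>g x. g \<in> carrier G \<Longrightarrow> x \<in> X \<Longrightarrow> \<theta> (\<tau> g x) = \<tau> g (\<theta> x)"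
    and mk: "\<And>g x. g \<in> carrier G \<Longrightarrow> x \<in> X \<Longrightarrow> m x * k g (\<theta> x) = k g x * m (\<tau> g x)"
  shows not_irreducible_if_symmetric: "\<not> irreducible_rep G (mono_rep X k \<tau>)"
    and nonscalar_if_symmetric: "\<exists>\<phi>\<in>carrier (hom_space G (mono_rep X k \<tau>) (mono_rep X k \<tau>)).
      \<not> (\<exists>c. \<forall>x\<in>fin_fun X. \<phi> x = (\<lambda>y. c * x y))"
proof -
  let ?W = "mono_rep X k \<tau> :: ('f, 'x \<Rightarrow> 'f, 'g) rep"
  define T where "T \<phi> = (\<lambda>x. if x \<in> X then m x * \<phi> (\<theta> x) else 0)" for \<phi> :: "'x \<Rightarrow> 'f"
  have \<theta>X: "\<theta> x \<in> X" if "x \<in> X" for x using \<theta> that by (auto simp: bij_betw_def)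
  have \<theta>_inj: "\<theta> x = \<theta> y \<longleftrightarrow> x = y" if "x \<in> X" "y \<in> X" for x y
    using \<theta> that by (auto simp: bij_betw_def inj_on_def)
  have T_mem: "T \<phi> \<in> fin_fun X" if "\<phi> \<in> fin_fun X" for \<phi>
  proof -
    have "finite {x \<in> X. \<theta> x \<in> supp \<phi>}"
      using finite_vimage_IntI[OF fin_funD(1)[OF that], of \<theta> X] \<theta>
      by (auto simp: bij_betw_def vimage_def Int_def conj_commute)
    then have "finite (supp (T \<phi>))" by (rule finite_subset[rotated]) (auto simp: T_def split: if_splits)
    then show ?thesis by (auto simp: fin_fun_def T_def)
  qed
  have T_add: "T (\<lambda>x. \<phi> x + \<psi> x) = (\<lambda>x. T \<phi> x + T \<psi> x)" for \<phi> \<psi>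
    by (auto simp: T_def distrib_left)
  have T_smult: "T (\<lambda>x. c * \<phi> x) = (\<lambda>x. c * T \<phi> x)" for c \<phi>
    by (auto simp: T_def)
  have T_act: "T (act ?W g \<phi>) = act ?W g (T \<phi>)" if "g \<in> carrier G" for g \<phi>
    using that \<theta>X \<tau>_closed[OF that]
    by (auto simp: T_def fun_eq_iff \<theta>\<tau> mk mult.assoc[symmetric])
  have T_basis: "T (basis_elt (\<theta> x)) = (\<lambda>y. m x * basis_elt x y)" if "x \<in> X" for x
    using that by (auto simp: T_def basis_elt_def fun_eq_iff \<theta>_inj)
  \<comment> \<open>T sends the basis vector at \<open>\<theta> x0\<close> to a nonzero multiple of
    the one at x0, a different point, so T is neither the identity nor a scalar.\<close>
  have T_x0: "T (basis_elt (\<theta> x0)) x0 \<noteq> 0" "(basis_elt (\<theta> x0) x0 :: 'f) = 0"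
    using T_basis[OF x0(1)] m[OF x0(1)] x0(2) by (auto simp: basis_elt_def)
  have b0: "basis_elt (\<theta> x0) \<in> fin_fun X" using x0(1) \<theta>X by simp
  \<comment> \<open>The functional is written as a map to functions on a one-point type, so that the
    rules for \<open>lext\<close> apply.\<close>
  define \<epsilon> where "\<epsilon> = lext (\<lambda>x (_ :: unit). w x)"
  have \<epsilon>T: "\<epsilon> (T \<phi>) = \<epsilon> \<phi>" if "\<phi> \<in> fin_fun X" for \<phi>
    using that
  proof (induction rule: fin_fun_induct)
    case zero
    show ?case using T_smult[of 0 "\<lambda>_. 0"] by simp
  next
    case (basis y)
    then obtain x where x: "x \<in> X" "y = \<theta> x" using \<theta> by (auto simp: bij_betw_def)
    then show ?case using w[OF x(1)] by (simp add: T_basis \<epsilon>_def lext_smult)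
  next
    case (add \<phi> \<psi>)
    then show ?case
      using fin_funD(1)[OF T_mem[OF add(1)]] fin_funD(1)[OF T_mem[OF add(2)]]
      by (simp add: T_add \<epsilon>_def lext_add fin_funD(1))
  next
    case (smult c \<phi>)
    then show ?case by (simp add: T_smult \<epsilon>_def lext_smult)
  qed
  define U where "U = (\<lambda>\<phi> x. T \<phi> x - \<phi> x) ` fin_fun X"
  interpret W: vectorspace class_ring ?W using linear_repD(1)[OF linear_rep_mono] .
  have "submodule class_ring U ?W"
  proof (intro submodule.intro)
    show "module class_ring ?W" by (rule W.module_axioms)
    show "U \<subseteq> carrier ?W" by (auto simp: U_def intro!: fin_fun_diff T_mem)
    show "\<zero>\<^bsub>?W\<^esub> \<in> U"
      unfolding U_def by (rule image_eqI[of _ _ "\<lambda>_. 0"]) (auto simp: T_def)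
    fix v w assume "v \<in> U" "w \<in> U"
    then obtain \<phi> \<psi> where "\<phi> \<in> fin_fun X" "\<psi> \<in> fin_fun X"
      "v = (\<lambda>x. T \<phi> x - \<phi> x)" "w = (\<lambda>x. T \<psi> x - \<psi> x)" by (auto simp: U_def)
    then show "v \<oplus>\<^bsub>?W\<^esub> w \<in> U"
      unfolding U_def by (intro image_eqI[of _ _ "\<lambda>x. \<phi> x + \<psi> x"]) (auto simp: T_add fin_fun_add)
  next
    fix c v assume "v \<in> U"
    then obtain \<phi> where "\<phi> \<in> fin_fun X" "v = (\<lambda>x. T \<phi> x - \<phi> x)" by (auto simp: U_def)
    then show "c \<odot>\<^bsub>?W\<^esub> v \<in> U"
      unfolding U_def
      by (intro image_eqI[of _ _ "\<lambda>x. c * \<phi> x"]) (auto simp: T_smult fin_fun_smult algebra_simps)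
  qed
  then have sub: "subspace class_ring U ?W" using W.vectorspace_axioms by (simp add: subspace_def)
  have inv: "act ?W g v \<in> U" if g: "g \<in> carrier G" and "v \<in> U" for g v
  proof -
    obtain \<phi> where \<phi>: "\<phi> \<in> fin_fun X" "v = (\<lambda>x. T \<phi> x - \<phi> x)" using \<open>v \<in> U\<close> by (auto simp: U_def)
    have "act ?W g v = (\<lambda>x. T (act ?W g \<phi>) x - act ?W g \<phi> x)"
      unfolding T_act[OF g] \<phi>(2) by (auto simp: fun_eq_iff algebra_simps)
    then show ?thesis using act_fin_fun[OF g \<phi>(1)] unfolding U_def by blast
  qed
  show "\<not> irreducible_rep G ?W"
  proof
    assume "irreducible_rep G ?W"
    then have "U = {\<zero>\<^bsub>?W\<^esub>} \<or> U = carrier ?W"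
      unfolding irreducible_rep_def using sub inv by blast
    then show False
    proof
      assume "U = {\<zero>\<^bsub>?W\<^esub>}"
      moreover have "(\<lambda>x. T (basis_elt (\<theta> x0)) x - basis_elt (\<theta> x0) x) \<in> U"
        unfolding U_def using b0 by blast
      ultimately have "(\<lambda>x. T (basis_elt (\<theta> x0)) x - basis_elt (\<theta> x0) x) = (\<lambda>_. 0)" by simp
      then show False using T_x0 fun_cong[of _ _ x0] by fastforce
    next
      assume "U = carrier ?W"
      \<comment> \<open>The functional vanishes on U but takes the nonzero value \<open>w x0\<close>
        at this basis vector.\<close>
      then have "basis_elt x0 \<in> U" using x0(1) by simp
      then obtain \<phi> where \<phi>: "\<phi> \<in> fin_fun X" "basis_elt x0 = (\<lambda>x. T \<phi> x - \<phi> x)"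
        by (auto simp: U_def)
      have "\<epsilon> (basis_elt x0) = (\<lambda>t. \<epsilon> (T \<phi>) t - \<epsilon> \<phi> t)"
        unfolding \<phi>(2) \<epsilon>_def by (rule lext_diff[OF T_mem[OF \<phi>(1)] \<phi>(1)])
      then have "\<epsilon> (basis_elt x0) () = 0" using \<epsilon>T[OF \<phi>(1)] by simp
      then show False using x0(3) by (simp add: \<epsilon>_def)
    qed
  qed
  have "(\<lambda>\<phi>\<in>fin_fun X. T \<phi>) \<in> carrier (hom_space G ?W ?W)"
    using act_fin_fun T_act
    by (intro hom_spaceI) (simp_all add: T_mem T_add T_smult fin_fun_add fin_fun_smult)
  moreover have "\<not> (\<exists>c. \<forall>x\<in>fin_fun X. (\<lambda>\<phi>\<in>fin_fun X. T \<phi>) x = (\<lambda>y. c * x y))"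
  proof
    assume "\<exists>c. \<forall>x\<in>fin_fun X. (\<lambda>\<phi>\<in>fin_fun X. T \<phi>) x = (\<lambda>y. c * x y)"
    then obtain c where "T (basis_elt (\<theta> x0)) = (\<lambda>y. c * basis_elt (\<theta> x0) y)" using b0 by auto
    then show False using T_x0 by simp
  qed
  ultimately show "\<exists>\<phi>\<in>carrier (hom_space G ?W ?W). \<not> (\<exists>c. \<forall>x\<in>fin_fun X. \<phi> x = (\<lambda>y. c * x y))"
    by blast
qed

end

section \<open>The model of V(D, f) on families of rows, and the two cases for D\<close>

section \<open>Basic modules\<close>

text \<open>The principal right ideal generated by z contains z = z * 1, so it is not inside the
  kernel. The side fits the action: entries of rows are multiplied on the right by entries of group
  elements.\<close>

lemma right_primitiveD:
  fixes \<mu> :: "'r::ring_1 \<Rightarrow> 'f::field"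
  assumes "right_primitive \<mu>"
  shows "linear_char \<mu>" "z \<noteq> 0 \<Longrightarrow> \<exists>r. \<mu> (z * r) \<noteq> 1"
proof -
  show \<mu>: "linear_char \<mu>" using assms by (simp add: right_primitive_def)
  assume z: "z \<noteq> 0"
  show "\<exists>r. \<mu> (z * r) \<noteq> 1"
  proof (rule ccontr)
    assume triv: "\<nexists>r. \<mu> (z * r) \<noteq> 1"
    define I where "I = range (\<lambda>r. z * r)"
    have grp: "group (add_monoid (class_ring :: 'r ring))"
      by (rule abelian_group.a_group) (rule class_ring.is_abelian_group)
    have "subgroup I (add_monoid class_ring)"
    proof (rule group.subgroupI[OF grp])
      show "I \<noteq> {}" by (auto simp: I_def)
      fix a b assume "a \<in> I" "b \<in> I"
      then show "a \<otimes>\<^bsub>add_monoid class_ring\<^esub> b \<in> I"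
        by (auto simp: I_def distrib_left[symmetric])
    next
      fix a assume "a \<in> I"
      then obtain r where r: "a = z * r" by (auto simp: I_def)
      have "inv\<^bsub>add_monoid class_ring\<^esub> a = - a"
        by (rule group.inv_equality[OF grp]) simp_all
      then show "inv\<^bsub>add_monoid class_ring\<^esub> a \<in> I"
        using r by (auto simp: I_def intro!: image_eqI[of _ _ "- r"])
    qed simp
    then have "right_ideal I"
      by (auto simp: right_ideal_def additive_subgroup_def I_def mult.assoc)
    moreover have "I \<subseteq> kernel (add_monoid class_ring) (units_of class_ring) \<mu>"
      using triv by (auto simp: kernel_def I_def units_of_def)
    ultimately have "I = {0}" using assms by (simp add: right_primitive_def)
    moreover have "z \<in> I" unfolding I_def by (rule image_eqI[of _ _ 1]) simp_all
    ultimately show False using z by simp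
  qed
qed

lemma row_mult_add: "row_mult (\<lambda>c. u c + v c) x c = row_mult u x c + row_mult v x c"
  by (simp add: row_mult_def distrib_right sum.distrib algebra_simps)

text \<open>Back substitution: the coefficients w a e are unitriangular on A, so r can be prescribed
  at c. The induction adds a new smallest index b; the rows already treated vanish at b, so their
  equations survive the choice of the value there.\<close>

lemma exists_orthogonal_column:
  fixes w :: "'l::linorder \<Rightarrow> 'l \<Rightarrow> 'r::ring_1"
  assumes "finite A" "\<And>a. a \<in> A \<Longrightarrow> a < c" "\<And>a. a \<in> A \<Longrightarrow> w a a = 1"
    "\<And>a e. a \<in> A \<Longrightarrow> e < a \<Longrightarrow> w a e = 0"
  shows "\<exists>z. z c = r \<and> (\<forall>a\<in>A. (\<Sum>e\<in>insert c A. w a e * z e) = 0)"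
  using assms
proof (induction A rule: finite_linorder_min_induct)
  case empty
  show ?case by (rule exI[of _ "\<lambda>_. r"]) simp
next
  case (insert b A)
  have "\<exists>z. z c = r \<and> (\<forall>a\<in>A. (\<Sum>e\<in>insert c A. w a e * z e) = 0)"
    by (rule insert.IH) (simp_all add: insert.prems)
  then obtain z where z: "z c = r" "\<And>a. a \<in> A \<Longrightarrow> (\<Sum>e\<in>insert c A. w a e * z e) = 0"
    by blast
  \<comment> \<open>The value at b is forced by the equation of row b, whose coefficient at b is
    1.\<close>
  define z' where "z' = z(b := - (\<Sum>e\<in>insert c A. w b e * z e))"
  have b: "b \<notin> insert c A" "b \<noteq> c" using insert.hyps insert.prems(1)[of b] by auto
  have sum: "(\<Sum>e\<in>insert c (insert b A). w a e * z' e)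
      = w a b * z' b + (\<Sum>e\<in>insert c A. w a e * z e)" for a
  proof -
    have "(\<Sum>e\<in>insert b (insert c A). w a e * z' e)
        = w a b * z' b + (\<Sum>e\<in>insert c A. w a e * z' e)"
      using b insert.hyps(1) by (intro sum.insert) auto
    also have "(\<Sum>e\<in>insert c A. w a e * z' e) = (\<Sum>e\<in>insert c A. w a e * z e)"
      using b by (intro sum.cong) (auto simp: z'_def)
    finally show ?thesis by (simp add: insert_commute)
  qed
  have "(\<Sum>e\<in>insert c (insert b A). w a e * z' e) = 0" if "a \<in> insert b A" for a
  proof (cases "a = b")
    case True
    then show ?thesis unfolding sum using insert.prems(2)[of b] by (simp add: z'_def)
  next
    case False
    then have "a \<in> A" using that by simp
    then show ?thesis
      unfolding sum using z(2) insert.hyps(2) insert.prems(3)[of a b] by simp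
  qed
  moreover have "z' c = r" using z(1) b by (simp add: z'_def)
  ultimately show ?case by blast
qed

locale basic_data =
  fixes D :: "('l::linorder \<times> 'l) set" and f :: "'l \<times> 'l \<Rightarrow> 'r::ring_1 \<Rightarrow> 'f::field"
  assumes D: "basic_set D" and f: "d \<in> D \<Longrightarrow> right_primitive (f d)"
begin

definition X :: "('l \<times> 'l \<Rightarrow> 'l \<Rightarrow> 'r) set" where
  "X = PiE D elem_X"

definition k :: "('l \<times> 'l \<Rightarrow> 'r) \<Rightarrow> ('l \<times> 'l \<Rightarrow> 'l \<Rightarrow> 'r) \<Rightarrow> 'f" where
  "k = tensor_k D (\<lambda>d. elem_k d (f d))"

definition \<tau> :: "('l \<times> 'l \<Rightarrow> 'r) \<Rightarrow> ('l \<times> 'l \<Rightarrow> 'l \<Rightarrow> 'r) \<Rightarrow> 'l \<times> 'l \<Rightarrow> 'l \<Rightarrow> 'r" where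
  "\<tau> = tensor_tau D elem_tau"

lemma basic: "finite D" "D \<noteq> {}" "(a, b) \<in> D \<Longrightarrow> a < b"
  "(a, b) \<in> D \<Longrightarrow> (a, b') \<in> D \<Longrightarrow> b = b'" "(a, b) \<in> D \<Longrightarrow> (a', b) \<in> D \<Longrightarrow> a = a'"
proof -
  show "finite D" "D \<noteq> {}" "(a, b) \<in> D \<Longrightarrow> a < b"
    using D by (auto simp: basic_set_def Phi_def)
  have inj: "inj_on fst D" "inj_on snd D" using D by (simp_all add: basic_set_def)
  show "b = b'" if "(a, b) \<in> D" "(a, b') \<in> D"
    using inj_onD[OF inj(1) _ that] by simp
  show "a = a'" if "(a, b) \<in> D" "(a', b) \<in> D"
    using inj_onD[OF inj(2) _ that] by simp
qed

lemma f_char: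
  assumes "d \<in> D"
  shows "f d (x + y) = f d x * f d y" "f d x \<noteq> 0" "f d 0 = 1"
  using linear_charD[OF right_primitiveD(1)[OF f[OF assms]]] by auto

sublocale monomial_action mclain_group X k \<tau>
  unfolding X_def k_def \<tau>_def
  by (rule basic_rep_iso(1)[OF D right_primitiveD(1)[OF f]])

lemma basic_rep_model:
  obtains \<Psi> where "rep_iso mclain_group (mono_rep X k \<tau>) (basic_rep D f) \<Psi>"
proof -
  have "\<exists>\<Psi>. rep_iso mclain_group (mono_rep X k \<tau>) (basic_rep D f) \<Psi>"
    unfolding X_def k_def \<tau>_def by (rule basic_rep_iso(2)[OF D right_primitiveD(1)[OF f]])
  then show ?thesis using that by blast
qed

lemma X_D:
  assumes "x \<in> X" "(a, b) \<in> D"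
  shows "finite (supp (x (a, b)))" "c < a \<Longrightarrow> x (a, b) c = 0" "x (a, b) a = 1"
    "b \<le> c \<Longrightarrow> x (a, b) c = 0"
proof -
  have "x (a, b) \<in> elem_X (a, b)" using assms by (auto simp: X_def)
  from elem_XD[OF this] show "finite (supp (x (a, b)))" "c < a \<Longrightarrow> x (a, b) c = 0"
    "x (a, b) a = 1" "b \<le> c \<Longrightarrow> x (a, b) c = 0" by auto
qed

lemma \<tau>_apply: "(a, b) \<in> D \<Longrightarrow> \<tau> g x (a, b) = trunc_below b (row_mult (x (a, b)) g)"
  by (simp add: \<tau>_def tensor_tau_def elem_tau_def)

lemma k_eq: "k g x = (\<Prod>d\<in>D. f d (row_mult (x d) g (snd d)))"
  by (simp add: k_def tensor_k_def elem_k_def)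

definition base_point :: "'l \<times> 'l \<Rightarrow> 'l \<Rightarrow> 'r" where
  "base_point = (\<lambda>d\<in>D. unit_row (fst d))"

lemma base_point_mem: "base_point \<in> X"
proof -
  have "(unit_row (fst d) :: 'l \<Rightarrow> 'r) \<in> elem_X d" if "d \<in> D" for d
    using unit_row_elem_X[of "fst d" "snd d"] basic(3)[of "fst d" "snd d"] that by simp
  then show ?thesis by (simp add: X_def base_point_def)
qed

text \<open>The first ends of the pairs in D are distinct, so the rows of x can be placed together
  as the rows of a single matrix.\<close>

lemma base_point_transitive:
  assumes x: "x \<in> X"
  shows "\<exists>g\<in>carrier mclain_group. \<tau> g base_point = x"
proof -
  \<comment> \<open>\<open>inv_into D fst e\<close> is the only pair of D with first end e. The
    diagonal is left out because the 1 is implicit.\<close>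
  define g where "g = (\<lambda>(e, c). if e \<in> fst ` D \<and> c \<noteq> e then x (inv_into D fst e) c else 0)"
  have inv: "inv_into D fst a = (a, b)" if "(a, b) \<in> D" for a b
    using inv_into_f_f[of fst D "(a, b)"] D that by (simp add: basic_set_def)
  have g_D: "g (a, c) = (if c = a then 0 else x (a, b) c)" if "(a, b) \<in> D" for a b c
    using that inv[OF that] by (force simp: g_def)
  have "supp g \<subseteq> (\<Union>d\<in>D. {fst d} \<times> supp (x d))"
    using inv by (fastforce simp: g_def split: if_splits)
  moreover have "finite (\<Union>d\<in>D. {fst d} \<times> supp (x d))"
    using basic(1) X_D(1)[OF x] by auto
  ultimately have "finite (supp g)" by (rule finite_subset)
  moreover have "e < c" if "g (e, c) \<noteq> 0" for e c
  proof -
    have "e \<in> fst ` D" using that by (simp add: g_def split: if_splits)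
    then obtain b where b: "(e, b) \<in> D" by auto
    have "c \<noteq> e" "x (e, b) c \<noteq> 0" using that by (simp_all add: g_D[OF b] split: if_splits)
    then show ?thesis using X_D(2)[OF x b, of c] by (metis linorder_neqE)
  qed
  ultimately have g: "g \<in> mclain_ring" by (auto simp: mclain_ring_def Phi_def)
  have "\<tau> g base_point = x"
  proof (rule PiE_ext)
    show "\<tau> g base_point \<in> PiE D elem_X" "x \<in> PiE D elem_X"
      using \<tau>_closed[OF _ base_point_mem] g x by (simp_all add: X_def)
    fix d assume d: "d \<in> D"
    obtain a b where ab: "d = (a, b)" by (cases d)
    have "row_mult (unit_row a) g c = x (a, b) c" for c
      using row_mult_unit_row[OF g, of a c] g_D[of a b c] X_D(3)[OF x, of a b] d
      by (simp add: unit_row_def ab)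
    then show "\<tau> g base_point d = x d"
      using d X_D(4)[OF x, of a b] \<tau>_apply[of a b]
      by (auto simp: ab base_point_def trunc_below_def fun_eq_iff)
  qed
  then show ?thesis using g by auto
qed

(* The column element with entry r in position (c, b) has to be corrected in the rows a of the
   pairs (a, b') with a < \<alpha> and b < b', so that it fixes the rows that enclose the row of d. *)
lemma column_separation:
  assumes no: "non_overlapping D" and S: "S \<subseteq> X" and d: "(\<alpha>, \<beta>) \<in> D"
    and agree: "\<And>u v a b. u \<in> S \<Longrightarrow> v \<in> S \<Longrightarrow> (a, b) \<in> D \<Longrightarrow> a < \<alpha> \<Longrightarrow> u (a, b) = v (a, b)"
    and c: "\<alpha> < c" "c < \<beta>"
  shows "\<exists>g\<in>carrier mclain_group. \<forall>x\<in>S. \<tau> g x = x \<and> k g x = f (\<alpha>, \<beta>) (x (\<alpha>, \<beta>) c * r)"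
proof (cases "S = {}")
  case True
  then show ?thesis using mclain.one_closed by blast
next
  case False
  then obtain u where u: "u \<in> S" by blast
  then have uX: "u \<in> X" using S by blast
  \<comment> \<open>Only rows reaching beyond \<beta> keep their entry in column \<beta> after
    truncation. Among these, the ones starting before \<alpha> are those that need a
    correction.\<close>
  define A where "A = fst ` {(a, b) \<in> D. a < \<alpha> \<and> \<beta> < b}"
  \<comment> \<open>By \<open>agree\<close> all families in S share the rows indexed by A, so these
    may be read off from u.\<close>
  define w where "w a = u (inv_into D fst a)" for a
  have w: "w a = u (a, b)" if "(a, b) \<in> D" for a b
    using inv_into_f_f[of fst D "(a, b)"] D that by (simp add: basic_set_def w_def)
  have fin: "finite A"
    unfolding A_def using basic(1) by (intro finite_imageI) (auto intro: finite_subset)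
  have A: "\<exists>b. (a, b) \<in> D \<and> a < \<alpha> \<and> \<beta> < b" if "a \<in> A" for a using that by (auto simp: A_def)
  have "\<exists>z. z c = r \<and> (\<forall>a\<in>A. (\<Sum>e\<in>insert c A. w a e * z e) = 0)"
  proof (rule exists_orthogonal_column[OF fin])
    fix a assume "a \<in> A"
    then obtain b where b: "(a, b) \<in> D" "a < \<alpha>" using A by blast
    show "a < c" using b c by simp
    show "w a a = 1" using X_D(3)[OF uX b(1)] w[OF b(1)] by simp
    show "w a e = 0" if "e < a" for e using X_D(2)[OF uX b(1) that] w[OF b(1)] by simp
  qed
  then obtain z where z: "z c = r" "\<And>a. a \<in> A \<Longrightarrow> (\<Sum>e\<in>insert c A. w a e * z e) = 0" by blast
  define g where "g = (\<lambda>(e, b). if b = \<beta> \<and> e \<in> insert c A then z e else 0)"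
  have lt: "e < \<beta>" if "e \<in> insert c A" for e
    using that c A[of e] basic(3)[OF d] by auto
  have "supp g \<subseteq> insert c A \<times> {\<beta>}" by (auto simp: g_def split: if_splits)
  then have "finite (supp g)" by (rule finite_subset) (use fin in auto)
  then have g: "g \<in> mclain_ring"
    using lt by (auto simp: mclain_ring_def Phi_def g_def split: if_splits)
  have row: "row_mult v g e = v e + (if e = \<beta> then \<Sum>e\<in>insert c A. v e * z e else 0)" for v e
  proof -
    have "row_mult v g e = v e + (\<Sum>e'\<in>insert c A. v e' * g (e', e))"
      using fin by (intro row_mult_eq) (auto simp: g_def split: if_splits)
    also have "(\<Sum>e'\<in>insert c A. v e' * g (e', e)) = (if e = \<beta> then \<Sum>e\<in>insert c A. v e * z e else 0)"
    proof (cases "e = \<beta>")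
      case True
      have "(\<Sum>e'\<in>insert c A. v e' * g (e', e)) = (\<Sum>e\<in>insert c A. v e * z e)"
        by (rule sum.cong) (auto simp: g_def True)
      then show ?thesis using True by simp
    qed (simp add: g_def)
    finally show ?thesis .
  qed
  have "\<tau> g x = x \<and> k g x = f (\<alpha>, \<beta>) (x (\<alpha>, \<beta>) c * r)" if "x \<in> S" for x
  proof
    have x: "x \<in> X" using that S by blast
    \<comment> \<open>The correcting entries have row index before \<alpha>, where the row of
      (\<alpha>, \<beta>) vanishes; so they leave its scalar alone.\<close>
    have main: "(\<Sum>e\<in>insert c A. x (\<alpha>, \<beta>) e * z e) = x (\<alpha>, \<beta>) c * r"
    proof -
      have "c \<notin> A" using A[of c] c by auto
      moreover have "(\<Sum>e\<in>A. x (\<alpha>, \<beta>) e * z e) = 0"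
        using A X_D(2)[OF x d] by (intro sum.neutral) fastforce
      ultimately show ?thesis using fin z(1) by simp
    qed
    \<comment> \<open>A row reaching beyond \<beta> starts at or after \<beta>, past every entry of
      the column, or overlaps (\<alpha>, \<beta>), or encloses it. The column z was solved for the
      last case.\<close>
    have other: "(\<Sum>e\<in>insert c A. x (a, b) e * z e) = 0" if ab: "(a, b) \<in> D" "\<beta> < b" for a b
    proof (cases "\<beta> \<le> a")
      case True
      then show ?thesis
        using lt X_D(2)[OF x ab(1)] by (intro sum.neutral) fastforce
    next
      case False
      moreover have "\<not> overlapping (\<alpha>, \<beta>) (a, b)"
        using no ab(1) d unfolding non_overlapping_def by blast
      ultimately have "\<not> \<alpha> < a" using ab(2) by (auto simp: overlapping_def)
      moreover have "a \<noteq> \<alpha>" using basic(4)[OF ab(1)] d ab(2) by auto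
      ultimately have a: "a < \<alpha>" by simp
      then have "a \<in> A" using ab by (force simp: A_def)
      moreover have "x (a, b) = w a"
        using agree[OF \<open>x \<in> S\<close> u ab(1) a] w[OF ab(1)] by simp
      ultimately show ?thesis using z(2) by simp
    qed
    show "\<tau> g x = x"
    proof (rule PiE_ext)
      show "\<tau> g x \<in> PiE D elem_X" "x \<in> PiE D elem_X"
        using \<tau>_closed[OF _ x] g x by (simp_all add: X_def)
      fix p assume p: "p \<in> D"
      obtain a b where ab: "p = (a, b)" by (cases p)
      show "\<tau> g x p = x p"
        using p other[of a b] X_D(4)[OF x, of a b]
        by (auto simp: ab \<tau>_apply trunc_below_def row fun_eq_iff)
    qed
    \<comment> \<open>The second ends in D are distinct, so only the pair (\<alpha>, \<beta>)
      evaluates its character in the changed column.\<close>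
    have "f p (row_mult (x p) g (snd p)) = (if p = (\<alpha>, \<beta>) then f (\<alpha>, \<beta>) (x (\<alpha>, \<beta>) c * r) else 1)"
      if p: "p \<in> D" for p
    proof -
      obtain a b where ab: "p = (a, b)" by (cases p)
      have "b = \<beta> \<longleftrightarrow> p = (\<alpha>, \<beta>)" using basic(5)[of a b \<alpha>] d p ab by auto
      then show ?thesis
        using p main X_D(4)[OF x, of a b b] f_char(3)[OF p] by (auto simp: ab row)
    qed
    then have "k g x = (\<Prod>p\<in>D. if p = (\<alpha>, \<beta>) then f (\<alpha>, \<beta>) (x (\<alpha>, \<beta>) c * r) else 1)"
      unfolding k_eq by (rule prod.cong[OF refl])
    then show "k g x = f (\<alpha>, \<beta>) (x (\<alpha>, \<beta>) c * r)"
      using d basic(1) by (simp add: prod.delta)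
  qed
  then show ?thesis using g by auto
qed

text \<open>Taking the first row in which members of S differ secures the agreement of earlier rows
  that \<open>column_separation\<close> demands. Right primitivity then turns a difference of
  entries into a difference of scalars.\<close>

lemma non_overlapping_separated:
  assumes no: "non_overlapping D" and S: "S \<subseteq> X" and uv: "u \<in> S" "v \<in> S" "u \<noteq> v"
  shows "\<exists>g\<in>carrier mclain_group. (\<forall>x\<in>S. \<tau> g x = x) \<and> (\<exists>x\<in>S. \<exists>y\<in>S. k g x \<noteq> k g y)"
proof -
  define B where "B = {d \<in> D. \<exists>x\<in>S. \<exists>y\<in>S. x d \<noteq> y d}"
  have "u \<in> PiE D elem_X" "v \<in> PiE D elem_X" using uv S by (auto simp: X_def)
  then have "B \<noteq> {}" using PiE_ext[of u D elem_X v] uv by (auto simp: B_def)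
  moreover have finB: "finite (fst ` B)" using basic(1) by (simp add: B_def)
  ultimately have "Min (fst ` B) \<in> fst ` B" by (intro Min_in) auto
  then obtain \<alpha> \<beta> where d: "(\<alpha>, \<beta>) \<in> B" "\<alpha> = Min (fst ` B)" by auto
  then have dD: "(\<alpha>, \<beta>) \<in> D" by (simp add: B_def)
  obtain x y where xy: "x \<in> S" "y \<in> S" "x (\<alpha>, \<beta>) \<noteq> y (\<alpha>, \<beta>)" using d(1) by (auto simp: B_def)
  then obtain c where c: "x (\<alpha>, \<beta>) c \<noteq> y (\<alpha>, \<beta>) c" by auto
  have X: "x \<in> X" "y \<in> X" using xy S by auto
  have "\<alpha> < c" "c < \<beta>"
    using c X_D(2,4)[OF X(1) dD, of c] X_D(2,4)[OF X(2) dD, of c]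
      X_D(3)[OF X(1) dD] X_D(3)[OF X(2) dD] by (metis linorder_neqE, metis not_le)
  have agree: "s (a, b) = t (a, b)" if "s \<in> S" "t \<in> S" "(a, b) \<in> D" "a < \<alpha>" for s t a b
  proof (rule ccontr)
    assume "s (a, b) \<noteq> t (a, b)"
    then have "(a, b) \<in> B" using that by (auto simp: B_def)
    then have "a \<in> fst ` B" by force
    then show False using Min_le[OF finB] that(4) d(2) not_le by blast
  qed
  obtain r where r: "f (\<alpha>, \<beta>) ((x (\<alpha>, \<beta>) c - y (\<alpha>, \<beta>) c) * r) \<noteq> 1"
    using right_primitiveD(2)[OF f[OF dD], of "x (\<alpha>, \<beta>) c - y (\<alpha>, \<beta>) c"] c by auto
  have "f (\<alpha>, \<beta>) (x (\<alpha>, \<beta>) c * r)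
      = f (\<alpha>, \<beta>) ((x (\<alpha>, \<beta>) c - y (\<alpha>, \<beta>) c) * r) * f (\<alpha>, \<beta>) (y (\<alpha>, \<beta>) c * r)"
    unfolding f_char(1)[OF dD, symmetric] by (simp add: algebra_simps)
  then have neq: "f (\<alpha>, \<beta>) (x (\<alpha>, \<beta>) c * r) \<noteq> f (\<alpha>, \<beta>) (y (\<alpha>, \<beta>) c * r)"
    using r f_char(2)[OF dD] by simp
  have "\<exists>g\<in>carrier mclain_group. \<forall>x\<in>S. \<tau> g x = x \<and> k g x = f (\<alpha>, \<beta>) (x (\<alpha>, \<beta>) c * r)"
    by (rule column_separation[OF no S dD _ \<open>\<alpha> < c\<close> \<open>c < \<beta>\<close>]) (rule agree)
  then obtain g where "g \<in> carrier mclain_group"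
    "\<And>x. x \<in> S \<Longrightarrow> \<tau> g x = x \<and> k g x = f (\<alpha>, \<beta>) (x (\<alpha>, \<beta>) c * r)"
    by blast
  then show ?thesis using neq xy by metis
qed

(* For an overlapping pair, adding a multiple of row (\<gamma>, \<delta>) to row (\<alpha>, \<beta>) commutes with the action. *)
definition shear :: "'l \<times> 'l \<Rightarrow> 'l \<times> 'l \<Rightarrow> 'r \<Rightarrow> ('l \<times> 'l \<Rightarrow> 'l \<Rightarrow> 'r) \<Rightarrow> 'l \<times> 'l \<Rightarrow> 'l \<Rightarrow> 'r" where
  "shear p q s x = x(p := (\<lambda>c. x p c + s * trunc_below (snd p) (x q) c))"

text \<open>Adding rows is a left operation and commutes with right multiplication, except that
  truncation at \<beta> drops the entry \<open>x ?q \<beta>\<close> of the longer row;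
  \<open>f ?p\<close> of that entry is the multiplier m. The weight w exists because row (\<gamma>,
  \<delta>) has entry 1 at \<gamma>: the shear raises \<open>x ?p \<gamma>\<close> by 1, so the
  argument of \<open>f ?p\<close> in w grows by \<open>x ?q \<beta>\<close>, and w is multiplied by
  m.\<close>

lemma
  assumes p: "(\<alpha>, \<beta>) \<in> D" and q: "(\<gamma>, \<delta>) \<in> D" and ov: "\<alpha> < \<gamma>" "\<gamma> < \<beta>" "\<beta> < \<delta>"
  shows overlapping_not_irreducible: "\<not> irreducible_rep mclain_group (mono_rep X k \<tau>)"
    and overlapping_nonscalar:
      "\<exists>\<phi>\<in>carrier (hom_space mclain_group (mono_rep X k \<tau>) (mono_rep X k \<tau>)).
        \<not> (\<exists>c. \<forall>x\<in>fin_fun X. \<phi> x = (\<lambda>y. c * x y))"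
proof -
  let ?p = "(\<alpha>, \<beta>)" and ?q = "(\<gamma>, \<delta>)"
  define \<theta> where "\<theta> = shear ?p ?q"
  define m where "m x = f ?p (x ?q \<beta>)" for x
  define w where "w x = f ?p (x ?p \<gamma> * x ?q \<beta>)" for x
  have pq: "?q \<noteq> ?p" using ov by auto
  have \<theta>_p: "\<theta> s x ?p = (\<lambda>c. x ?p c + s * trunc_below \<beta> (x ?q) c)" for s x
    by (simp add: \<theta>_def shear_def)
  have \<theta>_other: "\<theta> s x d = x d" if "d \<noteq> ?p" for s x d
    using that by (simp add: \<theta>_def shear_def)
  have \<theta>X: "\<theta> s x \<in> X" if x: "x \<in> X" for s x
  proof -
    let ?y = "\<lambda>c. x ?p c + s * trunc_below \<beta> (x ?q) c"
    have "supp ?y \<subseteq> supp (x ?p) \<union> supp (x ?q)" by (auto simp: trunc_below_def split: if_splits)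
    then have "finite (supp ?y)"
      by (rule finite_subset) (use X_D(1)[OF x p] X_D(1)[OF x q] in simp)
    moreover have "supp ?y \<subseteq> {\<alpha>..<\<beta>}"
    proof
      fix c assume c: "c \<in> supp ?y"
      have "\<not> c < \<alpha>" using c X_D(2)[OF x p, of c] X_D(2)[OF x q, of c] ov
        by (auto simp: trunc_below_def split: if_splits)
      moreover have "c < \<beta>"
        using c X_D(4)[OF x p, of c] by (cases "c < \<beta>") (auto simp: trunc_below_def)
      ultimately show "c \<in> {\<alpha>..<\<beta>}" by auto
    qed
    \<comment> \<open>The added row starts at \<gamma>, after \<alpha>, so the normalization
      survives.\<close>
    moreover have "?y \<alpha> = 1"
      using X_D(3)[OF x p] X_D(2)[OF x q ov(1)] by (simp add: trunc_below_def)
    ultimately have "\<theta> s x ?p \<in> elem_X ?p" unfolding \<theta>_p elem_X_def by simp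
    then show ?thesis
      using x p \<theta>_other unfolding X_def PiE_def extensional_def Pi_def by (smt (verit) Int_iff mem_Collect_eq)
  qed
  \<comment> \<open>Shears with opposite parameters are inverse to each other; the parameter s
    serves to name the inverse \<open>\<theta> (- 1)\<close>.\<close>
  have \<theta>\<theta>: "\<theta> s (\<theta> t x) = x" if "s + t = 0" for s t x
  proof
    fix d
    show "\<theta> s (\<theta> t x) d = x d"
    proof (cases "d = ?p")
      case True
      have "t * y + s * y = 0" for y using that by (metis add.commute distrib_right mult_zero_left)
      then show ?thesis
        unfolding True by (simp add: \<theta>_p \<theta>_other[OF pq] add.assoc)
    qed (simp add: \<theta>_other)
  qed
  have bij: "bij_betw (\<theta> 1) X X"
    by (rule bij_betw_byWitness[where f' = "\<theta> (- 1)"]) (auto simp: \<theta>\<theta> \<theta>X)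
  \<comment> \<open>Before column \<beta> the two transformed rows simply add. In column \<beta> the
    truncated row contributes less, by the lost entry \<open>x ?q \<beta>\<close>.\<close>
  have row: "row_mult (\<theta> 1 x ?p) g c
      = row_mult (x ?p) g c + row_mult (x ?q) g c - (if c = \<beta> then x ?q \<beta> else 0)"
    if "g \<in> mclain_ring" "c \<le> \<beta>" for g x c
    using that by (simp add: \<theta>_p row_mult_add row_mult_trunc_below)
  have comm: "\<theta> 1 (\<tau> g x) = \<tau> g (\<theta> 1 x)" if g: "g \<in> carrier mclain_group" and x: "x \<in> X" for g x
  proof (rule PiE_ext)
    show "\<theta> 1 (\<tau> g x) \<in> PiE D elem_X" "\<tau> g (\<theta> 1 x) \<in> PiE D elem_X"
      using \<theta>X \<tau>_closed[OF g] x by (simp_all add: X_def[symmetric])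
    fix d assume d: "d \<in> D"
    show "\<theta> 1 (\<tau> g x) d = \<tau> g (\<theta> 1 x) d"
    proof (cases "d = ?p")
      case True
      have "\<theta> 1 (\<tau> g x) ?p c = \<tau> g (\<theta> 1 x) ?p c" for c
        using g row[of g c x] ov
        by (auto simp: \<theta>_p[of 1 "\<tau> g x"] \<tau>_apply[OF p] \<tau>_apply[OF q] trunc_below_def)
      then show ?thesis unfolding True by blast
    next
      case False
      obtain a b where ab: "d = (a, b)" by (cases d)
      show ?thesis
        using \<tau>_apply[of a b] d False by (simp add: \<theta>_other ab)
    qed
  qed
  have mk: "m x * k g (\<theta> 1 x) = k g x * m (\<tau> g x)"
    if g: "g \<in> carrier mclain_group" and x: "x \<in> X" for g x
  proof -
    define K where "K = (\<Prod>d\<in>D - {?p}. f d (row_mult (x d) g (snd d)))"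
    have "(\<Prod>d\<in>D - {?p}. f d (row_mult (\<theta> 1 x d) g (snd d))) = K"
      unfolding K_def by (rule prod.cong) (auto simp: \<theta>_other)
    then have k\<theta>: "k g (\<theta> 1 x) = f ?p (row_mult (\<theta> 1 x ?p) g \<beta>) * K"
      unfolding k_eq using prod.remove[OF basic(1) p, of "\<lambda>d. f d (row_mult (\<theta> 1 x d) g (snd d))"]
      by simp
    have k: "k g x = f ?p (row_mult (x ?p) g \<beta>) * K"
      unfolding k_eq K_def using prod.remove[OF basic(1) p, of "\<lambda>d. f d (row_mult (x d) g (snd d))"]
      by simp
    have m: "m (\<tau> g x) = f ?p (row_mult (x ?q) g \<beta>)"
      using ov by (simp add: m_def \<tau>_apply[OF q] trunc_below_def)
    \<comment> \<open>Both sides are \<open>f ?p\<close> of the same sum, because the factor m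
      restores the entry lost by truncation.\<close>
    have "f ?p (x ?q \<beta>) * f ?p (row_mult (\<theta> 1 x ?p) g \<beta>)
        = f ?p (row_mult (x ?p) g \<beta>) * f ?p (row_mult (x ?q) g \<beta>)"
      unfolding f_char(1)[OF p, symmetric] using g row[of g \<beta> x] by simp
    then show ?thesis unfolding k\<theta> k m by (simp add: m_def mult_ac)
  qed
  have w: "m x * w x = w (\<theta> 1 x)" if x: "x \<in> X" for x
    using X_D(3)[OF x q] ov
    by (simp add: m_def w_def \<theta>_p \<theta>_other[OF pq] trunc_below_def f_char(1)[OF p, symmetric]
        algebra_simps)
  have ne: "\<theta> 1 base_point \<noteq> base_point"
  proof
    assume "\<theta> 1 base_point = base_point"
    from fun_cong[OF fun_cong[OF this, of ?p], of \<gamma>]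
    show False using X_D(3)[OF base_point_mem q] ov by (simp add: \<theta>_p trunc_below_def)
  qed
  have nz: "m x \<noteq> 0" "w x \<noteq> 0" for x using f_char(2)[OF p] by (simp_all add: m_def w_def)
  show "\<not> irreducible_rep mclain_group (mono_rep X k \<tau>)"
    by (rule not_irreducible_if_symmetric[OF bij base_point_mem ne nz(2,1) w comm mk])
  show "\<exists>\<phi>\<in>carrier (hom_space mclain_group (mono_rep X k \<tau>) (mono_rep X k \<tau>)).
      \<not> (\<exists>c. \<forall>x\<in>fin_fun X. \<phi> x = (\<lambda>y. c * x y))"
    by (rule nonscalar_if_symmetric[OF bij base_point_mem ne nz(2,1) w comm mk])
qed

text \<open>Overlapping is symmetric, so the two pairs may be named in the order of their left
  ends.\<close>

lemma overlappingE:
  assumes "\<not> non_overlapping D"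
  obtains \<alpha> \<beta> \<gamma> \<delta> where "(\<alpha>, \<beta>) \<in> D" "(\<gamma>, \<delta>) \<in> D" "\<alpha> < \<gamma>" "\<gamma> < \<beta>" "\<beta> < \<delta>"
  using assms unfolding non_overlapping_def overlapping_def by fast

lemma irreducible_iff: "irreducible_rep mclain_group (basic_rep D f) \<longleftrightarrow> non_overlapping D"
proof -
  obtain \<Psi> where \<Psi>: "rep_iso mclain_group (mono_rep X k \<tau>) (basic_rep D f) \<Psi>"
    by (rule basic_rep_model)
  have "irreducible_rep mclain_group (mono_rep X k \<tau>) \<longleftrightarrow> non_overlapping D"
  proof
    assume "irreducible_rep mclain_group (mono_rep X k \<tau>)"
    then show "non_overlapping D"
      using overlapping_not_irreducible by (meson overlappingE)
  qed (rule irreducible_if_separated[OF base_point_mem base_point_transitive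
        non_overlapping_separated])
  then show ?thesis using irreducible_rep_iso_iff[OF linear_rep_mono \<Psi>] by simp
qed

lemma intertwining_number_iff:
  "intertwining_number mclain_group (basic_rep D f) (basic_rep D f) = 1 \<longleftrightarrow> non_overlapping D"
proof -
  let ?W = "mono_rep X k \<tau>"
  obtain \<Psi> where \<Psi>: "rep_iso mclain_group ?W (basic_rep D f) \<Psi>"
    by (rule basic_rep_model)
  have "basis_elt base_point \<in> carrier ?W" using base_point_mem by simp
  moreover have "basis_elt base_point base_point \<noteq> \<zero>\<^bsub>?W\<^esub> base_point"
    by (simp add: basis_elt_def)
  ultimately have "carrier ?W \<noteq> {\<zero>\<^bsub>?W\<^esub>}" by (metis singletonD)
  note iff = intertwining_number_eq_1_iso[OF linear_rep_mono \<Psi> this, unfolded mono_rep_simps]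
  show ?thesis
  proof
    assume no: "non_overlapping D"
    show "intertwining_number mclain_group (basic_rep D f) (basic_rep D f) = 1"
      unfolding iff
    proof
      fix \<phi> assume "\<phi> \<in> carrier (hom_space mclain_group ?W ?W)"
      then show "\<exists>c. \<forall>x\<in>fin_fun X. \<phi> x = (\<lambda>y. c * x y)"
        by (rule scalar_if_separated[OF base_point_mem base_point_transitive
              non_overlapping_separated[OF no], rotated -1])
    qed
  next
    assume scalar: "intertwining_number mclain_group (basic_rep D f) (basic_rep D f) = 1"
    show "non_overlapping D"
    proof (rule ccontr)
      assume "\<not> non_overlapping D"
      then obtain \<alpha> \<beta> \<gamma> \<delta> where "(\<alpha>, \<beta>) \<in> D" "(\<gamma>, \<delta>) \<in> D" "\<alpha> < \<gamma>" "\<gamma> < \<beta>" "\<beta> < \<delta>"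
        by (rule overlappingE)
      from overlapping_nonscalar[OF this] scalar show False unfolding iff by blast
    qed
  qed
qed

lemma Omega_empty_iff: "Omega_set D = {} \<longleftrightarrow> non_overlapping D"
proof
  assume empty: "Omega_set D = {}"
  show "non_overlapping D"
  proof (rule ccontr)
    assume "\<not> non_overlapping D"
    then obtain \<alpha> \<beta> \<gamma> \<delta> where "(\<alpha>, \<beta>) \<in> D" "(\<gamma>, \<delta>) \<in> D" "\<alpha> < \<gamma>" "\<gamma> < \<beta>" "\<beta> < \<delta>"
      by (rule overlappingE)
    then have "(\<alpha>, \<gamma>) \<in> Omega_set D" unfolding Omega_set_def Phi_def by blast
    then show False using empty by simp
  qed
next
  assume "non_overlapping D"
  then show "Omega_set D = {}"
    unfolding non_overlapping_def overlapping_def Omega_set_def by fast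
qed

text \<open>A root of \<Omega> starts at the first end of some (\<alpha>, \<beta>) in D and stops
  before \<beta>, so it is excluded from \<Gamma>. Its root element with coefficient 1, which is
  nonzero in R, then lies in I but, by the support description of H, not in H.\<close>

lemma I_eq_H_iff: "(I_subgroup D :: ('l \<times> 'l \<Rightarrow> 'r) set) = H_subgroup D \<longleftrightarrow> Omega_set D = {}"
proof
  assume eq: "(I_subgroup D :: ('l \<times> 'l \<Rightarrow> 'r) set) = H_subgroup D"
  show "Omega_set D = {}"
  proof (rule ccontr)
    assume "Omega_set D \<noteq> {}"
    then obtain p where p: "p \<in> Omega_set D" by blast
    then have "p \<in> Phi" by (auto simp: Omega_set_def)
    then have "(root_elt 1 p :: 'l \<times> 'l \<Rightarrow> 'r) \<in> I_subgroup D"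
      unfolding I_subgroup_def using p supp_root_elt[of "1 :: 'r" p]
      by (intro mem_mclain_subgroup root_elt_mem) auto
    then have "supp (root_elt (1 :: 'r) p) \<subseteq> Gamma_set D"
      unfolding eq H_subgroup_def mclain_subgroup_eq[OF closed_Gamma_set[OF D]] by simp
    then have "p \<in> Gamma_set D" by (auto simp: root_elt_def)
    then show False using p by (auto simp: Gamma_set_def Omega_set_def)
  qed
qed (simp add: I_subgroup_def H_subgroup_def)

end

theorem theorem8p3:
  fixes D :: "('l::linorder \<times> 'l) set"
    and f :: "'l \<times> 'l \<Rightarrow> 'r::ring_1 \<Rightarrow> 'f::field"
  assumes "\<exists>\<mu> :: 'r \<Rightarrow> 'f. right_primitive \<mu>"
    and "basic_set D"
    and "\<forall>d\<in>D. right_primitive (f d)"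
  shows "(irreducible_rep mclain_group (basic_rep D f) \<longleftrightarrow> non_overlapping D) \<and>
    (non_overlapping D \<longleftrightarrow> Omega_set D = {}) \<and>
    (Omega_set D = {} \<longleftrightarrow> (I_subgroup D :: ('l \<times> 'l \<Rightarrow> 'r) set) = H_subgroup D) \<and>
    ((I_subgroup D :: ('l \<times> 'l \<Rightarrow> 'r) set) = H_subgroup D \<longleftrightarrow>
       intertwining_number mclain_group (basic_rep D f) (basic_rep D f) = 1)"
proof -
  interpret basic_data D f by unfold_locales (use assms in auto)
  show ?thesis
    using irreducible_iff intertwining_number_iff Omega_empty_iff I_eq_H_iff by simp
qed

end
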